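(* Let $k\ge1$, let $(\Omega_j,\mathcal F_j,H_j,P_j)$, $j\in\{1,\dots,k+1\}$, be projection valued measure spaces, $P=P_1\otimes\cdots\otimes P_{k+1}$ and $\boldsymbol P=(P_1,\dots,P_{k+1})$. If $\varphi\in L^\infty(\Omega_1,P_1)\hat\otimes_i\cdots\hat\otimes_iL^\infty(\Omega_{k+1},P_{k+1})$, then $$I^{\boldsymbol P}(\Sigma,\rho,\varphi_1,\dots,\varphi_{k+1})=I^{\boldsymbol P}(\tilde\Sigma,\tilde\rho,\tilde\varphi_1,\dots,\tilde\varphi_{k+1})$$ (as maps $B(H_2;H_1)\times\cdots\times B(H_{k+1};H_k)\to B(H_{k+1};H_1)$) whenever $(\Sigma,\rho,\varphi_1,\dots,\varphi_{k+1})$ and $(\tilde\Sigma,\tilde\rho,\tilde\varphi_1,\dots,\tilde\varphi_{k+1})$ are $L^\infty_P$-integral projective decompositions of $\varphi$.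
   Context: Hilbert spaces are complex (not assumed separable), inner products linear in the first argument. A projection valued measure space $(\Xi,\mathcal G,K,Q)$: $(\Xi,\mathcal G)$ measurable space, $K$ Hilbert space, $Q:\mathcal G\to B(K)$ with $Q(\Xi)=\mathrm{id}_K$, $Q(G)^2=Q(G)=Q(G)^*$, countably additive in the weak operator topology. $L^\infty(\Xi,Q)$: $Q$-a.e. classes of bounded measurable functions, $\|f\|_{L^\infty(Q)}=\inf\{c\ge0:Q(|f|>c)=0\}$. For $f\in L^\infty(\Xi,Q)$, $Q(f)\in B(K)$ is given by $\langle Q(f)h,k\rangle=\int f\,dQ_{h,k}$, $Q_{h,k}(G)=\langle Q(G)h,k\rangle$. $P=P_1\otimes\cdots\otimes P_{k+1}$ is the unique projection valued measure on $\Omega=\prod_j\Omega_j$ with the product $\sigma$-algebra, acting on the Hilbert space tensor product of the $H_j$, with $P(G_1\times\cdots\times G_{k+1})=P_1(G_1)\otimes\cdots\otimes P_{k+1}(G_{k+1})$. Upper integral of arbitrary $h:\Sigma\to[0,\infty]$: $\overline{\int_\Sigma}h\,d\rho=\inf\{\int\tilde h\,d\rho:h\le\tilde h\ \rho\text{-a.e.},\ \tilde h\text{ measurable}\}$. An $L^\infty_P$-integral projective decomposition of $\varphi:\Omega\to\mathbb C$: a tuple $(\Sigma,\rho,\varphi_1,\dots,\varphi_{k+1})$ with $(\Sigma,\mathcal H,\rho)$ $\sigma$-finite, $\varphi_j:\Omega_j\times\Sigma\to\mathbb C$ measurable, (i) $\varphi_j(\cdot,\sigma)\in L^\infty(\Omega_j,P_j)$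 for all $j,\sigma$; (ii) $\overline{\int_\Sigma}\prod_{j}\|\varphi_j(\cdot,\sigma)\|_{L^\infty(P_j)}\,\rho(d\sigma)<\infty$; (iii) $\varphi(\omega_1,\dots,\omega_{k+1})=\int_\Sigma\prod_j\varphi_j(\omega_j,\sigma)\,\rho(d\sigma)$ for $P$-a.e. $(\omega_1,\dots,\omega_{k+1})$. $L^\infty(\Omega_1,P_1)\hat\otimes_i\cdots\hat\otimes_iL^\infty(\Omega_{k+1},P_{k+1})$ is the set of $P$-a.e. classes of functions admitting such a decomposition. For $b=(b_1,\dots,b_k)$ with $b_j\in B(H_{j+1};H_j)$, $I^{\boldsymbol P}(\Sigma,\rho,\varphi_1,\dots,\varphi_{k+1})[b]:=\int_\Sigma P_1(\varphi_1(\cdot,\sigma))\,b_1\cdots P_k(\varphi_k(\cdot,\sigma))\,b_k\,P_{k+1}(\varphi_{k+1}(\cdot,\sigma))\,\rho(d\sigma)\in B(H_{k+1};H_1)$ is a pointwise Pettis integral, i.e. the unique bounded operator $T$ with $\langle Th,h'\rangle=\int_\Sigma\langle F(\sigma)h,h'\rangle\,\rho(d\sigma)$ for all $h\in H_{k+1},h'\in H_1$, $F$ being the integrand (whose matrix coefficients are measurable and integrable). *)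

theory Defs
  imports "HOL-Analysis.Analysis"
begin

section \<open>Complex Hilbert spaces\<close>

text \<open>
  A family of Hilbert spaces of variable length cannot be indexed by types, so a Hilbert space
  is a carrier set with explicit operations. Nothing is assumed about the operations outside
  the carrier.
\<close>

record 'a hilbert_data =
  vecs :: "'a set"
  vzero :: 'a
  vadd :: "'a \<Rightarrow> 'a \<Rightarrow> 'a"
  vscale :: "complex \<Rightarrow> 'a \<Rightarrow> 'a"
  vinner :: "'a \<Rightarrow> 'a \<Rightarrow> complex"

definition vdiff :: "('a, 'm) hilbert_data_scheme \<Rightarrow> 'a \<Rightarrow> 'a \<Rightarrow> 'a" where
  "vdiff H x y = vadd H x (vscale H (- 1) y)"

definition vnorm :: "('a, 'm) hilbert_data_scheme \<Rightarrow> 'a \<Rightarrow> real" where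
  "vnorm H x = sqrt (Re (vinner H x x))"

locale complex_hilbert =
  fixes H :: "'a hilbert_data"
  assumes zero_closed: "vzero H \<in> vecs H"
    and add_closed: "\<lbrakk>x \<in> vecs H; y \<in> vecs H\<rbrakk> \<Longrightarrow> vadd H x y \<in> vecs H"
    and scale_closed: "x \<in> vecs H \<Longrightarrow> vscale H a x \<in> vecs H"
    and add_assoc: "\<lbrakk>x \<in> vecs H; y \<in> vecs H; z \<in> vecs H\<rbrakk>
      \<Longrightarrow> vadd H (vadd H x y) z = vadd H x (vadd H y z)"
    and add_commute: "\<lbrakk>x \<in> vecs H; y \<in> vecs H\<rbrakk> \<Longrightarrow> vadd H x y = vadd H y x"
    and add_zero: "x \<in> vecs H \<Longrightarrow> vadd H x (vzero H) = x"
    and add_inverse: "x \<in> vecs H \<Longrightarrow> \<exists>y\<in>vecs H. vadd H x y = vzero H"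
    and scale_add_right: "\<lbrakk>x \<in> vecs H; y \<in> vecs H\<rbrakk>
      \<Longrightarrow> vscale H a (vadd H x y) = vadd H (vscale H a x) (vscale H a y)"
    and scale_add_left: "x \<in> vecs H
      \<Longrightarrow> vscale H (a + b) x = vadd H (vscale H a x) (vscale H b x)"
    and scale_scale: "x \<in> vecs H \<Longrightarrow> vscale H a (vscale H b x) = vscale H (a * b) x"
    and scale_one: "x \<in> vecs H \<Longrightarrow> vscale H 1 x = x"
    and inner_add_left: "\<lbrakk>x \<in> vecs H; y \<in> vecs H; z \<in> vecs H\<rbrakk>
      \<Longrightarrow> vinner H (vadd H x y) z = vinner H x z + vinner H y z"
    and inner_scale_left: "\<lbrakk>x \<in> vecs H; y \<in> vecs H\<rbrakk>
      \<Longrightarrow> vinner H (vscale H a x) y = a * vinner H x y"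
    and inner_cnj: "\<lbrakk>x \<in> vecs H; y \<in> vecs H\<rbrakk> \<Longrightarrow> vinner H x y = cnj (vinner H y x)"
    and inner_nonneg: "x \<in> vecs H \<Longrightarrow> 0 \<le> Re (vinner H x x)"
    and inner_definite: "\<lbrakk>x \<in> vecs H; vinner H x x = 0\<rbrakk> \<Longrightarrow> x = vzero H"
    and complete: "\<lbrakk>\<And>n. X n \<in> vecs H;
        \<forall>e>0. \<exists>N. \<forall>m\<ge>N. \<forall>n\<ge>N. vnorm H (vdiff H (X m) (X n)) < e\<rbrakk>
      \<Longrightarrow> \<exists>l\<in>vecs H. (\<lambda>n. vnorm H (vdiff H (X n) l)) \<longlonglongrightarrow> 0"

text \<open>
  \<open>B(H;K)\<close>. Operators are \<open>undefined\<close> outside the carrier, so that operators agreeing on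
  the carrier are equal.
\<close>

definition bounded_ops :: "'a hilbert_data \<Rightarrow> 'b hilbert_data \<Rightarrow> ('a \<Rightarrow> 'b) set" where
  "bounded_ops H K = {T \<in> vecs H \<rightarrow>\<^sub>E vecs K.
     (\<forall>x\<in>vecs H. \<forall>y\<in>vecs H. T (vadd H x y) = vadd K (T x) (T y)) \<and>
     (\<forall>a. \<forall>x\<in>vecs H. T (vscale H a x) = vscale K a (T x)) \<and>
     (\<exists>C. \<forall>x\<in>vecs H. vnorm K (T x) \<le> C * vnorm H x)}"

inductive_set lin_span :: "'a hilbert_data \<Rightarrow> 'a set \<Rightarrow> 'a set"
  for H :: "'a hilbert_data" and S :: "'a set" where
  span_zero: "vzero H \<in> lin_span H S"
| span_base: "x \<in> S \<Longrightarrow> x \<in> lin_span H S"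
| span_add: "\<lbrakk>x \<in> lin_span H S; y \<in> lin_span H S\<rbrakk> \<Longrightarrow> vadd H x y \<in> lin_span H S"
| span_scale: "x \<in> lin_span H S \<Longrightarrow> vscale H a x \<in> lin_span H S"

text \<open>
  \<open>(T, \<tau>)\<close> is a Hilbert space tensor product of the \<open>H j\<close>, \<open>j \<in> I\<close>, where \<open>\<tau> x\<close> is the
  elementary tensor of the family \<open>x\<close>. This determines \<open>(T, \<tau>)\<close> up to a unique unitary.
\<close>

locale hilbert_tensor = complex_hilbert T for T :: "'t hilbert_data" +
  fixes I :: "nat set" and H :: "nat \<Rightarrow> 'h hilbert_data" and \<tau> :: "(nat \<Rightarrow> 'h) \<Rightarrow> 't"
  assumes tensor_closed: "x \<in> (\<Pi>\<^sub>E j\<in>I. vecs (H j)) \<Longrightarrow> \<tau> x \<in> vecs T"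
    and tensor_add: "\<lbrakk>x \<in> (\<Pi>\<^sub>E j\<in>I. vecs (H j)); i \<in> I; u \<in> vecs (H i); v \<in> vecs (H i)\<rbrakk>
      \<Longrightarrow> \<tau> (x(i := vadd (H i) u v)) = vadd T (\<tau> (x(i := u))) (\<tau> (x(i := v)))"
    and tensor_scale: "\<lbrakk>x \<in> (\<Pi>\<^sub>E j\<in>I. vecs (H j)); i \<in> I; u \<in> vecs (H i)\<rbrakk>
      \<Longrightarrow> \<tau> (x(i := vscale (H i) a u)) = vscale T a (\<tau> (x(i := u)))"
    and tensor_inner: "\<lbrakk>x \<in> (\<Pi>\<^sub>E j\<in>I. vecs (H j)); y \<in> (\<Pi>\<^sub>E j\<in>I. vecs (H j))\<rbrakk>
      \<Longrightarrow> vinner T (\<tau> x) (\<tau> y) = (\<Prod>j\<in>I. vinner (H j) (x j) (y j))"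
    and tensor_dense: "\<lbrakk>t \<in> vecs T; 0 < e\<rbrakk>
      \<Longrightarrow> \<exists>y\<in>lin_span T (\<tau> ` (\<Pi>\<^sub>E j\<in>I. vecs (H j))). vnorm T (vdiff T t y) < e"

section \<open>Projection valued measures\<close>

text \<open>
  Only the \<open>\<sigma>\<close>-algebra of \<open>base X\<close> is relevant; its measure is ignored.
\<close>

record ('w, 'h) pvm_data =
  base :: "'w measure"
  hsp :: "'h hilbert_data"
  prj :: "'w set \<Rightarrow> 'h \<Rightarrow> 'h"

locale pvm_space =
  fixes X :: "('w, 'h) pvm_data"
  assumes hilbert: "complex_hilbert (hsp X)"
    and prj_bounded: "G \<in> sets (base X) \<Longrightarrow> prj X G \<in> bounded_ops (hsp X) (hsp X)"
    and prj_space: "h \<in> vecs (hsp X) \<Longrightarrow> prj X (space (base X)) h = h"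
    and prj_idem: "\<lbrakk>G \<in> sets (base X); h \<in> vecs (hsp X)\<rbrakk>
      \<Longrightarrow> prj X G (prj X G h) = prj X G h"
    and prj_selfadjoint: "\<lbrakk>G \<in> sets (base X); h \<in> vecs (hsp X); h' \<in> vecs (hsp X)\<rbrakk>
      \<Longrightarrow> vinner (hsp X) (prj X G h) h' = vinner (hsp X) h (prj X G h')"
    and prj_countably_additive:
      "\<lbrakk>range A \<subseteq> sets (base X); disjoint_family A; h \<in> vecs (hsp X); h' \<in> vecs (hsp X)\<rbrakk>
      \<Longrightarrow> (\<lambda>n::nat. vinner (hsp X) (prj X (A n) h) h')
            sums vinner (hsp X) (prj X (\<Union>n. A n) h) h'"

definition pvm_null :: "('w, 'h) pvm_data \<Rightarrow> 'w set \<Rightarrow> bool" where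
  "pvm_null X N \<longleftrightarrow> N \<in> sets (base X) \<and> (\<forall>h\<in>vecs (hsp X). prj X N h = vzero (hsp X))"

definition pvm_ae :: "('w, 'h) pvm_data \<Rightarrow> ('w \<Rightarrow> bool) \<Rightarrow> bool" where
  "pvm_ae X R \<longleftrightarrow> (\<exists>N. pvm_null X N \<and> (\<forall>w\<in>space (base X) - N. R w))"

text \<open>
  The \<open>Q\<close>-a.e. class of \<open>f\<close> is in \<open>L\<^sup>\<infinity>\<close>. Elements of \<open>L\<^sup>\<infinity>\<close> are represented by functions.
\<close>

definition Linf :: "('w, 'h) pvm_data \<Rightarrow> ('w \<Rightarrow> complex) set" where
  "Linf X = {f \<in> borel_measurable (base X).
     \<exists>g\<in>borel_measurable (base X). bounded (g ` space (base X)) \<and> pvm_ae X (\<lambda>w. f w = g w)}"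

definition Linf_norm :: "('w, 'h) pvm_data \<Rightarrow> ('w \<Rightarrow> complex) \<Rightarrow> real" where
  "Linf_norm X f = Inf {c. 0 \<le> c \<and> pvm_null X {w \<in> space (base X). c < norm (f w)}}"

text \<open>
  The integral of \<open>f\<close> against the complex measure \<open>\<nu>\<close> on \<open>M\<close>, by decomposing \<open>\<nu>\<close> as
  \<open>\<mu> 0 + \<i> \<mu> 1 - \<mu> 2 - \<i> \<mu> 3\<close> with finite positive measures for which \<open>f\<close> is integrable.
  The value does not depend on the decomposition, and if \<open>f\<close> is integrable with respect to the
  total variation of \<open>\<nu>\<close>, the Jordan decompositions of the real and imaginary parts of \<open>\<nu>\<close>
  provide one.
\<close>

definition complex_measure_integral ::
  "'w measure \<Rightarrow> ('w set \<Rightarrow> complex) \<Rightarrow> ('w \<Rightarrow> complex) \<Rightarrow> complex" where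
  "complex_measure_integral M \<nu> f = (THE z. \<exists>\<mu> :: nat \<Rightarrow> 'w measure.
     (\<forall>n<4. sets (\<mu> n) = sets M \<and> finite_measure (\<mu> n) \<and> integrable (\<mu> n) f) \<and>
     (\<forall>G\<in>sets M. \<nu> G = (\<Sum>n<4. \<i> ^ n * complex_of_real (measure (\<mu> n) G))) \<and>
     z = (\<Sum>n<4. \<i> ^ n * (\<integral>w. f w \<partial>\<mu> n)))"

definition pvm_integral :: "('w, 'h) pvm_data \<Rightarrow> ('w \<Rightarrow> complex) \<Rightarrow> 'h \<Rightarrow> 'h" where
  "pvm_integral X f = (THE T. T \<in> bounded_ops (hsp X) (hsp X) \<and>
     (\<forall>h\<in>vecs (hsp X). \<forall>h'\<in>vecs (hsp X). vinner (hsp X) (T h) h' =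
        complex_measure_integral (base X) (\<lambda>G. vinner (hsp X) (prj X G h) h') f))"

text \<open>
  \<open>Y\<close> is the tensor product of the projection valued measures \<open>X j\<close>, \<open>j \<in> I\<close>, acting on the
  tensor product Hilbert space \<open>(hsp Y, \<tau>)\<close>. The last assumption says that \<open>prj Y\<close> takes the
  product of the \<open>G j\<close> to the tensor product of the operators \<open>prj (X j) (G j)\<close>.
\<close>

locale product_pvm = pvm_space Y + hilbert_tensor "hsp Y" I "\<lambda>j. hsp (X j)" \<tau>
  for Y :: "(nat \<Rightarrow> 'w, 't) pvm_data" and I :: "nat set" and X :: "nat \<Rightarrow> ('w, 'h) pvm_data"
    and \<tau> :: "(nat \<Rightarrow> 'h) \<Rightarrow> 't" +
  assumes sets_product: "sets (base Y) = sets (PiM I (\<lambda>j. base (X j)))"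
    and prj_product: "\<lbrakk>\<And>j. j \<in> I \<Longrightarrow> G j \<in> sets (base (X j)); x \<in> (\<Pi>\<^sub>E j\<in>I. vecs (hsp (X j)))\<rbrakk>
      \<Longrightarrow> prj Y (\<Pi>\<^sub>E j\<in>I. G j) (\<tau> x) = \<tau> (\<lambda>j\<in>I. prj (X j) (G j) (x j))"

section \<open>Integral projective decompositions\<close>

text \<open>
  For non-measurable integrands \<open>nn_integral\<close> is a lower integral, hence this definition.
\<close>

definition upper_integral :: "'s measure \<Rightarrow> ('s \<Rightarrow> ennreal) \<Rightarrow> ennreal" where
  "upper_integral R h =
     Inf {\<integral>\<^sup>+s. g s \<partial>R | g. g \<in> borel_measurable R \<and> (AE s in R. h s \<le> g s)}"

text \<open>
  The index set is \<open>{1..k+1}\<close>, and \<open>Y\<close> is the product of \<open>X 1, \<dots>, X (k+1)\<close>. The measure space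
  \<open>R\<close> is \<open>(\<Sigma>, \<rho>)\<close>. That the integral in the last condition exists is part of the condition.
\<close>

definition Linf_decomposition ::
  "nat \<Rightarrow> (nat \<Rightarrow> ('w, 'h) pvm_data) \<Rightarrow> (nat \<Rightarrow> 'w, 't) pvm_data \<Rightarrow> ((nat \<Rightarrow> 'w) \<Rightarrow> complex)
    \<Rightarrow> 's measure \<Rightarrow> (nat \<Rightarrow> 'w \<Rightarrow> 's \<Rightarrow> complex) \<Rightarrow> bool" where
  "Linf_decomposition k X Y \<phi> R f \<longleftrightarrow>
     sigma_finite_measure R \<and>
     (\<forall>j\<in>{1..k+1}. (\<lambda>(w, s). f j w s) \<in> borel_measurable (base (X j) \<Otimes>\<^sub>M R)) \<and>
     (\<forall>j\<in>{1..k+1}. \<forall>s\<in>space R. (\<lambda>w. f j w s) \<in> Linf (X j)) \<and>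
     upper_integral R (\<lambda>s. ennreal (\<Prod>j\<in>{1..k+1}. Linf_norm (X j) (\<lambda>w. f j w s))) < \<infinity> \<and>
     pvm_ae Y (\<lambda>\<omega>. integrable R (\<lambda>s. \<Prod>j\<in>{1..k+1}. f j (\<omega> j) s) \<and>
                    \<phi> \<omega> = (\<integral>s. (\<Prod>j\<in>{1..k+1}. f j (\<omega> j) s) \<partial>R))"

text \<open>
  The integral projective tensor product of the \<open>L\<^sup>\<infinity>\<close>-spaces, each class being represented by all
  of its members. A set of the logic cannot range over measure spaces of all types, so the type
  that carries \<open>\<Sigma>\<close> is a parameter.
\<close>

definition Linf_tensor ::
  "'s itself \<Rightarrow> nat \<Rightarrow> (nat \<Rightarrow> ('w, 'h) pvm_data) \<Rightarrow> (nat \<Rightarrow> 'w, 't) pvm_data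
    \<Rightarrow> ((nat \<Rightarrow> 'w) \<Rightarrow> complex) set" where
  "Linf_tensor S k X Y = {\<phi>. \<exists>(R :: 's measure) f. Linf_decomposition k X Y \<phi> R f}"

section \<open>Multiple operator integrals\<close>

definition pettis_integral ::
  "'a hilbert_data \<Rightarrow> 'b hilbert_data \<Rightarrow> 's measure \<Rightarrow> ('s \<Rightarrow> 'a \<Rightarrow> 'b) \<Rightarrow> 'a \<Rightarrow> 'b" where
  "pettis_integral H K R F = (THE T. T \<in> bounded_ops H K \<and>
     (\<forall>h\<in>vecs H. \<forall>h'\<in>vecs K. integrable R (\<lambda>s. vinner K (F s h) h') \<and>
        vinner K (T h) h' = (\<integral>s. vinner K (F s h) h' \<partial>R)))"

text \<open>\<open>alternating_product A b k = A 1 \<circ> b 1 \<circ> A 2 \<circ> \<dots> \<circ> A k \<circ> b k \<circ> A (k + 1)\<close>\<close>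

primrec alternating_product ::
  "(nat \<Rightarrow> 'h \<Rightarrow> 'h) \<Rightarrow> (nat \<Rightarrow> 'h \<Rightarrow> 'h) \<Rightarrow> nat \<Rightarrow> 'h \<Rightarrow> 'h" where
  "alternating_product A b 0 = A 1"
| "alternating_product A b (Suc n) = alternating_product A b n \<circ> b (Suc n) \<circ> A (Suc n + 1)"

definition multiple_operator_integral ::
  "nat \<Rightarrow> (nat \<Rightarrow> ('w, 'h) pvm_data) \<Rightarrow> 's measure \<Rightarrow> (nat \<Rightarrow> 'w \<Rightarrow> 's \<Rightarrow> complex)
    \<Rightarrow> (nat \<Rightarrow> 'h \<Rightarrow> 'h) \<Rightarrow> 'h \<Rightarrow> 'h" where
  "multiple_operator_integral k X R f =
     (\<lambda>b \<in> (\<Pi>\<^sub>E j\<in>{1..k}. bounded_ops (hsp (X (j + 1))) (hsp (X j))).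
        pettis_integral (hsp (X (k + 1))) (hsp (X 1)) R
          (\<lambda>s. alternating_product (\<lambda>j. pvm_integral (X j) (\<lambda>w. f j w s)) b k))"

end

theory Submission
  imports Defs
begin

text \<open>
  Fix operators \<open>b\<close> and vectors \<open>h\<close>, \<open>h'\<close>, and write \<open>A\<^sub>j(\<sigma>) = P\<^sub>j(\<phi>\<^sub>j(\<cdot>,\<sigma>))\<close>. The Pettis integral is the only
  bounded operator with matrix coefficients \<open>\<integral>\<langle>A\<^sub>1(\<sigma>) b\<^sub>1 \<cdots> b\<^sub>k A\<^sub>k\<^sub>+\<^sub>1(\<sigma>) h, h'\<rangle> \<rho>(d\<sigma>)\<close>, so it suffices that
  these numbers exist and agree for the two decompositions (\<open>matrix_coefficients_eq\<close>).

  If all \<open>b\<^sub>j\<close> are of rank one, the integrand is a product \<open>\<Prod>\<^sub>j \<langle>A\<^sub>j(\<sigma>) v\<^sub>j, u\<^sub>j\<rangle>\<close>. By polarization one may take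
  \<open>u\<^sub>j = v\<^sub>j = x\<^sub>j\<close>. Then the product is the integral of \<open>\<Prod>\<^sub>j \<phi>\<^sub>j(\<omega>\<^sub>j,\<sigma>)\<close> over the product of the positive
  measures \<open>\<langle>P\<^sub>j(\<cdot>) x\<^sub>j, x\<^sub>j\<rangle>\<close>, which is the measure \<open>\<langle>P(\<cdot>) x, x\<rangle>\<close> of the elementary tensor \<open>x\<close>
  (\<open>pvm_measure_product\<close>). By Fubini's theorem the integral over \<open>\<sigma>\<close> becomes the integral of \<open>\<phi>\<close>
  against this measure, whatever the decomposition (\<open>integral_product_diagonal\<close>).

  To pass to arbitrary \<open>b\<^sub>j\<close>, one expands the vector \<open>A\<^sub>j\<^sub>+\<^sub>1(\<sigma>) v\<close> to which \<open>b\<^sub>j\<close> is applied along an orthonormal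
  sequence, which writes the integrand as a series of integrands with \<open>b\<^sub>j\<close> replaced by operators of rank
  one; dominated convergence permits integration term by term (\<open>mixed_coefficient_sums\<close>), and an
  induction frees one \<open>b\<^sub>j\<close> after the other. An orthonormal basis of a nonseparable space is
  uncountable, and dominated convergence fails for nets. But \<open>\<phi>\<^sub>j\<^sub>+\<^sub>1\<close> is measurable on a product \<open>\<sigma>\<close>-algebra, so all its
  sections are measurable with respect to one countably generated \<open>\<sigma>\<close>-algebra
  (\<open>measurable_sections_countably_generated\<close>). Hence for fixed \<open>v\<close> the vectors \<open>A\<^sub>j\<^sub>+\<^sub>1(\<sigma>) v\<close>, for all \<open>\<sigma>\<close> and
  for both decompositions, lie in one separable subspace, and one sequence, obtained by the
  Gram--Schmidt process, expands all of them (\<open>countable_expansion\<close>).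

  The operators \<open>P\<^sub>j(f)\<close> are defined by description. That they exist, with the expected matrix
  coefficients, is proved by the Riesz representation theorem (\<open>pvm_integral\<close>).
\<close>


section \<open>Geometry of Hilbert spaces\<close>

context complex_hilbert
begin

lemma inner_add_right:
  "\<lbrakk>x \<in> vecs H; y \<in> vecs H; z \<in> vecs H\<rbrakk> \<Longrightarrow> vinner H x (vadd H y z) = vinner H x y + vinner H x z"
  by (metis add_closed complex_cnj_add inner_add_left inner_cnj)

lemma inner_scale_right:
  "\<lbrakk>x \<in> vecs H; y \<in> vecs H\<rbrakk> \<Longrightarrow> vinner H x (vscale H a y) = cnj a * vinner H x y"
  by (metis complex_cnj_mult inner_cnj inner_scale_left scale_closed)

lemma inner_zero_left: "x \<in> vecs H \<Longrightarrow> vinner H (vzero H) x = 0"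
  using inner_add_left[of "vzero H" "vzero H" x] by (simp add: zero_closed add_zero)

lemma inner_zero_right: "x \<in> vecs H \<Longrightarrow> vinner H x (vzero H) = 0"
  by (metis complex_cnj_zero inner_cnj inner_zero_left zero_closed)

lemma diff_closed: "\<lbrakk>x \<in> vecs H; y \<in> vecs H\<rbrakk> \<Longrightarrow> vdiff H x y \<in> vecs H"
  by (simp add: vdiff_def add_closed scale_closed)

lemma inner_diff_left:
  "\<lbrakk>x \<in> vecs H; y \<in> vecs H; z \<in> vecs H\<rbrakk> \<Longrightarrow> vinner H (vdiff H x y) z = vinner H x z - vinner H y z"
  by (simp add: vdiff_def scale_closed inner_add_left inner_scale_left)

lemma inner_diff_right:
  "\<lbrakk>x \<in> vecs H; y \<in> vecs H; z \<in> vecs H\<rbrakk> \<Longrightarrow> vinner H z (vdiff H x y) = vinner H z x - vinner H z y"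
  by (simp add: vdiff_def scale_closed inner_add_right inner_scale_right)

lemmas closed_simps = zero_closed add_closed scale_closed diff_closed

lemmas inner_simps = inner_add_left inner_add_right inner_scale_left inner_scale_right
  inner_zero_left inner_zero_right inner_diff_left inner_diff_right

lemma inner_self: "x \<in> vecs H \<Longrightarrow> vinner H x x = complex_of_real ((vnorm H x)\<^sup>2)"
  using inner_nonneg[of x] inner_cnj[of x x]
  by (simp add: vnorm_def complex_eq_iff)

lemma norm_nonneg: "x \<in> vecs H \<Longrightarrow> 0 \<le> vnorm H x"
  by (simp add: vnorm_def inner_nonneg)

lemma norm_sq: "x \<in> vecs H \<Longrightarrow> (vnorm H x)\<^sup>2 = Re (vinner H x x)"
  by (simp add: inner_self)

lemma norm_eq_zero: "x \<in> vecs H \<Longrightarrow> vnorm H x = 0 \<longleftrightarrow> x = vzero H"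
  using inner_self[of x] inner_definite[of x] inner_zero_left[of x] by (auto simp: vnorm_def)

text \<open>
  Most vector identities below are read off from inner products, so that the vector space axioms
  need not be used directly.
\<close>

lemma vector_eqI:
  assumes "x \<in> vecs H" "y \<in> vecs H" "\<And>z. z \<in> vecs H \<Longrightarrow> vinner H x z = vinner H y z"
  shows "x = y"
proof -
  let ?d = "vdiff H x y"
  have d: "?d \<in> vecs H" using assms by (simp add: diff_closed)
  have "vinner H ?d ?d = 0" using assms d by (simp add: inner_diff_left)
  then have "?d = vzero H" using d inner_definite by blast
  then have "vadd H ?d y = vadd H (vzero H) y" by simp
  moreover have "vadd H (vscale H (-1) y) y = vzero H"
  proof -
    have "vadd H (vscale H (-1) y) (vscale H 1 y) = vscale H 0 y"
      using scale_add_left[OF assms(2), of "-1" 1] by simp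
    moreover have "vscale H 0 y = vzero H"
      using inner_definite[of "vscale H 0 y"] assms(2) by (simp add: inner_simps closed_simps)
    ultimately show ?thesis using assms(2) by (simp add: scale_one)
  qed
  ultimately show ?thesis
    using assms by (simp add: vdiff_def add_assoc closed_simps add_zero add_commute[of "vzero H"])
qed

lemma norm_scale: "x \<in> vecs H \<Longrightarrow> vnorm H (vscale H a x) = norm a * vnorm H x"
proof -
  assume x: "x \<in> vecs H"
  have "(vnorm H (vscale H a x))\<^sup>2 = (norm a * vnorm H x)\<^sup>2"
    using x by (simp add: norm_sq inner_simps closed_simps power_mult_distrib cmod_power2)
      (simp add: inner_self power2_eq_square algebra_simps)
  then show ?thesis using x by (simp add: norm_nonneg closed_simps)
qed

lemma Cauchy_Schwarz:
  assumes x: "x \<in> vecs H" and y: "y \<in> vecs H"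
  shows "norm (vinner H x y) \<le> vnorm H x * vnorm H y"
proof (cases "y = vzero H")
  case True
  then show ?thesis using x norm_nonneg y by (simp add: inner_simps)
next
  case False
  let ?i = "vinner H x y"
  let ?n = "(vnorm H y)\<^sup>2"
  have n: "?n > 0" using False norm_eq_zero[OF y] by simp
  let ?z = "vdiff H x (vscale H (?i / of_real ?n) y)"
  have z: "?z \<in> vecs H" using x y by (simp add: closed_simps)
  have yx: "vinner H y x = cnj ?i" using inner_cnj[OF y x] .
  have "vinner H ?z ?z = of_real ((vnorm H x)\<^sup>2) - ?i * cnj ?i / of_real ?n"
    using x y n by (simp add: inner_simps closed_simps inner_self[OF x] inner_self[OF y] yx)
  also have "\<dots> = of_real ((vnorm H x)\<^sup>2 - (norm ?i)\<^sup>2 / ?n)"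
    by (simp flip: complex_norm_square)
  finally have "0 \<le> (vnorm H x)\<^sup>2 - (norm ?i)\<^sup>2 / ?n"
    using inner_nonneg[OF z] by simp
  then have "(norm ?i)\<^sup>2 \<le> (vnorm H x * vnorm H y)\<^sup>2"
    using n by (simp add: divide_simps power_mult_distrib)
  then show ?thesis
    by (rule power2_le_imp_le) (simp add: norm_nonneg x y)
qed

text \<open>
  How a bound on a sesquilinear form passes to the operator it represents: test the image \<open>x\<close> against itself.
\<close>

lemma norm_le_of_inner_self:
  assumes x: "x \<in> vecs H" and C: "0 \<le> C" "norm (vinner H x x) \<le> C * vnorm H x"
  shows "vnorm H x \<le> C"
proof (cases "vnorm H x = 0")
  case False
  then have "vnorm H x > 0" using norm_nonneg[OF x] by simp
  moreover have "vnorm H x * vnorm H x \<le> C * vnorm H x"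
    using C(2) inner_self[OF x] by (simp add: norm_power power2_eq_square norm_mult)
  ultimately show ?thesis by simp
qed (use C in simp)

lemma tendsto_inner_left:
  assumes "\<And>n. a n \<in> vecs H" "l \<in> vecs H" "y \<in> vecs H"
    and lim: "(\<lambda>n. vnorm H (vdiff H (a n) l)) \<longlonglongrightarrow> 0"
  shows "(\<lambda>n. vinner H (a n) y) \<longlonglongrightarrow> vinner H l y"
proof (rule Lim_transform2[OF tendsto_const])
  have "(\<lambda>n. vinner H (vdiff H (a n) l) y) \<longlonglongrightarrow> 0"
  proof (rule Lim_null_comparison)
    show "\<forall>\<^sub>F n in sequentially.
        norm (vinner H (vdiff H (a n) l) y) \<le> vnorm H (vdiff H (a n) l) * vnorm H y"
      using assms by (simp add: Cauchy_Schwarz closed_simps)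
    show "(\<lambda>n. vnorm H (vdiff H (a n) l) * vnorm H y) \<longlonglongrightarrow> 0"
      using tendsto_mult_left_zero[OF lim] .
  qed
  then have "(\<lambda>n. - vinner H (vdiff H (a n) l) y) \<longlonglongrightarrow> - 0"
    by (rule tendsto_minus)
  then show "(\<lambda>n. vinner H l y - vinner H (a n) y) \<longlonglongrightarrow> 0"
    using assms by (simp add: inner_diff_left)
qed

text \<open>
  The vector \<open>z\<close> is the minimizer of \<open>J x = \<parallel>x\<parallel>\<^sup>2 - 2 Re (p x)\<close>. By the parallelogram law a
  minimizing sequence is Cauchy, and comparing \<open>J\<close> at a point of the sequence with its values in
  direction \<open>x\<close> bounds the defect \<open>\<langle>a k, x\<rangle> - p x\<close> in terms of the distance of \<open>J (a k)\<close> from the infimum.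
\<close>

lemma riesz_representation:
  assumes add: "\<And>x y. \<lbrakk>x \<in> vecs H; y \<in> vecs H\<rbrakk> \<Longrightarrow> p (vadd H x y) = p x + p y"
    and scale: "\<And>a x. x \<in> vecs H \<Longrightarrow> p (vscale H a x) = cnj a * p x"
    and bound: "\<And>x. x \<in> vecs H \<Longrightarrow> norm (p x) \<le> C * vnorm H x"
  shows "\<exists>z\<in>vecs H. \<forall>x\<in>vecs H. vinner H z x = p x"
proof -
  define J where "J x = (vnorm H x)\<^sup>2 - 2 * Re (p x)" for x
  define m where "m = Inf (J ` vecs H)"
  have low: "- C\<^sup>2 \<le> J x" if "x \<in> vecs H" for x
  proof -
    have "Re (p x) \<le> C * vnorm H x" using bound[OF that] complex_Re_le_cmod[of "p x"] by linarith
    then show ?thesis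
      using zero_le_power2[of "vnorm H x - C"] by (simp add: J_def power2_eq_square algebra_simps)
  qed
  have bdd: "bdd_below (J ` vecs H)" using low by (auto intro!: bdd_belowI2)
  have m: "m \<le> J x" if "x \<in> vecs H" for x
    unfolding m_def using bdd that by (simp add: cINF_lower)
  have "\<exists>x\<in>vecs H. J x < m + inverse (real (Suc n))" for n
    using cInf_lessD[of "J ` vecs H" "m + inverse (real (Suc n))"] zero_closed
    by (auto simp: m_def)
  then obtain a where a: "\<And>n. a n \<in> vecs H" "\<And>n. J (a n) < m + inverse (real (Suc n))"
    by metis
  \<comment> \<open>The parallelogram law, \<open>J\<close> being at least \<open>m\<close> at the midpoint.\<close>
  have par: "(vnorm H (vdiff H x y))\<^sup>2 \<le> 2 * (J x - m) + 2 * (J y - m)"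
    if x: "x \<in> vecs H" and y: "y \<in> vecs H" for x y
  proof -
    let ?z = "vscale H (1/2) (vadd H x y)"
    have "(vnorm H (vdiff H x y))\<^sup>2 = 2 * J x + 2 * J y - 4 * J ?z"
      using x y by (simp add: J_def norm_sq closed_simps inner_simps add scale algebra_simps)
    then show ?thesis using m[of ?z] x y by (simp add: closed_simps)
  qed
  have J_shift: "J (vadd H y (vscale H t x)) =
      J y + 2 * Re (cnj t * (vinner H y x - p x)) + (norm t)\<^sup>2 * (vnorm H x)\<^sup>2"
    if y: "y \<in> vecs H" and x: "x \<in> vecs H" for x y t
  proof -
    have "vinner H (vadd H y (vscale H t x)) (vadd H y (vscale H t x)) =
        vinner H y y + cnj t * vinner H y x + t * vinner H x y + t * cnj t * vinner H x x"
      using x y by (simp add: inner_simps closed_simps algebra_simps)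
    also have "t * cnj t * vinner H x x = of_real ((norm t)\<^sup>2 * (vnorm H x)\<^sup>2)"
      using inner_self[OF x] complex_norm_square[of t] by simp
    also have "t * vinner H x y = cnj (cnj t * vinner H y x)"
      using inner_cnj[OF x y] by simp
    finally have "Re (vinner H (vadd H y (vscale H t x)) (vadd H y (vscale H t x))) =
        Re (vinner H y y) + 2 * Re (cnj t * vinner H y x) + (norm t)\<^sup>2 * (vnorm H x)\<^sup>2"
      by (simp only: plus_complex.sel cnj.sel Re_complex_of_real)
    moreover have "vadd H y (vscale H t x) \<in> vecs H" using x y by (simp add: closed_simps)
    ultimately show ?thesis
      using x y unfolding J_def by (simp only: norm_sq[of "vadd H _ _"] norm_sq[of y] closed_simps add scale)
        (simp add: algebra_simps)
  qed
  have "\<exists>z\<in>vecs H. (\<lambda>n. vnorm H (vdiff H (a n) z)) \<longlonglongrightarrow> 0"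
  proof (rule complete[OF a(1)], intro allI impI)
    fix e :: real assume e: "e > 0"
    obtain N where N: "inverse (real (Suc N)) < e\<^sup>2 / 4"
      using reals_Archimedean[of "e\<^sup>2 / 4"] e by auto
    show "\<exists>N. \<forall>i\<ge>N. \<forall>j\<ge>N. vnorm H (vdiff H (a i) (a j)) < e"
    proof (intro exI allI impI)
      fix i j assume ij: "N \<le> i" "N \<le> j"
      have "inverse (real (Suc i)) \<le> inverse (real (Suc N))"
           "inverse (real (Suc j)) \<le> inverse (real (Suc N))"
        using ij by (auto intro!: le_imp_inverse_le)
      moreover have "J (a i) < m + inverse (real (Suc i))" "J (a j) < m + inverse (real (Suc j))"
        using a(2) by blast+
      ultimately have "J (a i) - m < e\<^sup>2 / 4" "J (a j) - m < e\<^sup>2 / 4"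
        using N by argo+
      then have "(vnorm H (vdiff H (a i) (a j)))\<^sup>2 < e\<^sup>2"
        using par[OF a(1) a(1), of i j] by argo
      then show "vnorm H (vdiff H (a i) (a j)) < e"
        using e by (simp add: power_less_imp_less_base)
    qed
  qed
  then obtain z where z: "z \<in> vecs H" "(\<lambda>n. vnorm H (vdiff H (a n) z)) \<longlonglongrightarrow> 0"
    by blast
  have "vinner H z x = p x" if x: "x \<in> vecs H" for x
  proof (cases "x = vzero H")
    case True
    then show ?thesis
      using z x scale[OF x, of 0] norm_eq_zero[OF x] bound[OF x] by (simp add: inner_simps)
  next
    case False
    let ?n = "(vnorm H x)\<^sup>2"
    have n: "?n > 0" using False norm_eq_zero[OF x] by simp
    have est: "norm (vinner H (a k) x - p x) \<le> sqrt (?n * inverse (real (Suc k)))" for k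
    proof -
      let ?w = "vinner H (a k) x - p x"
      \<comment> \<open>The step length that minimizes \<open>J\<close> on the line through \<open>a k\<close> in direction \<open>x\<close>.\<close>
      let ?t = "- ?w / of_real ?n"
      let ?y = "vadd H (a k) (vscale H ?t x)"
      have "J ?y = J (a k) + 2 * Re (cnj ?t * ?w) + (norm ?t)\<^sup>2 * ?n"
        using J_shift[OF a(1) x] .
      also have "Re (cnj ?t * ?w) = - (norm ?w)\<^sup>2 / ?n"
      proof -
        have "cnj (- w / of_real c) * w = - of_real ((norm w)\<^sup>2 / c)" for w :: complex and c
          using complex_norm_square[of w] by (simp add: mult.commute)
        from this[of ?w ?n] show ?thesis by simp
      qed
      also have "(norm ?t)\<^sup>2 * ?n = (norm ?w)\<^sup>2 / ?n"
      proof -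
        have "(norm (- w / complex_of_real c))\<^sup>2 * c = (norm w)\<^sup>2 / c" if "c > 0" for w c
          using that by (simp add: norm_divide power_divide) (simp add: power2_eq_square)
        from this[of ?n ?w] n show ?thesis by simp
      qed
      finally have "J ?y = J (a k) - (norm ?w)\<^sup>2 / ?n" by simp
      moreover have "m \<le> J ?y" using m x a(1) by (simp add: closed_simps)
      ultimately have "(norm ?w)\<^sup>2 / ?n \<le> inverse (real (Suc k))" using a(2)[of k] by linarith
      then have "(norm ?w)\<^sup>2 \<le> ?n * inverse (real (Suc k))"
        using n by (simp add: divide_simps mult.commute)
      then show ?thesis by (rule real_le_rsqrt)
    qed
    have "(\<lambda>k. sqrt (?n * inverse (real (Suc k)))) \<longlonglongrightarrow> sqrt (?n * 0)"
      by (intro tendsto_intros LIMSEQ_inverse_real_of_nat)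
    then have sq: "(\<lambda>k. sqrt (?n * inverse (real (Suc k)))) \<longlonglongrightarrow> 0"
      by (simp only: mult_zero_right real_sqrt_zero)
    have "(\<lambda>k. vinner H (a k) x - p x) \<longlonglongrightarrow> 0"
      by (rule Lim_null_comparison[OF _ sq]) (rule always_eventually, rule allI, rule est)
    then have "(\<lambda>k. vinner H (a k) x) \<longlonglongrightarrow> p x"
      by (rule LIM_zero_cancel)
    then show ?thesis
      by (rule LIMSEQ_unique[OF tendsto_inner_left[OF a(1) z(1) x z(2)]])
  qed
  then show ?thesis using z(1) by blast
qed

end


section \<open>Orthonormal expansions\<close>

primrec fourier :: "'a hilbert_data \<Rightarrow> (nat \<Rightarrow> 'a) \<Rightarrow> nat \<Rightarrow> 'a \<Rightarrow> 'a" where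
  "fourier H e 0 x = vzero H"
| "fourier H e (Suc n) x = vadd H (fourier H e n x) (vscale H (vinner H x (e n)) (e n))"

text \<open>
  Zero vectors are admitted in an orthonormal sequence, so that Gram--Schmidt may be applied to
  sequences that are linearly dependent or span a finite dimensional space.
\<close>

definition orthonormal_upto :: "'a hilbert_data \<Rightarrow> (nat \<Rightarrow> 'a) \<Rightarrow> nat \<Rightarrow> bool" where
  "orthonormal_upto H e n \<longleftrightarrow> (\<forall>i<n. e i \<in> vecs H \<and> (e i = vzero H \<or> vinner H (e i) (e i) = 1)
     \<and> (\<forall>j<n. j \<noteq> i \<longrightarrow> vinner H (e i) (e j) = 0))"

text \<open>
  The Gram--Schmidt process in terms of the projections onto the span of \<open>d 0, \<dots>, d (n - 1)\<close>. A
  residual that vanishes is normalized to the zero vector, because \<open>1 / 0 = 0\<close>.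
\<close>

primrec gram_schmidt_map :: "'a hilbert_data \<Rightarrow> (nat \<Rightarrow> 'a) \<Rightarrow> nat \<Rightarrow> 'a \<Rightarrow> 'a" where
  "gram_schmidt_map H d 0 x = vzero H"
| "gram_schmidt_map H d (Suc n) x = vadd H (gram_schmidt_map H d n x)
     (let r = vdiff H (d n) (gram_schmidt_map H d n (d n)); u = vscale H (1 / of_real (vnorm H r)) r
      in vscale H (vinner H x u) u)"

definition gram_schmidt_vec :: "'a hilbert_data \<Rightarrow> (nat \<Rightarrow> 'a) \<Rightarrow> nat \<Rightarrow> 'a" where
  "gram_schmidt_vec H d n = (let r = vdiff H (d n) (gram_schmidt_map H d n (d n))
     in vscale H (1 / of_real (vnorm H r)) r)"

context complex_hilbert
begin

lemma fourier_closed: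
  "\<lbrakk>\<And>i. i < n \<Longrightarrow> e i \<in> vecs H; x \<in> vecs H\<rbrakk> \<Longrightarrow> fourier H e n x \<in> vecs H"
  by (induction n) (simp_all add: closed_simps)

lemma inner_fourier:
  "\<lbrakk>\<And>i. i < n \<Longrightarrow> e i \<in> vecs H; x \<in> vecs H; y \<in> vecs H\<rbrakk>
    \<Longrightarrow> vinner H (fourier H e n x) y = (\<Sum>i<n. vinner H x (e i) * vinner H (e i) y)"
  by (induction n) (simp_all add: inner_simps closed_simps fourier_closed)

lemma inner_fourier_basis:
  assumes e: "orthonormal_upto H e N" and "n \<le> N" "i < N" and x: "x \<in> vecs H"
  shows "vinner H (fourier H e n x) (e i) = (if i < n then vinner H x (e i) else 0)"
proof -
  have c: "\<And>j. j < N \<Longrightarrow> e j \<in> vecs H" using e by (simp add: orthonormal_upto_def)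
  have "vinner H (fourier H e n x) (e i) = (\<Sum>j<n. vinner H x (e j) * vinner H (e j) (e i))"
    using c assms by (intro inner_fourier) auto
  also have "\<dots> = (\<Sum>j<n. if j = i then vinner H x (e i) else 0)"
    using e assms by (intro sum.cong) (auto simp: orthonormal_upto_def inner_simps)
  finally show ?thesis by simp
qed

lemma inner_fourier_fourier:
  assumes e: "orthonormal_upto H e N" and "m \<le> N" "n \<le> N" and x: "x \<in> vecs H"
  shows "vinner H (fourier H e m x) (fourier H e n x)
    = of_real (\<Sum>i<min m n. (norm (vinner H x (e i)))\<^sup>2)"
proof -
  have c: "\<And>j. j < N \<Longrightarrow> e j \<in> vecs H" using e by (simp add: orthonormal_upto_def)
  have f: "fourier H e n x \<in> vecs H" using c assms by (intro fourier_closed) auto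
  have "vinner H (fourier H e m x) (fourier H e n x)
      = (\<Sum>i<m. vinner H x (e i) * cnj (vinner H (fourier H e n x) (e i)))"
    using c assms f inner_cnj[OF c f] by (subst inner_fourier) auto
  also have "\<dots> = (\<Sum>i<m. if i < n then of_real ((norm (vinner H x (e i)))\<^sup>2) else 0)"
    using assms by (intro sum.cong) (auto simp: inner_fourier_basis complex_norm_square[symmetric])
  also have "\<dots> = (\<Sum>i<min m n. of_real ((norm (vinner H x (e i)))\<^sup>2))"
    by (intro sum.mono_neutral_cong_right) auto
  finally show ?thesis by simp
qed

lemma inner_fourier_self:
  assumes "\<And>i. i < n \<Longrightarrow> e i \<in> vecs H" "x \<in> vecs H"
  shows "vinner H (fourier H e n x) x = of_real (\<Sum>i<n. (norm (vinner H x (e i)))\<^sup>2)"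
  using assms inner_cnj[of "e _" x] by (simp add: inner_fourier complex_norm_square[symmetric])

lemma gram_schmidt_map_eq: "gram_schmidt_map H d n x = fourier H (gram_schmidt_vec H d) n x"
  by (induction n arbitrary: x) (simp_all add: gram_schmidt_vec_def Let_def)

lemma gram_schmidt_vec_closed:
  assumes "\<And>n. d n \<in> vecs H"
  shows "gram_schmidt_vec H d n \<in> vecs H"
proof (induction n rule: less_induct)
  case (less n)
  then show ?case unfolding gram_schmidt_vec_def[of H d n]
    by (simp add: gram_schmidt_map_eq Let_def closed_simps fourier_closed assms)
qed

lemma orthonormal_upto_gram_schmidt:
  assumes d: "\<And>n. d n \<in> vecs H"
  shows "orthonormal_upto H (gram_schmidt_vec H d) n"
proof (induction n)
  case 0
  then show ?case by (simp add: orthonormal_upto_def)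
next
  case (Suc n)
  let ?e = "gram_schmidt_vec H d"
  define r where "r = vdiff H (d n) (fourier H ?e n (d n))"
  have e: "?e i \<in> vecs H" for i using d by (rule gram_schmidt_vec_closed)
  have r: "r \<in> vecs H" unfolding r_def by (simp add: closed_simps fourier_closed d e)
  have en: "?e n = vscale H (1 / of_real (vnorm H r)) r"
    by (simp add: gram_schmidt_vec_def gram_schmidt_map_eq r_def Let_def)
  have unit: "?e n = vzero H \<or> vinner H (?e n) (?e n) = 1"
  proof (cases "r = vzero H")
    case True
    have "vnorm H (?e n) = 0" using True r norm_eq_zero[OF r] by (simp add: en norm_scale)
    then show ?thesis using norm_eq_zero e by blast
  next
    case False
    then have "vnorm H (?e n) = 1" using r norm_nonneg[OF r] norm_eq_zero[OF r]
      by (simp add: en norm_scale norm_divide)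
    then show ?thesis using inner_self[OF e] by simp
  qed
  have "vinner H r (?e i) = 0" if "i < n" for i
    using that inner_fourier_basis[OF Suc order_refl that d] unfolding r_def
    by (simp add: inner_simps fourier_closed d e)
  then have orth: "vinner H (?e n) (?e i) = 0" if "i < n" for i
    using that r e by (simp add: en inner_simps)
  then have "vinner H (?e i) (?e n) = 0" if "i < n" for i
    using that inner_cnj[OF e e, of i n] by simp
  then show ?case
    using Suc unit orth e by (auto simp: orthonormal_upto_def less_Suc_eq)
qed

text \<open>
  That the \<open>e i\<close> span at least as much as the \<open>d n\<close> is expressed by orthogonal complements, as in the
  hypothesis of the convergence theorem for Fourier sums.
\<close>

lemma gram_schmidt:
  fixes d :: "nat \<Rightarrow> 'a"
  assumes d: "\<And>n. d n \<in> vecs H"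
  obtains e where "\<And>n. e n \<in> vecs H" "\<And>n. orthonormal_upto H e n"
    "\<And>n y. \<lbrakk>y \<in> vecs H; \<And>i. vinner H (e i) y = 0\<rbrakk> \<Longrightarrow> vinner H (d n) y = 0"
proof
  let ?e = "gram_schmidt_vec H d"
  show e: "?e n \<in> vecs H" for n using d by (rule gram_schmidt_vec_closed)
  show "orthonormal_upto H ?e n" for n using d by (rule orthonormal_upto_gram_schmidt)
  fix n y assume y: "y \<in> vecs H" and 0: "\<And>i. vinner H (?e i) y = 0"
  define r where "r = vdiff H (d n) (fourier H ?e n (d n))"
  have f: "fourier H ?e n (d n) \<in> vecs H" by (simp add: fourier_closed d e)
  have r: "r \<in> vecs H" unfolding r_def by (simp add: closed_simps f d)
  have en: "?e n = vscale H (1 / of_real (vnorm H r)) r"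
    by (simp add: gram_schmidt_vec_def gram_schmidt_map_eq r_def Let_def)
  have "vinner H r y = 0"
  proof (cases "r = vzero H")
    case True
    then show ?thesis using y by (simp add: inner_simps)
  next
    case False
    then show ?thesis using 0[of n] r y norm_eq_zero[OF r] by (simp add: en inner_simps)
  qed
  moreover have "vinner H (fourier H ?e n (d n)) y = 0"
    using 0 by (simp add: inner_fourier e d y)
  ultimately show "vinner H (d n) y = 0"
    using y f d[of n] by (simp add: r_def inner_simps)
qed

lemma norm_fourier_sq:
  assumes e: "orthonormal_upto H e n" and x: "x \<in> vecs H"
  shows "(vnorm H (fourier H e n x))\<^sup>2 = (\<Sum>i<n. (norm (vinner H x (e i)))\<^sup>2)"
proof -
  have "fourier H e n x \<in> vecs H"
    using e x by (intro fourier_closed) (auto simp: orthonormal_upto_def)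
  then show ?thesis
    using inner_fourier_fourier[OF e order_refl order_refl x] by (simp add: norm_sq)
qed

text \<open>
  Bessel's inequality.
\<close>

lemma norm_fourier_le:
  assumes e: "orthonormal_upto H e n" and x: "x \<in> vecs H"
  shows "vnorm H (fourier H e n x) \<le> vnorm H x"
proof -
  have c: "\<And>j. j < n \<Longrightarrow> e j \<in> vecs H" using e by (simp add: orthonormal_upto_def)
  have f: "fourier H e n x \<in> vecs H" using c x by (rule fourier_closed)
  have "vinner H (vdiff H x (fourier H e n x)) (vdiff H x (fourier H e n x)) =
      of_real ((vnorm H x)\<^sup>2 - (vnorm H (fourier H e n x))\<^sup>2)"
    using x f inner_cnj[OF x f] c
    by (simp add: inner_simps closed_simps inner_self[OF x] norm_fourier_sq[OF e x]
        inner_fourier_self inner_fourier_fourier[OF e])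
  then have "(vnorm H (fourier H e n x))\<^sup>2 \<le> (vnorm H x)\<^sup>2"
    using inner_nonneg[of "vdiff H x (fourier H e n x)"] x f by (simp add: closed_simps)
  then show ?thesis by (rule power2_le_imp_le) (simp add: norm_nonneg x)
qed

text \<open>
  By Bessel's inequality the partial sums are Cauchy. If \<open>l\<close> is their limit, then \<open>x - l\<close> is
  orthogonal to all \<open>e i\<close>, hence to \<open>x\<close> by hypothesis and to \<open>l\<close> by continuity, so it vanishes. The
  hypothesis says that \<open>x\<close> is in the closed span of the \<open>e i\<close>, in a form that can be verified without
  mentioning closures.
\<close>

lemma fourier_tendsto:
  assumes e: "\<And>n. orthonormal_upto H e n" and x: "x \<in> vecs H"
    and perp: "\<And>y. \<lbrakk>y \<in> vecs H; \<And>i. vinner H (e i) y = 0\<rbrakk> \<Longrightarrow> vinner H x y = 0"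
  shows "(\<lambda>n. vnorm H (vdiff H (fourier H e n x) x)) \<longlonglongrightarrow> 0"
proof -
  have c: "e i \<in> vecs H" for i using e[of "Suc i"] by (simp add: orthonormal_upto_def)
  have f: "fourier H e n x \<in> vecs H" for n using c x by (rule fourier_closed)
  define s where "s n = (\<Sum>i<n. (norm (vinner H x (e i)))\<^sup>2)" for n
  have sn: "s n = (vnorm H (fourier H e n x))\<^sup>2" for n
    by (simp add: s_def norm_fourier_sq[OF e x])
  have "mono s" unfolding s_def by (intro monoI sum_mono2) auto
  moreover have "s n \<le> (vnorm H x)\<^sup>2" for n
    unfolding sn using norm_fourier_le[OF e x] f by (simp add: norm_nonneg power_mono)
  ultimately have "Cauchy s"
    by (intro convergent_Cauchy Bseq_mono_convergent BseqI'[where K = "(vnorm H x)\<^sup>2"])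
      (auto simp: mono_def sn)
  have diff: "(vnorm H (vdiff H (fourier H e m x) (fourier H e n x)))\<^sup>2 = \<bar>s m - s n\<bar>" for m n
  proof -
    have *: "vinner H (fourier H e i x) (fourier H e j x) = of_real (s (min i j))" for i j
      using inner_fourier_fourier[OF e _ _ x, of i "max i j" j] by (simp add: s_def)
    have "(vnorm H (vdiff H (fourier H e m x) (fourier H e n x)))\<^sup>2 = s m + s n - 2 * s (min m n)"
      using f by (simp add: norm_sq inner_simps closed_simps * min.commute)
    also have "\<dots> = \<bar>s m - s n\<bar>"
      using monoD[OF \<open>mono s\<close>, of m n] monoD[OF \<open>mono s\<close>, of n m] by (cases "m \<le> n") auto
    finally show ?thesis .
  qed
  have "\<exists>l\<in>vecs H. (\<lambda>n. vnorm H (vdiff H (fourier H e n x) l)) \<longlonglongrightarrow> 0"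
  proof (rule complete[OF f], intro allI impI)
    fix r :: real assume "r > 0"
    then obtain N where N: "\<And>m n. \<lbrakk>m \<ge> N; n \<ge> N\<rbrakk> \<Longrightarrow> \<bar>s m - s n\<bar> < r\<^sup>2"
      using metric_CauchyD[OF \<open>Cauchy s\<close>, of "r\<^sup>2"] by (auto simp: dist_real_def)
    have "vnorm H (vdiff H (fourier H e m x) (fourier H e n x)) < r" if "m \<ge> N" "n \<ge> N" for m n
      using N[OF that] \<open>r > 0\<close> unfolding diff[symmetric]
      by (simp add: power_less_imp_less_base)
    then show "\<exists>N. \<forall>m\<ge>N. \<forall>n\<ge>N. vnorm H (vdiff H (fourier H e m x) (fourier H e n x)) < r"
      by blast
  qed
  then obtain l where l: "l \<in> vecs H" "(\<lambda>n. vnorm H (vdiff H (fourier H e n x) l)) \<longlonglongrightarrow> 0"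
    by blast
  let ?y = "vdiff H x l"
  have y: "?y \<in> vecs H" using x l by (simp add: closed_simps)
  have "vinner H l (e i) = vinner H x (e i)" for i
  proof -
    have "(\<lambda>n. vinner H (fourier H e n x) (e i)) \<longlonglongrightarrow> vinner H l (e i)"
      using tendsto_inner_left[OF f l(1) c l(2)] .
    moreover have "\<forall>\<^sub>F n in sequentially. vinner H (fourier H e n x) (e i) = vinner H x (e i)"
      using inner_fourier_basis[OF e order_refl _ x]
      by (intro eventually_sequentiallyI[of "Suc i"]) simp
    ultimately show ?thesis using tendsto_unique tendsto_eventually trivial_limit_sequentially by metis
  qed
  then have "vinner H ?y (e i) = 0" for i using x l c by (simp add: inner_simps)
  then have perp_y: "vinner H (e i) ?y = 0" for i using inner_cnj[OF c y, of i] by simp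
  have "(\<lambda>n. vinner H (fourier H e n x) ?y) \<longlonglongrightarrow> vinner H l ?y"
    using tendsto_inner_left[OF f l(1) y l(2)] .
  then have "vinner H l ?y = 0"
    using perp_y by (simp add: inner_fourier c x y LIMSEQ_const_iff)
  moreover have "vinner H x ?y = 0" using perp[OF y perp_y] .
  ultimately have "vinner H ?y ?y = 0" using x l y by (simp add: inner_diff_left)
  then have "?y = vzero H" using inner_definite y by blast
  then have "x = l" using x l by (intro vector_eqI) (auto simp: inner_simps dest: inner_diff_left[of x l])
  then show ?thesis using l by simp
qed

end


section \<open>Integrals as limits of finite sums\<close>

text \<open>
  The sets \<open>G i y\<close> are the level sets of simple functions converging to \<open>f\<close>; they serve all measures
  \<open>\<mu>\<close> at once. Consequently whatever is linear in \<open>\<mu>\<close> on the sets of \<open>N\<close> is linear for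
  the integrals of \<open>f\<close>. The \<open>\<sigma>\<close>-algebra of \<open>N\<close> may be smaller than that of \<open>\<mu>\<close>, which is used for
  functions measurable with respect to a countably generated \<open>\<sigma>\<close>-algebra.
\<close>

lemma integral_limit_of_simple_sums:
  fixes f :: "'a \<Rightarrow> complex"
  assumes f: "f \<in> borel_measurable N"
  obtains S :: "nat \<Rightarrow> complex set" and G :: "nat \<Rightarrow> complex \<Rightarrow> 'a set"
  where "\<And>i. finite (S i)" "\<And>i y. G i y \<in> sets N"
    "\<And>\<mu>. \<lbrakk>finite_measure \<mu>; space \<mu> = space N; sets N \<subseteq> sets \<mu>; integrable \<mu> f\<rbrakk>
      \<Longrightarrow> (\<lambda>i. \<Sum>y\<in>S i. y * complex_of_real (measure \<mu> (G i y))) \<longlonglongrightarrow> (\<integral>x. f x \<partial>\<mu>)"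
proof -
  obtain s where s: "\<And>i. simple_function N (s i)"
      and lim: "\<And>x. x \<in> space N \<Longrightarrow> (\<lambda>i. s i x) \<longlonglongrightarrow> f x"
      and bound: "\<And>i x. x \<in> space N \<Longrightarrow> dist (s i x) 0 \<le> 2 * dist (f x) 0"
    using borel_measurable_implies_sequence_metric[OF f, of 0] by blast
  show thesis
  proof
    show "finite (s i ` space N)" for i using simple_functionD(1)[OF s] .
    show "{x \<in> space N. s i x = y} \<in> sets N" for i y
    proof -
      have "s i -` {y} \<inter> space N \<in> sets N" by (rule simple_functionD(2)[OF s])
      also have "s i -` {y} \<inter> space N = {x \<in> space N. s i x = y}" by auto
      finally show ?thesis .
    qed
    fix \<mu> assume \<mu>: "finite_measure \<mu>" "space \<mu> = space N" "sets N \<subseteq> sets \<mu>" "integrable \<mu> f"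
    interpret finite_measure \<mu> by fact
    have s': "simple_function \<mu> (s i)" for i
      using s[of i] \<mu> by (auto simp: simple_function_def)
    have sb: "Bochner_Integration.simple_bochner_integrable \<mu> (s i)" for i
      by (rule simple_bochner_integrable.intros[OF s']) (simp add: emeasure_eq_measure)
    have "(\<integral>x. s i x \<partial>\<mu>)
        = (\<Sum>y\<in>s i ` space N. y * complex_of_real (measure \<mu> {x \<in> space N. s i x = y}))" for i
      using simple_bochner_integrable_eq_integral[OF sb, of i]
      by (simp add: simple_bochner_integral_def \<mu> scaleR_conv_of_real mult.commute)
    moreover have "(\<lambda>i. \<integral>x. s i x \<partial>\<mu>) \<longlonglongrightarrow> (\<integral>x. f x \<partial>\<mu>)"
    proof (rule integral_dominated_convergence)
      show "f \<in> borel_measurable \<mu>" using \<mu>(4) by auto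
      show "s i \<in> borel_measurable \<mu>" for i using s' by (rule borel_measurable_simple_function)
      show "integrable \<mu> (\<lambda>x. 2 * norm (f x))" using \<mu>(4) by auto
      show "AE x in \<mu>. (\<lambda>i. s i x) \<longlonglongrightarrow> f x" using lim \<mu> by auto
      show "AE x in \<mu>. norm (s i x) \<le> 2 * norm (f x)" for i using bound \<mu> by auto
    qed
    ultimately show "(\<lambda>i. \<Sum>y\<in>s i ` space N. y * complex_of_real (measure \<mu> {x \<in> space N. s i x = y}))
        \<longlonglongrightarrow> (\<integral>x. f x \<partial>\<mu>)" by simp
  qed
qed

text \<open>
  The decompositions of a complex measure \<open>\<nu>\<close> over which \<^const>\<open>complex_measure_integral\<close> ranges.
\<close>

definition jordan_decomposition ::
  "'w measure \<Rightarrow> ('w set \<Rightarrow> complex) \<Rightarrow> ('w \<Rightarrow> complex) \<Rightarrow> (nat \<Rightarrow> 'w measure) \<Rightarrow> bool" where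
  "jordan_decomposition M \<nu> f \<mu> \<longleftrightarrow>
     (\<forall>n<4. sets (\<mu> n) = sets M \<and> finite_measure (\<mu> n) \<and> integrable (\<mu> n) f) \<and>
     (\<forall>G\<in>sets M. \<nu> G = (\<Sum>n<4. \<i> ^ n * complex_of_real (measure (\<mu> n) G)))"

lemma jordan_decomposition_limit:
  fixes f :: "'w \<Rightarrow> complex"
  assumes f: "f \<in> borel_measurable N" and N: "space N = space M" "sets N \<subseteq> sets M"
  obtains S :: "nat \<Rightarrow> complex set" and G :: "nat \<Rightarrow> complex \<Rightarrow> 'w set"
  where "\<And>i y. G i y \<in> sets N"
    "\<And>\<nu> \<mu>. jordan_decomposition M \<nu> f \<mu>
      \<Longrightarrow> (\<lambda>i. \<Sum>y\<in>S i. y * \<nu> (G i y)) \<longlonglongrightarrow> (\<Sum>n<4. \<i> ^ n * (\<integral>w. f w \<partial>\<mu> n))"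
proof -
  obtain S and G :: "nat \<Rightarrow> complex \<Rightarrow> 'w set"
    where "\<And>i. finite (S i)" and G: "\<And>i y. G i y \<in> sets N"
    and lim: "\<And>\<mu>. \<lbrakk>finite_measure \<mu>; space \<mu> = space N; sets N \<subseteq> sets \<mu>; integrable \<mu> f\<rbrakk>
      \<Longrightarrow> (\<lambda>i. \<Sum>y\<in>S i. y * complex_of_real (measure \<mu> (G i y))) \<longlonglongrightarrow> (\<integral>x. f x \<partial>\<mu>)"
    by (rule integral_limit_of_simple_sums[OF f]) (rule that)
  show thesis
  proof
    show "G i y \<in> sets N" for i y by (rule G)
    fix \<nu> \<mu> assume dec: "jordan_decomposition M \<nu> f \<mu>"
    have \<nu>: "\<nu> (G i y) = (\<Sum>n<4. \<i> ^ n * complex_of_real (measure (\<mu> n) (G i y)))" for i y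
      using dec subsetD[OF N(2) G[of i y]] unfolding jordan_decomposition_def by blast
    have "(\<Sum>y\<in>S i. y * \<nu> (G i y))
        = (\<Sum>n<4. \<i> ^ n * (\<Sum>y\<in>S i. y * complex_of_real (measure (\<mu> n) (G i y))))" for i
      unfolding \<nu> sum_distrib_left by (subst sum.swap) (simp add: mult.left_commute)
    moreover have "(\<lambda>i. \<Sum>n<4. \<i> ^ n * (\<Sum>y\<in>S i. y * complex_of_real (measure (\<mu> n) (G i y))))
        \<longlonglongrightarrow> (\<Sum>n<4. \<i> ^ n * (\<integral>w. f w \<partial>\<mu> n))"
    proof (intro tendsto_sum tendsto_mult tendsto_const lim)
      fix n :: nat assume "n \<in> {..<4}"
      then have d: "sets (\<mu> n) = sets M" "finite_measure (\<mu> n)" "integrable (\<mu> n) f"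
        using dec by (auto simp: jordan_decomposition_def)
      then show "finite_measure (\<mu> n)" "integrable (\<mu> n) f" "sets N \<subseteq> sets (\<mu> n)"
        "space (\<mu> n) = space N"
        using N sets_eq_imp_space_eq[OF d(1)] by auto
    qed
    ultimately show "(\<lambda>i. \<Sum>y\<in>S i. y * \<nu> (G i y)) \<longlonglongrightarrow> (\<Sum>n<4. \<i> ^ n * (\<integral>w. f w \<partial>\<mu> n))"
      by simp
  qed
qed

text \<open>
  Two decompositions of \<open>\<nu>\<close> give the same value, since both values are the limit of the same sums
  of values of \<open>\<nu>\<close>.
\<close>

lemma complex_measure_integral_eq:
  assumes f: "f \<in> borel_measurable M" and dec: "jordan_decomposition M \<nu> f \<mu>"
  shows "complex_measure_integral M \<nu> f = (\<Sum>n<4. \<i> ^ n * (\<integral>w. f w \<partial>\<mu> n))"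
proof -
  obtain S and G :: "nat \<Rightarrow> complex \<Rightarrow> 'a set"
    where "\<And>i y. G i y \<in> sets M" and lim: "\<And>\<nu> \<mu>. jordan_decomposition M \<nu> f \<mu>
      \<Longrightarrow> (\<lambda>i. \<Sum>y\<in>S i. y * \<nu> (G i y)) \<longlonglongrightarrow> (\<Sum>n<4. \<i> ^ n * (\<integral>w. f w \<partial>\<mu> n))"
    by (rule jordan_decomposition_limit[OF f refl order_refl]) (rule that)
  have "complex_measure_integral M \<nu> f
      = (THE z. \<exists>\<mu>. jordan_decomposition M \<nu> f \<mu> \<and> z = (\<Sum>n<4. \<i> ^ n * (\<integral>w. f w \<partial>\<mu> n)))"
    by (simp only: complex_measure_integral_def jordan_decomposition_def conj_assoc)
  also have "\<dots> = (\<Sum>n<4. \<i> ^ n * (\<integral>w. f w \<partial>\<mu> n))"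
  proof (rule the_equality)
    show "\<exists>\<mu>'. jordan_decomposition M \<nu> f \<mu>' \<and>
        (\<Sum>n<4. \<i> ^ n * (\<integral>w. f w \<partial>\<mu> n)) = (\<Sum>n<4. \<i> ^ n * (\<integral>w. f w \<partial>\<mu>' n))"
      using dec by blast
    fix z assume "\<exists>\<mu>. jordan_decomposition M \<nu> f \<mu> \<and> z = (\<Sum>n<4. \<i> ^ n * (\<integral>w. f w \<partial>\<mu> n))"
    then obtain \<mu>' where "jordan_decomposition M \<nu> f \<mu>'" "z = (\<Sum>n<4. \<i> ^ n * (\<integral>w. f w \<partial>\<mu>' n))"
      by blast
    then show "z = (\<Sum>n<4. \<i> ^ n * (\<integral>w. f w \<partial>\<mu> n))"
      using LIMSEQ_unique[OF lim lim[OF dec]] by simp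
  qed
  finally show ?thesis .
qed

section \<open>Countable generation of sections\<close>

text \<open>
  Although \<open>M\<close> need not be countably generated, a single set of the product \<open>\<sigma>\<close>-algebra is built from
  countably many rectangles, so all its sections lie in one countably generated \<open>\<sigma>\<close>-algebra.
\<close>

lemma sections_countably_generated:
  assumes "D \<in> sets (M \<Otimes>\<^sub>M R)"
  shows "\<exists>C. countable C \<and> C \<subseteq> sets M \<and>
    (\<forall>s\<in>space R. {w \<in> space M. (w, s) \<in> D} \<in> sigma_sets (space M) C)"
  using assms unfolding sets_pair_measure
proof (induction rule: sigma_sets.induct)
  case (Basic D)
  then obtain a b where ab: "D = a \<times> b" "a \<in> sets M" by auto
  then have "{w \<in> space M. (w, s) \<in> D} = (if s \<in> b then a else {})" for s
    using sets.sets_into_space[OF ab(2)] by auto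
  then show ?case using ab
    by (intro exI[of _ "{a}"]) (auto intro: sigma_sets.Empty sigma_sets.Basic)
next
  case Empty
  show ?case by (intro exI[of _ "{}"]) (auto intro: sigma_sets.Empty)
next
  case (Compl D)
  then obtain C where C: "countable C" "C \<subseteq> sets M"
    "\<And>s. s \<in> space R \<Longrightarrow> {w \<in> space M. (w, s) \<in> D} \<in> sigma_sets (space M) C" by blast
  have "{w \<in> space M. (w, s) \<in> space M \<times> space R - D} \<in> sigma_sets (space M) C"
    if "s \<in> space R" for s
  proof -
    have "{w \<in> space M. (w, s) \<in> space M \<times> space R - D} = space M - {w \<in> space M. (w, s) \<in> D}"
      using that by auto
    then show ?thesis using C(3)[OF that] by (simp add: sigma_sets.Compl)
  qed
  then show ?case using C by blast
next
  case (Union D)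
  define P where "P i C \<longleftrightarrow> countable C \<and> C \<subseteq> sets M \<and>
    (\<forall>s\<in>space R. {w \<in> space M. (w, s) \<in> D i} \<in> sigma_sets (space M) C)" for i :: nat and C
  have "\<forall>i. \<exists>C. P i C" using Union.IH by (simp add: P_def)
  then obtain C where "\<And>i. P i (C i)" by metis
  then have C: "\<And>i. countable (C i)" "\<And>i. C i \<subseteq> sets M"
    "\<And>i s. s \<in> space R \<Longrightarrow> {w \<in> space M. (w, s) \<in> D i} \<in> sigma_sets (space M) (C i)"
    by (simp_all add: P_def)
  have "{w \<in> space M. (w, s) \<in> (\<Union>i. D i)} \<in> sigma_sets (space M) (\<Union>i. C i)"
    if "s \<in> space R" for s
  proof -
    have "{w \<in> space M. (w, s) \<in> D i} \<in> sigma_sets (space M) (\<Union>i. C i)" for i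
      using C(3)[OF that, of i] sigma_sets_mono'[of "C i" "\<Union>i. C i" "space M"] by auto
    then have "(\<Union>i. {w \<in> space M. (w, s) \<in> D i}) \<in> sigma_sets (space M) (\<Union>i. C i)"
      by (rule sigma_sets.Union)
    also have "(\<Union>i. {w \<in> space M. (w, s) \<in> D i}) = {w \<in> space M. (w, s) \<in> (\<Union>i. D i)}" by auto
    finally show ?thesis .
  qed
  then show ?case using C by (intro exI[of _ "\<Union>i. C i"]) auto
qed

text \<open>
  The preceding lemma, applied to the preimages of the members of a countable base.
\<close>

lemma measurable_sections_countably_generated:
  fixes f :: "'a \<Rightarrow> 's \<Rightarrow> 'b::second_countable_topology"
  assumes f: "(\<lambda>(w, s). f w s) \<in> borel_measurable (M \<Otimes>\<^sub>M R)"
  obtains C where "countable C" "C \<subseteq> sets M"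
    "\<And>s. s \<in> space R \<Longrightarrow> (\<lambda>w. f w s) \<in> borel_measurable (sigma (space M) C)"
proof -
  obtain B :: "'b set set" where B: "countable B" "topological_basis B"
    using ex_countable_basis by blast
  define D where "D b = (\<lambda>(w, s). f w s) -` b \<inter> space (M \<Otimes>\<^sub>M R)" for b
  have "D b \<in> sets (M \<Otimes>\<^sub>M R)" if "b \<in> B" for b
    unfolding D_def using f topological_basis_open[OF B(2) that] by (auto intro: measurable_sets)
  moreover define P where "P b C \<longleftrightarrow> countable C \<and> C \<subseteq> sets M \<and>
    (\<forall>s\<in>space R. {w \<in> space M. (w, s) \<in> D b} \<in> sigma_sets (space M) C)" for b C
  ultimately have "\<forall>b\<in>B. \<exists>C. P b C" unfolding P_def
    by (intro ballI sections_countably_generated)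
  then obtain C where "\<And>b. b \<in> B \<Longrightarrow> P b (C b)" by metis
  then have C: "\<And>b. b \<in> B \<Longrightarrow> countable (C b)" "\<And>b. b \<in> B \<Longrightarrow> C b \<subseteq> sets M"
    "\<And>b s. \<lbrakk>b \<in> B; s \<in> space R\<rbrakk>
      \<Longrightarrow> {w \<in> space M. (w, s) \<in> D b} \<in> sigma_sets (space M) (C b)" by (simp_all add: P_def)
  have sub: "(\<Union>b\<in>B. C b) \<subseteq> Pow (space M)" using C(2) sets.space_closed[of M]
    by (auto simp: UN_subset_iff)
  show thesis
  proof
    show "countable (\<Union>b\<in>B. C b)" using B(1) C(1) by auto
    show "(\<Union>b\<in>B. C b) \<subseteq> sets M" using C(2) by auto
    fix s assume s: "s \<in> space R"
    show "(\<lambda>w. f w s) \<in> borel_measurable (sigma (space M) (\<Union>b\<in>B. C b))"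
      unfolding borel_eq_countable_basis[OF B]
    proof (rule measurable_sigma_sets)
      fix b assume b: "b \<in> B"
      have "{w \<in> space M. (w, s) \<in> D b} \<in> sigma_sets (space M) (\<Union>b\<in>B. C b)"
        using C(3)[OF b s] sigma_sets_mono'[of "C b" "\<Union>b\<in>B. C b" "space M"] b by auto
      also have "{w \<in> space M. (w, s) \<in> D b} = (\<lambda>w. f w s) -` b \<inter> space M"
        using s by (auto simp: D_def space_pair_measure)
      finally show "(\<lambda>w. f w s) -` b \<inter> space (sigma (space M) (\<Union>b\<in>B. C b))
          \<in> sets (sigma (space M) (\<Union>b\<in>B. C b))"
        using sub by (simp add: space_measure_of_conv)
    qed (auto simp: sub)
  qed
qed

text \<open>
  The sets \<open>d n\<close> are the finite intersections of members of \<open>C\<close>, the empty one being the whole space.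
\<close>

lemma countable_pi_system:
  assumes C: "countable C" "C \<subseteq> sets M"
  obtains d :: "nat \<Rightarrow> 'a set" where "range d \<subseteq> sets M" "Int_stable (range d)"
    "space M \<in> range d" "C \<subseteq> range d"
proof -
  define E where "E = (\<lambda>F. space M \<inter> \<Inter>F) ` {F. finite F \<and> F \<subseteq> C}"
  have "countable E" unfolding E_def using C(1) by (simp add: countable_Collect_finite_subset)
  moreover have sp: "space M \<in> E" unfolding E_def by (rule image_eqI[of _ _ "{}"]) auto
  ultimately have d: "range (from_nat_into E) = E"
    by (intro range_from_nat_into) auto
  have "E \<subseteq> sets M"
  proof
    fix A assume "A \<in> E"
    then obtain F where F: "A = space M \<inter> \<Inter>F" "finite F" "F \<subseteq> C" by (auto simp: E_def)
    show "A \<in> sets M"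
    proof (cases "F = {}")
      case False
      have "\<Inter>F \<in> sets M" using F(2,3) False C(2) sets.finite_INT[of F "\<lambda>x. x" M] by (simp add: subset_iff)
      then show ?thesis using F by auto
    qed (use F in auto)
  qed
  moreover have "Int_stable E"
  proof (rule Int_stableI)
    fix A B assume "A \<in> E" "B \<in> E"
    then obtain F F' where "A = space M \<inter> \<Inter>F" "finite F" "F \<subseteq> C"
      "B = space M \<inter> \<Inter>F'" "finite F'" "F' \<subseteq> C" by (auto simp: E_def)
    then show "A \<inter> B \<in> E" unfolding E_def by (intro image_eqI[of _ _ "F \<union> F'"]) (simp_all add: Inter_Un_distrib inf_assoc inf_left_commute)
  qed
  moreover have "C \<subseteq> E"
  proof
    fix A assume "A \<in> C"
    moreover have "A \<subseteq> space M" using C(2) \<open>A \<in> C\<close> by (intro sets.sets_into_space) blast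
    ultimately show "A \<in> E" unfolding E_def
      by (intro image_eqI[of _ _ "{A}"]) auto
  qed
  ultimately show thesis using that[of "from_nat_into E"] d sp by simp
qed


section \<open>Integration with respect to a projection valued measure\<close>

text \<open>
  The finite positive measure \<open>Q\<^sub>h\<^sub>,\<^sub>h\<close> of a projection valued measure \<open>Q\<close>.
\<close>

definition pvm_measure :: "('w, 'h) pvm_data \<Rightarrow> 'h \<Rightarrow> 'w measure" where
  "pvm_measure X h = measure_of (space (base X)) (sets (base X))
     (\<lambda>G. ennreal (Re (vinner (hsp X) (prj X G h) h)))"

text \<open>
  The polarization identity for a sesquilinear form \<open>q\<close> reads
  \<open>q h h' = q x\<^sub>0 x\<^sub>0 + \<i> q x\<^sub>1 x\<^sub>1 - q x\<^sub>2 x\<^sub>2 - \<i> q x\<^sub>3 x\<^sub>3\<close> with \<open>x\<^sub>n = (h + \<i>\<^sup>n h') / 2\<close>. The factor \<open>1/2\<close>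
  makes the coefficients those of \<^const>\<open>complex_measure_integral\<close>.
\<close>

definition polar_vec :: "'h hilbert_data \<Rightarrow> 'h \<Rightarrow> 'h \<Rightarrow> nat \<Rightarrow> 'h" where
  "polar_vec H h h' n = vscale H (1/2) (vadd H h (vscale H (\<i> ^ n) h'))"

lemma space_pvm_measure [simp]: "space (pvm_measure X h) = space (base X)"
  by (simp add: pvm_measure_def space_measure_of_conv)

lemma sets_pvm_measure [simp, measurable_cong]: "sets (pvm_measure X h) = sets (base X)"
  by (simp add: pvm_measure_def)

lemma sum_lessThan_4:
  fixes g :: "nat \<Rightarrow> 'a::comm_monoid_add"
  shows "(\<Sum>n<4. g n) = g 0 + g 1 + g 2 + g 3"
  by (simp add: eval_nat_numeral)

context pvm_space
begin

interpretation hil: complex_hilbert "hsp X" by (rule hilbert)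

lemma prj_closed: "\<lbrakk>G \<in> sets (base X); h \<in> vecs (hsp X)\<rbrakk> \<Longrightarrow> prj X G h \<in> vecs (hsp X)"
  using prj_bounded by (fastforce simp: bounded_ops_def)

lemma prj_add: "\<lbrakk>G \<in> sets (base X); h \<in> vecs (hsp X); h' \<in> vecs (hsp X)\<rbrakk>
    \<Longrightarrow> prj X G (vadd (hsp X) h h') = vadd (hsp X) (prj X G h) (prj X G h')"
  using prj_bounded by (fastforce simp: bounded_ops_def)

lemma prj_scale: "\<lbrakk>G \<in> sets (base X); h \<in> vecs (hsp X)\<rbrakk>
    \<Longrightarrow> prj X G (vscale (hsp X) a h) = vscale (hsp X) a (prj X G h)"
  using prj_bounded by (fastforce simp: bounded_ops_def)

lemma inner_prj_self:
  assumes "G \<in> sets (base X)" "h \<in> vecs (hsp X)"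
  shows "vinner (hsp X) (prj X G h) h = of_real ((vnorm (hsp X) (prj X G h))\<^sup>2)"
  using prj_selfadjoint[OF assms(1) prj_closed[OF assms] assms(2)] prj_idem[OF assms]
    hil.inner_self[OF prj_closed[OF assms]] by simp

lemma inner_prj_empty:
  assumes h: "h \<in> vecs (hsp X)" and h': "h' \<in> vecs (hsp X)"
  shows "vinner (hsp X) (prj X {} h) h' = 0"
proof -
  have "(\<lambda>n::nat. vinner (hsp X) (prj X {} h) h') sums vinner (hsp X) (prj X {} h) h'"
    using prj_countably_additive[of "\<lambda>_. {}" h h'] h h' by (simp add: disjoint_family_on_def)
  then have "(\<lambda>n::nat. vinner (hsp X) (prj X {} h) h') \<longlonglongrightarrow> 0"
    by (intro summable_LIMSEQ_zero) (rule sums_summable)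
  then show ?thesis by (simp add: LIMSEQ_const_iff)
qed

lemma emeasure_pvm_measure:
  assumes h: "h \<in> vecs (hsp X)" and G: "G \<in> sets (base X)"
  shows "emeasure (pvm_measure X h) G = ennreal (Re (vinner (hsp X) (prj X G h) h))"
proof -
  have "countably_additive (sets (base X)) (\<lambda>G. ennreal (Re (vinner (hsp X) (prj X G h) h)))"
  proof (rule countably_additiveI)
    fix A :: "nat \<Rightarrow> 'w set"
    assume A: "range A \<subseteq> sets (base X)" "disjoint_family A"
    show "(\<Sum>i. ennreal (Re (vinner (hsp X) (prj X (A i) h) h)))
        = ennreal (Re (vinner (hsp X) (prj X (\<Union>i. A i) h) h))"
    proof (rule suminf_ennreal_eq)
      show "0 \<le> Re (vinner (hsp X) (prj X (A i) h) h)" for i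
        using A(1) h by (simp add: inner_prj_self range_subsetD)
      show "(\<lambda>i. Re (vinner (hsp X) (prj X (A i) h) h)) sums
          Re (vinner (hsp X) (prj X (\<Union>i. A i) h) h)"
        using prj_countably_additive[OF A h h] by (rule sums_Re)
    qed
  qed
  moreover have "positive (sets (base X)) (\<lambda>G. ennreal (Re (vinner (hsp X) (prj X G h) h)))"
    using inner_prj_empty[OF h h] by (simp add: positive_def)
  ultimately show ?thesis
    unfolding pvm_measure_def using G
    by (intro emeasure_measure_of_sigma sets.sigma_algebra_axioms) auto
qed

lemma measure_pvm_measure:
  assumes h: "h \<in> vecs (hsp X)" and G: "G \<in> sets (base X)"
  shows "of_real (measure (pvm_measure X h) G) = vinner (hsp X) (prj X G h) h"
  unfolding measure_def emeasure_pvm_measure[OF assms] inner_prj_self[OF G h] by simp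

lemma finite_pvm_measure:
  assumes h: "h \<in> vecs (hsp X)"
  shows "finite_measure (pvm_measure X h)"
  by (rule finite_measureI) (simp add: emeasure_pvm_measure[OF h])

lemma measure_pvm_measure_space:
  assumes h: "h \<in> vecs (hsp X)"
  shows "measure (pvm_measure X h) (space (base X)) = (vnorm (hsp X) h)\<^sup>2"
proof -
  have "complex_of_real (measure (pvm_measure X h) (space (base X))) = of_real ((vnorm (hsp X) h)\<^sup>2)"
    using h by (simp only: measure_pvm_measure[OF h] sets.top prj_space hil.inner_self)
  then show ?thesis by (simp only: of_real_eq_iff)
qed

lemma pvm_null_iff:
  assumes "G \<in> sets (base X)"
  shows "pvm_null X G \<longleftrightarrow> (\<forall>h\<in>vecs (hsp X). emeasure (pvm_measure X h) G = 0)"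
  using assms hil.norm_eq_zero[OF prj_closed[OF assms]]
  by (simp add: pvm_null_def emeasure_pvm_measure inner_prj_self)

lemma AE_pvm_measure:
  assumes "pvm_ae X R" "h \<in> vecs (hsp X)"
  shows "AE w in pvm_measure X h. R w"
proof -
  obtain N where N: "pvm_null X N" "\<forall>w\<in>space (base X) - N. R w"
    using assms(1) unfolding pvm_ae_def by blast
  then have "N \<in> sets (base X)" by (simp add: pvm_null_def)
  then show ?thesis
    using N assms(2) pvm_null_iff[of N] by (intro AE_I'[of N]) (auto simp: null_sets_def)
qed

lemma polar_closed:
  "\<lbrakk>h \<in> vecs (hsp X); h' \<in> vecs (hsp X)\<rbrakk> \<Longrightarrow> polar_vec (hsp X) h h' n \<in> vecs (hsp X)"
  by (simp add: polar_vec_def hil.closed_simps)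

lemma pvm_polarization:
  assumes h: "h \<in> vecs (hsp X)" and h': "h' \<in> vecs (hsp X)" and G: "G \<in> sets (base X)"
  shows "vinner (hsp X) (prj X G h) h' =
    (\<Sum>n<4. \<i> ^ n * of_real (measure (pvm_measure X (polar_vec (hsp X) h h' n)) G))"
  unfolding measure_pvm_measure[OF polar_closed[OF h h'] G] sum_lessThan_4
  using prj_closed[OF G h] prj_closed[OF G h'] h h' G
  by (simp add: polar_vec_def prj_add prj_scale hil.closed_simps hil.inner_simps algebra_simps
      power3_eq_cube)

lemma norm_polar:
  assumes h: "h \<in> vecs (hsp X)" and h': "h' \<in> vecs (hsp X)"
  shows "(\<Sum>n<4. (vnorm (hsp X) (polar_vec (hsp X) h h' n))\<^sup>2)
    = (vnorm (hsp X) h)\<^sup>2 + (vnorm (hsp X) h')\<^sup>2"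
  unfolding sum_lessThan_4 using h h'
  by (simp add: hil.norm_sq polar_closed)
    (simp add: polar_vec_def hil.closed_simps hil.inner_simps algebra_simps power3_eq_cube)

lemma Linf_level_sets:
  assumes f: "f \<in> Linf X"
  shows "{w \<in> space (base X). c < norm (f w)} \<in> sets (base X)"
proof -
  have "f \<in> borel_measurable (base X)" using f by (simp add: Linf_def)
  then show ?thesis by measurable
qed

text \<open>
  Without this \<^const>\<open>Linf_norm\<close> would be the infimum of the empty set, an arbitrary real number. A bound
  for the bounded representative of \<open>f\<close> is a bound for \<open>f\<close> outside a null set.
\<close>

lemma essential_bound_exists:
  assumes f: "f \<in> Linf X"
  shows "{c. 0 \<le> c \<and> pvm_null X {w \<in> space (base X). c < norm (f w)}} \<noteq> {}"
proof -
  obtain g where g: "bounded (g ` space (base X))" "pvm_ae X (\<lambda>w. f w = g w)"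
    using f unfolding Linf_def by blast
  obtain B where B: "\<And>w. w \<in> space (base X) \<Longrightarrow> norm (g w) \<le> B"
    using g(1) unfolding bounded_iff by blast
  define c where "c = max B 0"
  have "emeasure (pvm_measure X k) {w \<in> space (base X). c < norm (f w)} = 0"
    if k: "k \<in> vecs (hsp X)" for k
  proof -
    have "AE w in pvm_measure X k. \<not> c < norm (f w)"
      using AE_pvm_measure[OF g(2) k] AE_space by eventually_elim (use B in \<open>force simp: c_def\<close>)
    then show ?thesis
      using Linf_level_sets[OF f] by (subst (asm) AE_iff_measurable[OF _ refl]) auto
  qed
  then have "c \<in> {c. 0 \<le> c \<and> pvm_null X {w \<in> space (base X). c < norm (f w)}}"
    using Linf_level_sets[OF f, of c] by (simp add: pvm_null_iff) (simp add: c_def)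
  then show ?thesis by blast
qed

lemma Linf_norm_nonneg: "f \<in> Linf X \<Longrightarrow> 0 \<le> Linf_norm X f"
  unfolding Linf_norm_def using essential_bound_exists by (intro cInf_greatest) auto

text \<open>
  The infimum that defines the norm is attained, a countable union of null sets being null.
\<close>

lemma AE_norm_le_Linf_norm:
  assumes f: "f \<in> Linf X" and h: "h \<in> vecs (hsp X)"
  shows "AE w in pvm_measure X h. norm (f w) \<le> Linf_norm X f"
proof -
  note level = Linf_level_sets[OF f]
  define S where "S = {c. 0 \<le> c \<and> pvm_null X {w \<in> space (base X). c < norm (f w)}}"
  have "S \<noteq> {}" unfolding S_def by (rule essential_bound_exists[OF f])
  moreover have "bdd_below S" by (rule bdd_belowI[of _ 0]) (simp add: S_def)
  ultimately have ex: "\<exists>c\<in>S. c < Linf_norm X f + inverse (real (Suc n))" for n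
    using cInf_lessD[of S "Linf_norm X f + inverse (real (Suc n))"]
    by (force simp: Linf_norm_def S_def[symmetric])
  have "AE w in pvm_measure X h. norm (f w) < Linf_norm X f + inverse (real (Suc n))" for n
  proof -
    obtain c where c: "c \<in> S" "c < Linf_norm X f + inverse (real (Suc n))" using ex by blast
    have "emeasure (pvm_measure X h) {w \<in> space (base X). c < norm (f w)} = 0"
      using c(1) h level by (simp add: S_def pvm_null_iff)
    then have "AE w in pvm_measure X h. \<not> c < norm (f w)"
      using level by (subst AE_iff_measurable[OF _ refl]) auto
    then show ?thesis by eventually_elim (use c(2) in linarith)
  qed
  then have "AE w in pvm_measure X h. \<forall>n. norm (f w) < Linf_norm X f + inverse (real (Suc n))"
    by (simp add: AE_all_countable)
  then show ?thesis
  proof eventually_elim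
    fix w assume w: "\<forall>n. norm (f w) < Linf_norm X f + inverse (real (Suc n))"
    show "norm (f w) \<le> Linf_norm X f"
    proof (rule ccontr)
      assume "\<not> norm (f w) \<le> Linf_norm X f"
      then obtain n where "inverse (real (Suc n)) < norm (f w) - Linf_norm X f"
        using reals_Archimedean[of "norm (f w) - Linf_norm X f"] by auto
      then show False using w[rule_format, of n] by linarith
    qed
  qed
qed

lemma Linf_integrable:
  assumes f: "f \<in> Linf X" and h: "h \<in> vecs (hsp X)"
  shows "integrable (pvm_measure X h) f"
proof -
  interpret finite_measure "pvm_measure X h" by (rule finite_pvm_measure[OF h])
  have "f \<in> borel_measurable (base X)" using f by (simp add: Linf_def)
  then show ?thesis
    using AE_norm_le_Linf_norm[OF f h] by (intro integrable_const_bound) auto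
qed

lemma integral_norm_pvm_measure_le:
  assumes f: "f \<in> Linf X" and h: "h \<in> vecs (hsp X)"
  shows "(\<integral>w. norm (f w) \<partial>pvm_measure X h) \<le> Linf_norm X f * (vnorm (hsp X) h)\<^sup>2"
proof -
  interpret finite_measure "pvm_measure X h" by (rule finite_pvm_measure[OF h])
  have "(\<integral>w. norm (f w) \<partial>pvm_measure X h) \<le> (\<integral>w. Linf_norm X f \<partial>pvm_measure X h)"
    using Linf_integrable[OF f h] AE_norm_le_Linf_norm[OF f h] by (intro integral_mono_AE) auto
  then show ?thesis using measure_pvm_measure_space[OF h] by (simp add: mult.commute)
qed

text \<open>
  The integral of \<open>f\<close> against \<open>Q\<^sub>h\<^sub>,\<^sub>h\<^sub>'\<close>.
\<close>

definition pvm_form :: "('w \<Rightarrow> complex) \<Rightarrow> 'h \<Rightarrow> 'h \<Rightarrow> complex" where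
  "pvm_form f h h' = (\<Sum>n<4. \<i> ^ n * (\<integral>w. f w \<partial>pvm_measure X (polar_vec (hsp X) h h' n)))"

lemma jordan_decomposition_polar:
  assumes f: "f \<in> Linf X" and h: "h \<in> vecs (hsp X)" and h': "h' \<in> vecs (hsp X)"
  shows "jordan_decomposition (base X) (\<lambda>G. vinner (hsp X) (prj X G h) h') f
    (\<lambda>n. pvm_measure X (polar_vec (hsp X) h h' n))"
  unfolding jordan_decomposition_def
  using polar_closed[OF h h'] f h h' by (simp add: finite_pvm_measure Linf_integrable pvm_polarization)

lemma complex_measure_integral_pvm:
  assumes f: "f \<in> Linf X" and h: "h \<in> vecs (hsp X)" and h': "h' \<in> vecs (hsp X)"
  shows "complex_measure_integral (base X) (\<lambda>G. vinner (hsp X) (prj X G h) h') f = pvm_form f h h'"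
  unfolding pvm_form_def
  using f by (intro complex_measure_integral_eq jordan_decomposition_polar[OF f h h']) (simp add: Linf_def)

text \<open>
  The approximating sums are visibly sesquilinear in \<open>(h, h')\<close>, which the defining formula of
  \<open>pvm_form\<close> is not.
\<close>

lemma pvm_form_limit:
  assumes f: "f \<in> Linf X" and fN: "f \<in> borel_measurable N"
    and N: "space N = space (base X)" "sets N \<subseteq> sets (base X)"
  obtains S :: "nat \<Rightarrow> complex set" and G :: "nat \<Rightarrow> complex \<Rightarrow> 'w set"
  where "\<And>i y. G i y \<in> sets N"
    "\<And>h h'. \<lbrakk>h \<in> vecs (hsp X); h' \<in> vecs (hsp X)\<rbrakk>
      \<Longrightarrow> (\<lambda>i. \<Sum>y\<in>S i. y * vinner (hsp X) (prj X (G i y) h) h') \<longlonglongrightarrow> pvm_form f h h'"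
proof -
  obtain S and G :: "nat \<Rightarrow> complex \<Rightarrow> 'w set"
    where G: "\<And>i y. G i y \<in> sets N"
    and lim: "\<And>\<nu> \<mu>. jordan_decomposition (base X) \<nu> f \<mu>
      \<Longrightarrow> (\<lambda>i. \<Sum>y\<in>S i. y * \<nu> (G i y)) \<longlonglongrightarrow> (\<Sum>n<4. \<i> ^ n * (\<integral>w. f w \<partial>\<mu> n))"
    by (rule jordan_decomposition_limit[OF fN N]) (rule that)
  show thesis
  proof (rule that)
    show "G i y \<in> sets N" for i y by (rule G)
    show "(\<lambda>i. \<Sum>y\<in>S i. y * vinner (hsp X) (prj X (G i y) h) h') \<longlonglongrightarrow> pvm_form f h h'"
      if "h \<in> vecs (hsp X)" "h' \<in> vecs (hsp X)" for h h'
      unfolding pvm_form_def by (rule lim[OF jordan_decomposition_polar[OF f that]])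
  qed
qed

lemma pvm_form_sesquilinear:
  assumes f: "f \<in> Linf X" and h: "h \<in> vecs (hsp X)" and h': "h' \<in> vecs (hsp X)"
  shows "k \<in> vecs (hsp X) \<Longrightarrow> pvm_form f (vadd (hsp X) h k) h' = pvm_form f h h' + pvm_form f k h'"
    and "pvm_form f (vscale (hsp X) a h) h' = a * pvm_form f h h'"
    and "k \<in> vecs (hsp X) \<Longrightarrow> pvm_form f h (vadd (hsp X) h' k) = pvm_form f h h' + pvm_form f h k"
    and "pvm_form f h (vscale (hsp X) a h') = cnj a * pvm_form f h h'"
proof -
  have "f \<in> borel_measurable (base X)" using f by (simp add: Linf_def)
  then obtain S and G :: "nat \<Rightarrow> complex \<Rightarrow> 'w set"
    where G: "\<And>i y. G i y \<in> sets (base X)"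
    and lim: "\<And>h h'. \<lbrakk>h \<in> vecs (hsp X); h' \<in> vecs (hsp X)\<rbrakk>
      \<Longrightarrow> (\<lambda>i. \<Sum>y\<in>S i. y * vinner (hsp X) (prj X (G i y) h) h') \<longlonglongrightarrow> pvm_form f h h'"
    by (rule pvm_form_limit[OF f _ refl order_refl]) (rule that)
  note closed = h h' G prj_closed hil.closed_simps
  show "pvm_form f (vadd (hsp X) h k) h' = pvm_form f h h' + pvm_form f k h'"
    if k: "k \<in> vecs (hsp X)"
  proof (rule LIMSEQ_unique[OF lim])
    have "(\<lambda>i. (\<Sum>y\<in>S i. y * vinner (hsp X) (prj X (G i y) h) h')
        + (\<Sum>y\<in>S i. y * vinner (hsp X) (prj X (G i y) k) h')) \<longlonglongrightarrow> pvm_form f h h' + pvm_form f k h'"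
      using lim h h' k by (intro tendsto_add) auto
    then show "(\<lambda>i. \<Sum>y\<in>S i. y * vinner (hsp X) (prj X (G i y) (vadd (hsp X) h k)) h')
        \<longlonglongrightarrow> pvm_form f h h' + pvm_form f k h'"
      using k by (simp add: closed prj_add hil.inner_simps distrib_left sum.distrib)
  qed (use closed k in auto)
  show "pvm_form f (vscale (hsp X) a h) h' = a * pvm_form f h h'"
  proof (rule LIMSEQ_unique[OF lim])
    have "(\<lambda>i. a * (\<Sum>y\<in>S i. y * vinner (hsp X) (prj X (G i y) h) h')) \<longlonglongrightarrow> a * pvm_form f h h'"
      using lim h h' by (intro tendsto_mult tendsto_const) auto
    then show "(\<lambda>i. \<Sum>y\<in>S i. y * vinner (hsp X) (prj X (G i y) (vscale (hsp X) a h)) h')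
        \<longlonglongrightarrow> a * pvm_form f h h'"
      by (simp add: closed prj_scale hil.inner_simps sum_distrib_left mult.left_commute)
  qed (use closed in auto)
  show "pvm_form f h (vadd (hsp X) h' k) = pvm_form f h h' + pvm_form f h k"
    if k: "k \<in> vecs (hsp X)"
  proof (rule LIMSEQ_unique[OF lim])
    have "(\<lambda>i. (\<Sum>y\<in>S i. y * vinner (hsp X) (prj X (G i y) h) h')
        + (\<Sum>y\<in>S i. y * vinner (hsp X) (prj X (G i y) h) k)) \<longlonglongrightarrow> pvm_form f h h' + pvm_form f h k"
      using lim h h' k by (intro tendsto_add) auto
    then show "(\<lambda>i. \<Sum>y\<in>S i. y * vinner (hsp X) (prj X (G i y) h) (vadd (hsp X) h' k))
        \<longlonglongrightarrow> pvm_form f h h' + pvm_form f h k"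
      using k by (simp add: closed hil.inner_simps distrib_left sum.distrib)
  qed (use closed k in auto)
  show "pvm_form f h (vscale (hsp X) a h') = cnj a * pvm_form f h h'"
  proof (rule LIMSEQ_unique[OF lim])
    have "(\<lambda>i. cnj a * (\<Sum>y\<in>S i. y * vinner (hsp X) (prj X (G i y) h) h'))
        \<longlonglongrightarrow> cnj a * pvm_form f h h'"
      using lim h h' by (intro tendsto_mult tendsto_const) auto
    then show "(\<lambda>i. \<Sum>y\<in>S i. y * vinner (hsp X) (prj X (G i y) h) (vscale (hsp X) a h'))
        \<longlonglongrightarrow> cnj a * pvm_form f h h'"
      by (simp add: closed hil.inner_simps sum_distrib_left mult.left_commute)
  qed (use closed in auto)
qed

lemma pvm_form_bound_squares:
  assumes f: "f \<in> Linf X" and h: "h \<in> vecs (hsp X)" and h': "h' \<in> vecs (hsp X)"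
  shows "norm (pvm_form f h h') \<le> Linf_norm X f * ((vnorm (hsp X) h)\<^sup>2 + (vnorm (hsp X) h')\<^sup>2)"
proof -
  have "norm (pvm_form f h h')
      \<le> (\<Sum>n<4. norm (\<i> ^ n * (\<integral>w. f w \<partial>pvm_measure X (polar_vec (hsp X) h h' n))))"
    unfolding pvm_form_def by (rule norm_sum)
  also have "\<dots> \<le> (\<Sum>n<4. Linf_norm X f * (vnorm (hsp X) (polar_vec (hsp X) h h' n))\<^sup>2)"
  proof (rule sum_mono)
    fix n :: nat
    have "norm (\<integral>w. f w \<partial>pvm_measure X (polar_vec (hsp X) h h' n))
        \<le> (\<integral>w. norm (f w) \<partial>pvm_measure X (polar_vec (hsp X) h h' n))"
      by (rule integral_norm_bound)
    also have "\<dots> \<le> Linf_norm X f * (vnorm (hsp X) (polar_vec (hsp X) h h' n))\<^sup>2"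
      by (rule integral_norm_pvm_measure_le[OF f polar_closed[OF h h']])
    finally show "norm (\<i> ^ n * (\<integral>w. f w \<partial>pvm_measure X (polar_vec (hsp X) h h' n)))
        \<le> Linf_norm X f * (vnorm (hsp X) (polar_vec (hsp X) h h' n))\<^sup>2"
      by (simp add: norm_mult norm_power)
  qed
  finally show ?thesis by (simp only: sum_distrib_left[symmetric] norm_polar[OF h h'])
qed

text \<open>
  The bound in terms of squares, applied to normalized vectors. Polarization costs the factor 2, which
  is harmless: only integrability of the product of the bounds matters later.
\<close>

lemma pvm_form_bound:
  assumes f: "f \<in> Linf X" and h: "h \<in> vecs (hsp X)" and h': "h' \<in> vecs (hsp X)"
  shows "norm (pvm_form f h h') \<le> 2 * Linf_norm X f * vnorm (hsp X) h * vnorm (hsp X) h'"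
proof -
  let ?a = "vnorm (hsp X) h" and ?b = "vnorm (hsp X) h'"
  note nonneg = hil.norm_nonneg[OF h] hil.norm_nonneg[OF h'] Linf_norm_nonneg[OF f]
  show ?thesis
  proof (cases "?a = 0 \<or> ?b = 0")
    case True
    then have "h = vzero (hsp X) \<or> h' = vzero (hsp X)"
      using hil.norm_eq_zero[OF h] hil.norm_eq_zero[OF h'] by blast
    moreover have "vscale (hsp X) 0 (vzero (hsp X)) = vzero (hsp X)"
      by (rule hil.vector_eqI) (auto simp: hil.closed_simps hil.inner_simps)
    ultimately have "pvm_form f h h' = 0"
      using pvm_form_sesquilinear(2)[OF f h h', of 0] pvm_form_sesquilinear(4)[OF f h h', of 0] by auto
    then show ?thesis using nonneg by simp
  next
    case False
    then have pos: "?a > 0" "?b > 0" using nonneg by auto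
    let ?u = "vscale (hsp X) (1 / of_real ?a) h" and ?v = "vscale (hsp X) (1 / of_real ?b) h'"
    have u: "?u \<in> vecs (hsp X)" "vnorm (hsp X) ?u = 1" and v: "?v \<in> vecs (hsp X)" "vnorm (hsp X) ?v = 1"
      using h h' pos by (simp_all add: hil.closed_simps hil.norm_scale norm_divide)
    have "pvm_form f ?u ?v = pvm_form f h h' / of_real (?a * ?b)"
      using pos by (simp add: pvm_form_sesquilinear(2)[OF f h v(1)] pvm_form_sesquilinear(4)[OF f h h'])
    moreover have "norm (pvm_form f ?u ?v) \<le> Linf_norm X f * 2"
      using pvm_form_bound_squares[OF f u(1) v(1)] u v by simp
    ultimately have "norm (pvm_form f h h') / (?a * ?b) \<le> Linf_norm X f * 2"
      using pos by (simp add: norm_divide norm_mult)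
    then show ?thesis using pos by (simp add: divide_simps mult_ac)
  qed
qed

text \<open>
  The Riesz representation of the bounded sesquilinear form \<open>pvm_form f\<close>.
\<close>

lemma pvm_integral_exists:
  assumes f: "f \<in> Linf X"
  shows "\<exists>T\<in>bounded_ops (hsp X) (hsp X). \<forall>h\<in>vecs (hsp X). \<forall>h'\<in>vecs (hsp X).
    vinner (hsp X) (T h) h' = pvm_form f h h'"
proof -
  have "\<exists>z\<in>vecs (hsp X). \<forall>h'\<in>vecs (hsp X). vinner (hsp X) z h' = pvm_form f h h'"
    if h: "h \<in> vecs (hsp X)" for h
    using pvm_form_sesquilinear(3,4)[OF f h] pvm_form_bound[OF f h]
    by (intro hil.riesz_representation[where C = "2 * Linf_norm X f * vnorm (hsp X) h"]) auto
  then obtain T where T: "\<And>h. h \<in> vecs (hsp X) \<Longrightarrow> T h \<in> vecs (hsp X)"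
    "\<And>h h'. \<lbrakk>h \<in> vecs (hsp X); h' \<in> vecs (hsp X)\<rbrakk> \<Longrightarrow> vinner (hsp X) (T h) h' = pvm_form f h h'"
    by metis
  have bound: "vnorm (hsp X) (T h) \<le> 2 * Linf_norm X f * vnorm (hsp X) h" if h: "h \<in> vecs (hsp X)" for h
  proof (rule hil.norm_le_of_inner_self[OF T(1)[OF h]])
    show "0 \<le> 2 * Linf_norm X f * vnorm (hsp X) h"
      using h by (simp add: hil.norm_nonneg Linf_norm_nonneg[OF f])
    show "norm (vinner (hsp X) (T h) (T h)) \<le> 2 * Linf_norm X f * vnorm (hsp X) h * vnorm (hsp X) (T h)"
      using pvm_form_bound[OF f h T(1)[OF h]] T(2)[OF h T(1)[OF h]] by simp
  qed
  show ?thesis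
  proof
    show "restrict T (vecs (hsp X)) \<in> bounded_ops (hsp X) (hsp X)"
      unfolding bounded_ops_def
    proof (intro CollectI conjI ballI allI exI)
      show "restrict T (vecs (hsp X)) \<in> vecs (hsp X) \<rightarrow>\<^sub>E vecs (hsp X)" using T(1) by auto
      show "vnorm (hsp X) (restrict T (vecs (hsp X)) x) \<le> 2 * Linf_norm X f * vnorm (hsp X) x"
        if "x \<in> vecs (hsp X)" for x using bound that by simp
      fix x assume x: "x \<in> vecs (hsp X)"
      show "restrict T (vecs (hsp X)) (vadd (hsp X) x y) =
          vadd (hsp X) (restrict T (vecs (hsp X)) x) (restrict T (vecs (hsp X)) y)"
        if y: "y \<in> vecs (hsp X)" for y
        by (rule hil.vector_eqI)
          (simp_all add: x y T hil.closed_simps hil.inner_simps pvm_form_sesquilinear(1)[OF f])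
      show "restrict T (vecs (hsp X)) (vscale (hsp X) a x) =
          vscale (hsp X) a (restrict T (vecs (hsp X)) x)" for a
        by (rule hil.vector_eqI)
          (simp_all add: x T hil.closed_simps hil.inner_simps pvm_form_sesquilinear(2)[OF f])
    qed
  qed (use T(2) in simp)
qed

lemma pvm_integral:
  assumes f: "f \<in> Linf X"
  shows "pvm_integral X f \<in> bounded_ops (hsp X) (hsp X)"
    and "\<lbrakk>h \<in> vecs (hsp X); h' \<in> vecs (hsp X)\<rbrakk> \<Longrightarrow> vinner (hsp X) (pvm_integral X f h) h' = pvm_form f h h'"
proof -
  let ?P = "\<lambda>T. T \<in> bounded_ops (hsp X) (hsp X) \<and> (\<forall>h\<in>vecs (hsp X). \<forall>h'\<in>vecs (hsp X).
    vinner (hsp X) (T h) h' = complex_measure_integral (base X) (\<lambda>G. vinner (hsp X) (prj X G h) h') f)"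
  have eq: "?P T \<longleftrightarrow> T \<in> bounded_ops (hsp X) (hsp X) \<and> (\<forall>h\<in>vecs (hsp X). \<forall>h'\<in>vecs (hsp X).
      vinner (hsp X) (T h) h' = pvm_form f h h')" for T
    using complex_measure_integral_pvm[OF f] by simp
  have "\<exists>!T. ?P T"
    unfolding eq
  proof (rule ex_ex1I)
    show "\<exists>T. T \<in> bounded_ops (hsp X) (hsp X) \<and> (\<forall>h\<in>vecs (hsp X). \<forall>h'\<in>vecs (hsp X).
        vinner (hsp X) (T h) h' = pvm_form f h h')"
      using pvm_integral_exists[OF f] by blast
    fix T U
    assume T: "T \<in> bounded_ops (hsp X) (hsp X) \<and> (\<forall>h\<in>vecs (hsp X). \<forall>h'\<in>vecs (hsp X).
        vinner (hsp X) (T h) h' = pvm_form f h h')"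
      and U: "U \<in> bounded_ops (hsp X) (hsp X) \<and> (\<forall>h\<in>vecs (hsp X). \<forall>h'\<in>vecs (hsp X).
        vinner (hsp X) (U h) h' = pvm_form f h h')"
    then have TU: "T \<in> vecs (hsp X) \<rightarrow>\<^sub>E vecs (hsp X)" "U \<in> vecs (hsp X) \<rightarrow>\<^sub>E vecs (hsp X)"
      by (auto simp: bounded_ops_def)
    show "T = U"
    proof (rule PiE_ext[OF TU])
      fix h assume h: "h \<in> vecs (hsp X)"
      show "T h = U h"
        using PiE_mem[OF TU(1) h] PiE_mem[OF TU(2) h] T U h by (intro hil.vector_eqI) auto
    qed
  qed
  from theI'[OF this, folded pvm_integral_def]
  have "?P (pvm_integral X f)" by (simp add: pvm_integral_def)
  then show "pvm_integral X f \<in> bounded_ops (hsp X) (hsp X)"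
    and "\<lbrakk>h \<in> vecs (hsp X); h' \<in> vecs (hsp X)\<rbrakk>
      \<Longrightarrow> vinner (hsp X) (pvm_integral X f h) h' = pvm_form f h h'"
    unfolding eq by blast+
qed

lemma norm_pvm_integral_le:
  assumes f: "f \<in> Linf X" and h: "h \<in> vecs (hsp X)"
  shows "vnorm (hsp X) (pvm_integral X f h) \<le> 2 * Linf_norm X f * vnorm (hsp X) h"
proof -
  have T: "pvm_integral X f h \<in> vecs (hsp X)"
    using pvm_integral(1)[OF f] h by (auto simp: bounded_ops_def)
  show ?thesis
  proof (rule hil.norm_le_of_inner_self[OF T])
    show "0 \<le> 2 * Linf_norm X f * vnorm (hsp X) h"
      using h by (simp add: hil.norm_nonneg Linf_norm_nonneg[OF f])
    show "norm (vinner (hsp X) (pvm_integral X f h) (pvm_integral X f h))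
        \<le> 2 * Linf_norm X f * vnorm (hsp X) h * vnorm (hsp X) (pvm_integral X f h)"
      unfolding pvm_integral(2)[OF f h T] by (rule pvm_form_bound[OF f h T])
  qed
qed

text \<open>
  The sets \<open>A\<close> with \<open>\<langle>Q(A)h, y\<rangle> = 0\<close> form a Dynkin system, so they contain the \<open>\<sigma>\<close>-algebra
  generated by the \<open>d n\<close>. Since \<open>f\<close> is measurable with respect to it, the sums that approximate
  \<open>\<langle>Q(f)h, y\<rangle>\<close> vanish.
\<close>

lemma inner_pvm_integral_eq_0:
  fixes d :: "nat \<Rightarrow> 'w set"
  assumes d: "range d \<subseteq> sets (base X)" "Int_stable (range d)" "space (base X) \<in> range d"
    and f: "f \<in> Linf X" "f \<in> borel_measurable (sigma (space (base X)) (range d))"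
    and h: "h \<in> vecs (hsp X)" and y: "y \<in> vecs (hsp X)"
    and 0: "\<And>n. vinner (hsp X) (prj X (d n) h) y = 0"
  shows "vinner (hsp X) (pvm_integral X f h) y = 0"
proof -
  let ?N = "sigma (space (base X)) (range d)"
  have sub: "range d \<subseteq> Pow (space (base X))" using d(1) sets.space_closed by blast
  have N: "space ?N = space (base X)" "sets ?N = sigma_sets (space (base X)) (range d)"
    using sub by (simp_all add: space_measure_of_conv)
  have le: "sets ?N \<subseteq> sets (base X)" unfolding N(2) by (rule sets.sigma_sets_subset[OF d(1)])
  have vanish: "vinner (hsp X) (prj X A h) y = 0" if A: "A \<in> sets ?N" for A
    using d(2) sub A[unfolded N(2)]
  proof (induction rule: sigma_sets_induct_disjoint)
    case (basic A)
    then show ?case using 0 by auto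
  next
    case empty
    show ?case by (rule inner_prj_empty[OF h y])
  next
    case (compl A)
    then have A: "A \<in> sets (base X)" using le N(2) by blast
    obtain n where n: "space (base X) = d n" using d(3) by blast
    have "measure (pvm_measure X z) (space (base X) - A) =
        measure (pvm_measure X z) (space (base X)) - measure (pvm_measure X z) A"
      if "z \<in> vecs (hsp X)" for z
      using finite_measure.finite_measure_compl[OF finite_pvm_measure[OF that], of A] A by simp
    then have "vinner (hsp X) (prj X (space (base X) - A) h) y =
        vinner (hsp X) (prj X (space (base X)) h) y - vinner (hsp X) (prj X A h) y"
      using A h y polar_closed[OF h y]
      by (simp add: pvm_polarization right_diff_distrib sum_subtractf)
    then show ?case using compl 0[of n] n by simp
  next
    case (union A)
    then have "range A \<subseteq> sets (base X)" using le N(2) by blast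
    then have "(\<lambda>n. vinner (hsp X) (prj X (A n) h) y) sums vinner (hsp X) (prj X (\<Union>n. A n) h) y"
      using union h y by (intro prj_countably_additive)
    then show ?case using union by (simp add: sums_0 sums_unique2)
  qed
  obtain S and G :: "nat \<Rightarrow> complex \<Rightarrow> 'w set"
    where G: "\<And>i y. G i y \<in> sets ?N"
    and lim: "\<And>h h'. \<lbrakk>h \<in> vecs (hsp X); h' \<in> vecs (hsp X)\<rbrakk>
      \<Longrightarrow> (\<lambda>i. \<Sum>y\<in>S i. y * vinner (hsp X) (prj X (G i y) h) h') \<longlonglongrightarrow> pvm_form f h h'"
    by (rule pvm_form_limit[OF f N(1) le]) (rule that)
  have "pvm_form f h y = 0"
    using lim[OF h y] by (simp add: vanish[OF G] LIMSEQ_const_iff)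
  then show ?thesis using pvm_integral(2)[OF f(1) h y] by simp
qed

text \<open>
  This replaces the separability of the Hilbert space. For fixed \<open>h\<close>, all \<open>Q(f)h\<close> with \<open>f\<close> measurable
  with respect to one countably generated \<open>\<sigma>\<close>-algebra are in one separable subspace, and one
  sequence \<open>e\<close> expands all of them.
\<close>

lemma countable_expansion:
  assumes C: "countable C" "C \<subseteq> sets (base X)" and h: "h \<in> vecs (hsp X)"
  obtains e where "\<And>n. e n \<in> vecs (hsp X)" "\<And>n. orthonormal_upto (hsp X) e n"
    "\<And>f. \<lbrakk>f \<in> Linf X; f \<in> borel_measurable (sigma (space (base X)) C)\<rbrakk>
      \<Longrightarrow> (\<lambda>n. vnorm (hsp X) (vdiff (hsp X) (fourier (hsp X) e n (pvm_integral X f h))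
            (pvm_integral X f h))) \<longlonglongrightarrow> 0"
proof -
  obtain d :: "nat \<Rightarrow> 'w set" where d: "range d \<subseteq> sets (base X)" "Int_stable (range d)"
    "space (base X) \<in> range d" "C \<subseteq> range d"
    by (rule countable_pi_system[OF C]) (rule that)
  have dn: "d n \<in> sets (base X)" for n using d(1) by blast
  obtain e where e: "\<And>n. e n \<in> vecs (hsp X)" "\<And>n. orthonormal_upto (hsp X) e n"
    "\<And>n y. \<lbrakk>y \<in> vecs (hsp X); \<And>i. vinner (hsp X) (e i) y = 0\<rbrakk>
      \<Longrightarrow> vinner (hsp X) (prj X (d n) h) y = 0"
    by (rule hil.gram_schmidt[of "\<lambda>n. prj X (d n) h"]) (use prj_closed[OF dn h] in \<open>blast+\<close>)
  show thesis
  proof (rule that[OF e(1,2)])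
    fix f assume f: "f \<in> Linf X" "f \<in> borel_measurable (sigma (space (base X)) C)"
    have sub: "range d \<subseteq> Pow (space (base X))" "C \<subseteq> Pow (space (base X))"
      using d(1) C(2) sets.space_closed[of "base X"] by blast+
    have "sets (sigma (space (base X)) C) \<subseteq> sets (sigma (space (base X)) (range d))"
      using sub d(4) by (simp add: sigma_sets_mono')
    then have fd: "f \<in> borel_measurable (sigma (space (base X)) (range d))"
      using f(2) by (auto simp: measurable_def space_measure_of_conv)
    show "(\<lambda>n. vnorm (hsp X) (vdiff (hsp X) (fourier (hsp X) e n (pvm_integral X f h))
        (pvm_integral X f h))) \<longlonglongrightarrow> 0"
    proof (rule hil.fourier_tendsto[OF e(2)])
      show "pvm_integral X f h \<in> vecs (hsp X)"
        using pvm_integral(1)[OF f(1)] h by (auto simp: bounded_ops_def)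
      fix y assume y: "y \<in> vecs (hsp X)" "\<And>i. vinner (hsp X) (e i) y = 0"
      show "vinner (hsp X) (pvm_integral X f h) y = 0"
        by (rule inner_pvm_integral_eq_0[OF d(1-3) f(1) fd h y(1)]) (rule e(3)[OF y])
    qed
  qed
qed

end


section \<open>Alternating products of operators\<close>

text \<open>
  Unlike \<^const>\<open>bounded_ops\<close> this puts no condition on values outside the carrier, and hence it is
  preserved by composition.
\<close>

definition bounded_linear_on ::
  "'a hilbert_data \<Rightarrow> 'b hilbert_data \<Rightarrow> ('a \<Rightarrow> 'b) \<Rightarrow> real \<Rightarrow> bool" where
  "bounded_linear_on H K T C \<longleftrightarrow>
     (\<forall>x\<in>vecs H. T x \<in> vecs K \<and> vnorm K (T x) \<le> C * vnorm H x) \<and>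
     (\<forall>x\<in>vecs H. \<forall>y\<in>vecs H. T (vadd H x y) = vadd K (T x) (T y)) \<and>
     (\<forall>a. \<forall>x\<in>vecs H. T (vscale H a x) = vscale K a (T x))"

lemma bounded_linear_on_compose:
  assumes T: "bounded_linear_on H K T C" and S: "bounded_linear_on K L S D" and D: "0 \<le> D"
  shows "bounded_linear_on H L (S \<circ> T) (D * C)"
proof -
  have "vnorm L (S (T x)) \<le> D * C * vnorm H x" if x: "x \<in> vecs H" for x
  proof -
    have "vnorm L (S (T x)) \<le> D * vnorm K (T x)"
      using S T x by (simp add: bounded_linear_on_def)
    also have "\<dots> \<le> D * (C * vnorm H x)"
      using T x D by (intro mult_left_mono) (simp_all add: bounded_linear_on_def)
    finally show ?thesis by (simp add: mult.assoc)
  qed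
  then show ?thesis using T S by (simp add: bounded_linear_on_def)
qed

lemma bounded_ops_bounded_linear_on:
  assumes H: "complex_hilbert H" and T: "T \<in> bounded_ops H K"
  obtains C where "0 \<le> C" "bounded_linear_on H K T C"
proof -
  interpret complex_hilbert H by fact
  obtain C where C: "\<And>x. x \<in> vecs H \<Longrightarrow> vnorm K (T x) \<le> C * vnorm H x"
    using T unfolding bounded_ops_def by blast
  have "vnorm K (T x) \<le> \<bar>C\<bar> * vnorm H x" if "x \<in> vecs H" for x
    using C[OF that] mult_right_mono[OF abs_ge_self[of C] norm_nonneg[OF that]] by linarith
  then have "bounded_linear_on H K T \<bar>C\<bar>"
    using T by (auto simp: bounded_ops_def bounded_linear_on_def)
  then show thesis by (intro that[of "\<bar>C\<bar>"]) auto
qed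

lemma bounded_linear_on_alternating_product:
  assumes A: "\<And>j. j \<in> {1..m+1} \<Longrightarrow> bounded_linear_on (H j) (H j) (A j) (N j)"
    and N: "\<And>j. j \<in> {1..m+1} \<Longrightarrow> 0 \<le> N j"
    and b: "\<And>j. j \<in> {1..m} \<Longrightarrow> bounded_linear_on (H (j + 1)) (H j) (b j) (C j)"
    and C: "\<And>j. j \<in> {1..m} \<Longrightarrow> 0 \<le> C j"
  shows "bounded_linear_on (H (m + 1)) (H 1) (alternating_product A b m)
    ((\<Prod>j\<in>{1..m}. C j) * (\<Prod>j\<in>{1..m+1}. N j))"
  using assms
proof (induction m)
  case 0
  then show ?case by simp
next
  case (Suc m)
  let ?K = "(\<Prod>j\<in>{1..m}. C j) * (\<Prod>j\<in>{1..m+1}. N j)"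
  have IH: "bounded_linear_on (H (m + 1)) (H 1) (alternating_product A b m) ?K"
    by (rule Suc.IH) (use Suc.prems in auto)
  have K: "0 \<le> ?K" using Suc.prems(2,4) by (intro mult_nonneg_nonneg prod_nonneg) auto
  have bm: "bounded_linear_on (H (Suc m + 1)) (H (m + 1)) (b (Suc m)) (C (Suc m))"
    using Suc.prems(3)[of "Suc m"] by simp
  have Am: "bounded_linear_on (H (Suc m + 1)) (H (Suc m + 1)) (A (Suc m + 1)) (N (Suc m + 1))"
    using Suc.prems(1)[of "Suc m + 1"] by simp
  have "bounded_linear_on (H (Suc m + 1)) (H 1)
      ((alternating_product A b m \<circ> b (Suc m)) \<circ> A (Suc m + 1)) ((?K * C (Suc m)) * N (Suc m + 1))"
    using K Suc.prems(4)[of "Suc m"]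
    by (intro bounded_linear_on_compose[OF Am] bounded_linear_on_compose[OF bm IH K]) auto
  moreover have "(?K * C (Suc m)) * N (Suc m + 1)
      = (\<Prod>j\<in>{1..Suc m}. C j) * (\<Prod>j\<in>{1..Suc m + 1}. N j)"
    by (simp add: mult_ac)
  ultimately show ?case by (simp only: alternating_product.simps)
qed

lemma inner_bounded_linear_fourier:
  assumes H: "complex_hilbert H" and K: "complex_hilbert K" and T: "bounded_linear_on H K T C"
    and e: "\<And>i. e i \<in> vecs H" and x: "x \<in> vecs H" and y: "y \<in> vecs K"
  shows "vinner K (T (fourier H e n x)) y = (\<Sum>i<n. vinner H x (e i) * vinner K (T (e i)) y)"
proof (induction n)
  case 0
  interpret H: complex_hilbert H by fact
  interpret K: complex_hilbert K by fact
  have "vzero H = vscale H 0 (vzero H)"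
    by (rule H.vector_eqI) (auto simp: H.closed_simps H.inner_simps)
  then have "T (vzero H) = vscale K 0 (T (vzero H))"
    using T H.zero_closed unfolding bounded_linear_on_def by metis
  then have "vinner K (T (vzero H)) y = vinner K (vscale K 0 (T (vzero H))) y" by simp
  also have "\<dots> = 0"
    using T y H.zero_closed by (simp add: K.inner_simps bounded_linear_on_def)
  finally show ?case by simp
next
  case (Suc n)
  interpret H: complex_hilbert H by fact
  interpret K: complex_hilbert K by fact
  have "fourier H e n x \<in> vecs H" using e x by (intro H.fourier_closed)
  then show ?case using T Suc e x y
    by (simp add: bounded_linear_on_def H.closed_simps K.closed_simps K.inner_simps)
qed

lemma tendsto_inner_bounded_linear:
  assumes H: "complex_hilbert H" and K: "complex_hilbert K" and T: "bounded_linear_on H K T C"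
    and a: "\<And>n. a n \<in> vecs H" and l: "l \<in> vecs H" and y: "y \<in> vecs K"
    and lim: "(\<lambda>n. vnorm H (vdiff H (a n) l)) \<longlonglongrightarrow> 0"
  shows "(\<lambda>n. vinner K (T (a n)) y) \<longlonglongrightarrow> vinner K (T l) y"
proof -
  interpret H: complex_hilbert H by fact
  interpret K: complex_hilbert K by fact
  have T_closed: "T x \<in> vecs K" if "x \<in> vecs H" for x using T that by (simp add: bounded_linear_on_def)
  have "T (vdiff H (a n) l) = vdiff K (T (a n)) (T l)" for n
    using T a l by (simp add: bounded_linear_on_def vdiff_def H.closed_simps)
  then have le: "vnorm K (vdiff K (T (a n)) (T l)) \<le> C * vnorm H (vdiff H (a n) l)" for n
    using T a l H.diff_closed[OF a l, of n] unfolding bounded_linear_on_def by metis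
  have ge: "0 \<le> vnorm K (vdiff K (T (a n)) (T l))" for n
    by (intro K.norm_nonneg K.diff_closed T_closed a l)
  have "(\<lambda>n. C * vnorm H (vdiff H (a n) l)) \<longlonglongrightarrow> 0"
    using lim by (rule tendsto_mult_right_zero)
  then have "(\<lambda>n. vnorm K (vdiff K (T (a n)) (T l))) \<longlonglongrightarrow> 0"
    by (rule tendsto_sandwich[OF always_eventually[OF allI[OF ge]] always_eventually[OF allI[OF le]] tendsto_const])
  then show ?thesis by (rule K.tendsto_inner_left[OF T_closed[OF a] T_closed[OF l] y])
qed

section \<open>Inserting an orthonormal expansion\<close>

text \<open>
  The abstract form of the integrand of a multiple operator integral: families \<open>A s j\<close> of operators
  on \<open>H j\<close> whose bounds have an integrable product.
\<close>

locale operator_fields =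
  fixes k :: nat and H :: "nat \<Rightarrow> 'h hilbert_data" and R :: "'s measure"
    and A :: "'s \<Rightarrow> nat \<Rightarrow> 'h \<Rightarrow> 'h" and N :: "'s \<Rightarrow> nat \<Rightarrow> real" and g :: "'s \<Rightarrow> real"
  assumes hilberts: "j \<in> {1..k+1} \<Longrightarrow> complex_hilbert (H j)"
    and fields: "\<lbrakk>j \<in> {1..k+1}; s \<in> space R\<rbrakk> \<Longrightarrow> bounded_linear_on (H j) (H j) (A s j) (N s j)"
    and N_nonneg: "\<lbrakk>j \<in> {1..k+1}; s \<in> space R\<rbrakk> \<Longrightarrow> 0 \<le> N s j"
    and integrable_g: "integrable R g"
    and N_le_g: "AE s in R. (\<Prod>j\<in>{1..k+1}. N s j) \<le> g s"
begin

text \<open>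
  These coefficients interpolate between rank one and arbitrary \<open>b\<close>. If \<open>b (m + 1), \<dots>, b k\<close> are of
  rank one, then the matrix coefficient of the alternating product factors in this way, with
  \<open>h\<close>, \<open>v\<close> and \<open>u\<close> composed of the vectors that define the rank one operators. For \<open>m = 0\<close> it is a product of \<open>k + 1\<close>
  matrix coefficients, for \<open>m = k\<close> it is the coefficient of the full alternating product.
\<close>

definition mixed_coefficient ::
  "nat \<Rightarrow> (nat \<Rightarrow> 'h \<Rightarrow> 'h) \<Rightarrow> 'h \<Rightarrow> 'h \<Rightarrow> (nat \<Rightarrow> 'h) \<Rightarrow> (nat \<Rightarrow> 'h) \<Rightarrow> 's \<Rightarrow> complex" where
  "mixed_coefficient m b h h' v u s = vinner (H 1) (alternating_product (A s) b m h) h' *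
     (\<Prod>j\<in>{m+2..k+1}. vinner (H j) (A s j (v j)) (u j))"

text \<open>
  One more operator \<open>b (m + 1)\<close> is released from being of rank one by expanding the vector
  \<open>A s (m + 2) h\<close>, to which it is applied, along \<open>e\<close>: inserting
  \<open>\<Sum>\<^sub>i \<langle>A s (m + 2) h, e i\<rangle> e i\<close> gives a sum over \<open>i\<close> of coefficients of level \<open>m\<close>. By Bessel's
  inequality the partial sums are dominated by a multiple of \<open>g\<close>, so the integral may be taken term
  by term. Measurability at level \<open>m + 1\<close> is inherited from level \<open>m\<close>.
\<close>

lemma mixed_coefficient_sums:
  assumes m: "m < k"
    and b: "\<And>j. j \<in> {1..Suc m} \<Longrightarrow> b j \<in> bounded_ops (H (j + 1)) (H j)"
    and h: "h \<in> vecs (H (m + 2))" and h': "h' \<in> vecs (H 1)"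
    and v: "\<And>j. j \<in> {1..k+1} \<Longrightarrow> v j \<in> vecs (H j)" and u: "\<And>j. j \<in> {1..k+1} \<Longrightarrow> u j \<in> vecs (H j)"
    and e: "\<And>i. e i \<in> vecs (H (m + 2))" "\<And>n. orthonormal_upto (H (m + 2)) e n"
    and expand: "\<And>s. s \<in> space R \<Longrightarrow> (\<lambda>n. vnorm (H (m + 2))
      (vdiff (H (m + 2)) (fourier (H (m + 2)) e n (A s (m + 2) h)) (A s (m + 2) h))) \<longlonglongrightarrow> 0"
    and int: "\<And>i. integrable R
      (mixed_coefficient m b (b (Suc m) (e i)) h' (v(m + 2 := h)) (u(m + 2 := e i)))"
  shows "integrable R (mixed_coefficient (Suc m) b h h' v u)"
    and "(\<lambda>i. \<integral>s. mixed_coefficient m b (b (Suc m) (e i)) h' (v(m + 2 := h)) (u(m + 2 := e i)) s \<partial>R)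
      sums (\<integral>s. mixed_coefficient (Suc m) b h h' v u s \<partial>R)"
proof -
  define P where "P s = (\<Prod>j\<in>{m+3..k+1}. vinner (H j) (A s j (v j)) (u j))" for s
  define Z where "Z n s = vinner (H 1)
    (alternating_product (A s) b m (b (Suc m) (fourier (H (m + 2)) e n (A s (m + 2) h)))) h' * P s" for n s
  let ?Zl = "mixed_coefficient (Suc m) b h h' v u"
  have H1: "complex_hilbert (H 1)" and Hm: "complex_hilbert (H (m + 2))"
    using hilberts m by auto
  interpret H1: complex_hilbert "H 1" by fact
  interpret Hm: complex_hilbert "H (m + 2)" by fact
  have "\<exists>C. 0 \<le> C \<and> bounded_linear_on (H (j + 1)) (H j) (b j) C" if "j \<in> {1..Suc m}" for j
    using bounded_ops_bounded_linear_on[OF hilberts[of "j + 1"] b[OF that]] that m by auto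
  then obtain C where C: "\<And>j. j \<in> {1..Suc m} \<Longrightarrow> 0 \<le> C j"
    "\<And>j. j \<in> {1..Suc m} \<Longrightarrow> bounded_linear_on (H (j + 1)) (H j) (b j) (C j)"
    by metis
  have field_closed: "A s j x \<in> vecs (H j)" if "j \<in> {1..k+1}" "s \<in> space R" "x \<in> vecs (H j)" for j s x
    using fields[OF that(1,2)] that(3) by (simp add: bounded_linear_on_def)
  have Ah: "A s (m + 2) h \<in> vecs (H (m + 2))" if "s \<in> space R" for s
    using field_closed[OF _ that h] m by simp
  have fourier: "fourier (H (m + 2)) e n (A s (m + 2) h) \<in> vecs (H (m + 2))" if "s \<in> space R" for n s
    by (intro Hm.fourier_closed e Ah that)
  have op: "bounded_linear_on (H (m + 2)) (H 1) (alternating_product (A s) b m \<circ> b (Suc m))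
      ((\<Prod>j\<in>{1..Suc m}. C j) * (\<Prod>j\<in>{1..m+1}. N s j))" if s: "s \<in> space R" for s
  proof -
    have "bounded_linear_on (H (m + 1)) (H 1) (alternating_product (A s) b m)
        ((\<Prod>j\<in>{1..m}. C j) * (\<Prod>j\<in>{1..m+1}. N s j))"
      using fields[OF _ s] N_nonneg[OF _ s] C m
      by (intro bounded_linear_on_alternating_product) auto
    moreover have "bounded_linear_on (H (m + 2)) (H (m + 1)) (b (Suc m)) (C (Suc m))"
      using C(2)[of "Suc m"] by simp
    moreover have "0 \<le> (\<Prod>j\<in>{1..m}. C j) * (\<Prod>j\<in>{1..m+1}. N s j)"
      using N_nonneg[OF _ s] C(1) m by (intro mult_nonneg_nonneg prod_nonneg) auto
    ultimately have "bounded_linear_on (H (m + 2)) (H 1) (alternating_product (A s) b m \<circ> b (Suc m))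
        ((\<Prod>j\<in>{1..m}. C j) * (\<Prod>j\<in>{1..m+1}. N s j) * C (Suc m))"
      by (intro bounded_linear_on_compose)
    then show ?thesis by (simp add: mult_ac)
  qed
  have Z_sum: "Z n s = (\<Sum>i<n.
      mixed_coefficient m b (b (Suc m) (e i)) h' (v(m + 2 := h)) (u(m + 2 := e i)) s)"
    if s: "s \<in> space R" for n s
  proof -
    have ivl: "{m+2..k+1} = insert (m + 2) {m+3..k+1}" using m by auto
    have "(\<Prod>j\<in>{m+2..k+1}. vinner (H j) (A s j ((v(m + 2 := h)) j)) ((u(m + 2 := e i)) j))
        = vinner (H (m + 2)) (A s (m + 2) h) (e i) * P s" for i
      unfolding ivl P_def by (subst prod.insert) (auto intro!: prod.cong)
    then show ?thesis
      using inner_bounded_linear_fourier[where e = e and n = n, OF Hm H1 op[OF s] e(1) Ah[OF s] h']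
      by (simp add: Z_def mixed_coefficient_def sum_distrib_right sum_distrib_left mult_ac)
  qed
  have Z_int: "integrable R (Z n)" for n
  proof -
    have "integrable R (\<lambda>s. \<Sum>i<n.
        mixed_coefficient m b (b (Suc m) (e i)) h' (v(m + 2 := h)) (u(m + 2 := e i)) s)"
      using int by (intro Bochner_Integration.integrable_sum)
    then show ?thesis using Z_sum by (simp cong: Bochner_Integration.integrable_cong)
  qed
  have Z_lim: "(\<lambda>n. Z n s) \<longlonglongrightarrow> ?Zl s" if s: "s \<in> space R" for s
  proof -
    have "(\<lambda>n. vinner (H 1) ((alternating_product (A s) b m \<circ> b (Suc m))
        (fourier (H (m + 2)) e n (A s (m + 2) h))) h') \<longlonglongrightarrow>
        vinner (H 1) ((alternating_product (A s) b m \<circ> b (Suc m)) (A s (m + 2) h)) h'"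
      by (rule tendsto_inner_bounded_linear[where a = "\<lambda>n. fourier (H (m + 2)) e n (A s (m + 2) h)", OF Hm H1 op[OF s] fourier[OF s] Ah[OF s] h' expand[OF s]])
    then have "(\<lambda>n. Z n s) \<longlonglongrightarrow>
        vinner (H 1) ((alternating_product (A s) b m \<circ> b (Suc m)) (A s (m + 2) h)) h' * P s"
      unfolding Z_def by (intro tendsto_mult tendsto_const) simp
    then show ?thesis by (simp add: mixed_coefficient_def P_def numeral_3_eq_3)
  qed
  define D where "D = (\<Prod>j\<in>{1..Suc m}. C j) * vnorm (H (m + 2)) h * vnorm (H 1) h' *
    (\<Prod>j\<in>{m+3..k+1}. vnorm (H j) (v j) * vnorm (H j) (u j))"
  have Z_bound: "norm (Z n s) \<le> D * (\<Prod>j\<in>{1..k+1}. N s j)" if s: "s \<in> space R" for n s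
  proof -
    let ?x = "fourier (H (m + 2)) e n (A s (m + 2) h)"
    let ?C = "\<Prod>j\<in>{1..Suc m}. C j" and ?N = "\<Prod>j\<in>{1..m+1}. N s j"
    have nn: "0 \<le> ?C" "0 \<le> ?N"
      using N_nonneg[OF _ s] C(1) m by (intro prod_nonneg; simp)+
    have "vnorm (H (m + 2)) ?x \<le> vnorm (H (m + 2)) (A s (m + 2) h)"
      by (rule Hm.norm_fourier_le[OF e(2) Ah[OF s]])
    also have "\<dots> \<le> N s (m + 2) * vnorm (H (m + 2)) h"
      using fields[of "m + 2" s] s m h by (simp add: bounded_linear_on_def)
    finally have x: "vnorm (H (m + 2)) ?x \<le> N s (m + 2) * vnorm (H (m + 2)) h" .
    have T: "(alternating_product (A s) b m \<circ> b (Suc m)) ?x \<in> vecs (H 1)"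
      and Tn: "vnorm (H 1) ((alternating_product (A s) b m \<circ> b (Suc m)) ?x) \<le> ?C * ?N * vnorm (H (m + 2)) ?x"
      using op[OF s, unfolded bounded_linear_on_def, THEN conjunct1, rule_format, OF fourier[OF s, of n]]
      by simp_all
    have "norm (vinner (H 1) ((alternating_product (A s) b m \<circ> b (Suc m)) ?x) h')
        \<le> vnorm (H 1) ((alternating_product (A s) b m \<circ> b (Suc m)) ?x) * vnorm (H 1) h'"
      by (rule H1.Cauchy_Schwarz[OF T h'])
    also have "\<dots> \<le> (?C * ?N * (N s (m + 2) * vnorm (H (m + 2)) h)) * vnorm (H 1) h'"
      using Tn mult_left_mono[OF x, of "?C * ?N"] nn H1.norm_nonneg[OF h']
      by (intro mult_right_mono) auto
    finally have 1: "norm (vinner (H 1) ((alternating_product (A s) b m \<circ> b (Suc m)) ?x) h')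
        \<le> (?C * ?N * (N s (m + 2) * vnorm (H (m + 2)) h)) * vnorm (H 1) h'" .
    have 2: "norm (P s) \<le> (\<Prod>j\<in>{m+3..k+1}. N s j * (vnorm (H j) (v j) * vnorm (H j) (u j)))"
      unfolding P_def prod_norm[symmetric]
    proof (rule prod_mono)
      fix j assume "j \<in> {m+3..k+1}"
      then have j: "j \<in> {1..k+1}" by auto
      interpret Hj: complex_hilbert "H j" by (rule hilberts[OF j])
      have "norm (vinner (H j) (A s j (v j)) (u j)) \<le> vnorm (H j) (A s j (v j)) * vnorm (H j) (u j)"
        by (rule Hj.Cauchy_Schwarz[OF field_closed[OF j s v[OF j]] u[OF j]])
      also have "\<dots> \<le> (N s j * vnorm (H j) (v j)) * vnorm (H j) (u j)"
        using fields[OF j s] v[OF j] Hj.norm_nonneg[OF u[OF j]]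
        by (intro mult_right_mono) (simp_all add: bounded_linear_on_def)
      finally show "0 \<le> norm (vinner (H j) (A s j (v j)) (u j)) \<and> norm (vinner (H j) (A s j (v j)) (u j))
          \<le> N s j * (vnorm (H j) (v j) * vnorm (H j) (u j))"
        by (simp add: mult.assoc)
    qed
    have "norm (Z n s) \<le> ((?C * ?N * (N s (m + 2) * vnorm (H (m + 2)) h)) * vnorm (H 1) h') *
        (\<Prod>j\<in>{m+3..k+1}. N s j * (vnorm (H j) (v j) * vnorm (H j) (u j)))"
      unfolding Z_def norm_mult using 1 2 by (intro mult_mono') simp_all
    also have "\<dots> = D * (?N * N s (m + 2) * (\<Prod>j\<in>{m+3..k+1}. N s j))"
      by (simp add: D_def prod.distrib mult_ac)
    also have "?N * N s (m + 2) * (\<Prod>j\<in>{m+3..k+1}. N s j) = (\<Prod>j\<in>{1..k+1}. N s j)"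
    proof -
      have ivl: "{1..k+1} = {1..m+1} \<union> insert (m + 2) {m+3..k+1}" using m by auto
      have "(\<Prod>j\<in>{1..m+1} \<union> insert (m + 2) {m+3..k+1}. N s j)
          = ?N * (\<Prod>j\<in>insert (m + 2) {m+3..k+1}. N s j)"
        by (rule prod.union_disjoint) auto
      also have "(\<Prod>j\<in>insert (m + 2) {m+3..k+1}. N s j)
          = N s (m + 2) * (\<Prod>j\<in>{m+3..k+1}. N s j)"
        by (rule prod.insert) auto
      finally show ?thesis unfolding ivl by (simp only: mult.assoc)
    qed
    finally show ?thesis .
  qed
  have D: "0 \<le> D"
    unfolding D_def using C(1) complex_hilbert.norm_nonneg[OF hilberts] v u
    by (intro mult_nonneg_nonneg prod_nonneg Hm.norm_nonneg H1.norm_nonneg h h') auto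
  have dom: "AE s in R. norm (Z n s) \<le> D * g s" for n
    using N_le_g AE_space
  proof eventually_elim
    fix s assume "(\<Prod>j\<in>{1..k+1}. N s j) \<le> g s" "s \<in> space R"
    then show "norm (Z n s) \<le> D * g s"
      using Z_bound[of s n] mult_left_mono[OF _ D] by (meson order_trans)
  qed
  have Zl_meas: "?Zl \<in> borel_measurable R"
    by (rule borel_measurable_LIMSEQ_metric[OF borel_measurable_integrable[OF Z_int] Z_lim])
  note dct = Zl_meas borel_measurable_integrable[OF Z_int] integrable_mult_right[OF integrable_g, of D]
    AE_I2[OF Z_lim] dom
  show "integrable R ?Zl" by (rule integrable_dominated_convergence[OF dct])
  have "(\<lambda>n. \<integral>s. Z n s \<partial>R) \<longlonglongrightarrow> (\<integral>s. ?Zl s \<partial>R)"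
    by (rule integral_dominated_convergence[OF dct])
  moreover have "(\<integral>s. Z n s \<partial>R) = (\<Sum>i<n. \<integral>s.
      mixed_coefficient m b (b (Suc m) (e i)) h' (v(m + 2 := h)) (u(m + 2 := e i)) s \<partial>R)" for n
    by (rule trans[OF Bochner_Integration.integral_cong[OF refl Z_sum] Bochner_Integration.integral_sum[OF int]])
  ultimately show "(\<lambda>i. \<integral>s. mixed_coefficient m b (b (Suc m) (e i)) h' (v(m + 2 := h)) (u(m + 2 := e i)) s \<partial>R)
      sums (\<integral>s. ?Zl s \<partial>R)"
    by (simp add: sums_def)
qed

end

text \<open>
  Induction on the number of operators that are not of rank one, for both families simultaneously.
  It is essential that the sequence \<open>e\<close> serves both families, since the terms are compared one by one.
\<close>

lemma integral_alternating_product_eq: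
  assumes R: "operator_fields k H R A N g" and R': "operator_fields k H R' A' N' g'"
    and b: "\<And>j. j \<in> {1..k} \<Longrightarrow> b j \<in> bounded_ops (H (j + 1)) (H j)"
    and expand: "\<And>j h. \<lbrakk>j \<in> {1..k+1}; h \<in> vecs (H j)\<rbrakk> \<Longrightarrow>
      \<exists>e. (\<forall>i. e i \<in> vecs (H j)) \<and> (\<forall>n. orthonormal_upto (H j) e n) \<and>
        (\<forall>s\<in>space R. (\<lambda>n. vnorm (H j) (vdiff (H j) (fourier (H j) e n (A s j h)) (A s j h))) \<longlonglongrightarrow> 0) \<and>
        (\<forall>s\<in>space R'. (\<lambda>n. vnorm (H j) (vdiff (H j) (fourier (H j) e n (A' s j h)) (A' s j h))) \<longlonglongrightarrow> 0)"
    and rank_one: "\<And>v u. \<lbrakk>\<And>j. j \<in> {1..k+1} \<Longrightarrow> v j \<in> vecs (H j); \<And>j. j \<in> {1..k+1} \<Longrightarrow> u j \<in> vecs (H j)\<rbrakk>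
      \<Longrightarrow> integrable R (\<lambda>s. \<Prod>j\<in>{1..k+1}. vinner (H j) (A s j (v j)) (u j)) \<and>
        integrable R' (\<lambda>s. \<Prod>j\<in>{1..k+1}. vinner (H j) (A' s j (v j)) (u j)) \<and>
        (\<integral>s. (\<Prod>j\<in>{1..k+1}. vinner (H j) (A s j (v j)) (u j)) \<partial>R) =
        (\<integral>s. (\<Prod>j\<in>{1..k+1}. vinner (H j) (A' s j (v j)) (u j)) \<partial>R')"
    and h: "h \<in> vecs (H (k + 1))" and h': "h' \<in> vecs (H 1)"
  shows "integrable R (\<lambda>s. vinner (H 1) (alternating_product (A s) b k h) h') \<and>
    integrable R' (\<lambda>s. vinner (H 1) (alternating_product (A' s) b k h) h') \<and>
    (\<integral>s. vinner (H 1) (alternating_product (A s) b k h) h' \<partial>R) =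
    (\<integral>s. vinner (H 1) (alternating_product (A' s) b k h) h' \<partial>R')"
proof -
  interpret R: operator_fields k H R A N g by fact
  interpret R': operator_fields k H R' A' N' g' by fact
  have main: "integrable R (R.mixed_coefficient m b h h' v u) \<and>
      integrable R' (R'.mixed_coefficient m b h h' v u) \<and>
      (\<integral>s. R.mixed_coefficient m b h h' v u s \<partial>R) = (\<integral>s. R'.mixed_coefficient m b h h' v u s \<partial>R')"
    if "m \<le> k" "h \<in> vecs (H (m + 1))" "h' \<in> vecs (H 1)"
      "\<And>j. j \<in> {1..k+1} \<Longrightarrow> v j \<in> vecs (H j)" "\<And>j. j \<in> {1..k+1} \<Longrightarrow> u j \<in> vecs (H j)" for m h h' v u
    using that
  proof (induction m arbitrary: h v u)
    case 0
    have ivl: "{1..k+1} = insert 1 {2..k+1}" by auto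
    have P: "vinner (H 1) (B 1 h) h' * (\<Prod>j\<in>{2..k+1}. vinner (H j) (B j (v j)) (u j)) =
        (\<Prod>j\<in>{1..k+1}. vinner (H j) (B j ((v(1 := h)) j)) ((u(1 := h')) j))" for B
      unfolding ivl by (subst prod.insert) (auto intro!: prod.cong)
    have "R.mixed_coefficient 0 b h h' v u =
        (\<lambda>s. \<Prod>j\<in>{1..k+1}. vinner (H j) (A s j ((v(1 := h)) j)) ((u(1 := h')) j))"
      "R'.mixed_coefficient 0 b h h' v u =
        (\<lambda>s. \<Prod>j\<in>{1..k+1}. vinner (H j) (A' s j ((v(1 := h)) j)) ((u(1 := h')) j))"
      unfolding R.mixed_coefficient_def R'.mixed_coefficient_def alternating_product.simps
      by (simp_all only: add_0 P)
    then show ?case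
      using rank_one[of "v(1 := h)" "u(1 := h')"] 0 by simp
  next
    case (Suc m)
    then have m: "m < k" and h: "h \<in> vecs (H (m + 2))" and j: "m + 2 \<in> {1..k+1}" by auto
    obtain e where e: "\<And>i. e i \<in> vecs (H (m + 2))" "\<And>n. orthonormal_upto (H (m + 2)) e n"
      "\<And>s. s \<in> space R \<Longrightarrow> (\<lambda>n. vnorm (H (m + 2))
        (vdiff (H (m + 2)) (fourier (H (m + 2)) e n (A s (m + 2) h)) (A s (m + 2) h))) \<longlonglongrightarrow> 0"
      "\<And>s. s \<in> space R' \<Longrightarrow> (\<lambda>n. vnorm (H (m + 2))
        (vdiff (H (m + 2)) (fourier (H (m + 2)) e n (A' s (m + 2) h)) (A' s (m + 2) h))) \<longlonglongrightarrow> 0"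
      using expand[OF j h] by blast
    have b': "\<And>j. j \<in> {1..Suc m} \<Longrightarrow> b j \<in> bounded_ops (H (j + 1)) (H j)" using b m by auto
    have be: "b (Suc m) (e i) \<in> vecs (H (m + 1))" for i
      using b'[of "Suc m"] e(1)[of i] by (auto simp: bounded_ops_def)
    have IH: "integrable R (R.mixed_coefficient m b (b (Suc m) (e i)) h' (v(m + 2 := h)) (u(m + 2 := e i))) \<and>
        integrable R' (R'.mixed_coefficient m b (b (Suc m) (e i)) h' (v(m + 2 := h)) (u(m + 2 := e i))) \<and>
        (\<integral>s. R.mixed_coefficient m b (b (Suc m) (e i)) h' (v(m + 2 := h)) (u(m + 2 := e i)) s \<partial>R) =
        (\<integral>s. R'.mixed_coefficient m b (b (Suc m) (e i)) h' (v(m + 2 := h)) (u(m + 2 := e i)) s \<partial>R')" for i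
      using m be Suc.prems h e(1) by (intro Suc.IH) auto
    note step = R.mixed_coefficient_sums[where e = e, OF m b' h Suc.prems(3-5) e(1,2,3)]
      and step' = R'.mixed_coefficient_sums[where e = e, OF m b' h Suc.prems(3-5) e(1,2,4)]
    have "(\<lambda>i. \<integral>s. R.mixed_coefficient m b (b (Suc m) (e i)) h' (v(m + 2 := h)) (u(m + 2 := e i)) s \<partial>R)
        sums (\<integral>s. R.mixed_coefficient (Suc m) b h h' v u s \<partial>R)"
      using IH by (intro step(2)) auto
    moreover have "(\<lambda>i. \<integral>s. R.mixed_coefficient m b (b (Suc m) (e i)) h' (v(m + 2 := h)) (u(m + 2 := e i)) s \<partial>R)
        sums (\<integral>s. R'.mixed_coefficient (Suc m) b h h' v u s \<partial>R')"
      using IH step'(2) by auto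
    ultimately show ?case
      using IH step(1) step'(1) sums_unique2 by blast
  qed
  have full: "R.mixed_coefficient k b h h' v u = (\<lambda>s. vinner (H 1) (alternating_product (A s) b k h) h')"
    "R'.mixed_coefficient k b h h' v u = (\<lambda>s. vinner (H 1) (alternating_product (A' s) b k h) h')" for v u
    by (simp_all add: R.mixed_coefficient_def R'.mixed_coefficient_def fun_eq_iff)
  have "vzero (H j) \<in> vecs (H j)" if "j \<in> {1..k+1}" for j
    using complex_hilbert.zero_closed[OF R.hilberts[OF that]] .
  from main[OF order_refl h h' this this] show ?thesis unfolding full .
qed


section \<open>Rank one operators\<close>

text \<open>
  The norms are not known to depend measurably on \<open>s\<close>; a measurable majorant of finite integral is
  what the upper integral provides.
\<close>

lemma Linf_decomposition_dominated:
  assumes dec: "Linf_decomposition k X Y \<phi> R f"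
  obtains g where "integrable R g"
    "AE s in R. (\<Prod>j\<in>{1..k+1}. Linf_norm (X j) (\<lambda>w. f j w s)) \<le> g s"
proof -
  let ?h = "\<lambda>s. \<Prod>j\<in>{1..k+1}. Linf_norm (X j) (\<lambda>w. f j w s)"
  have "upper_integral R (\<lambda>s. ennreal (?h s)) < \<infinity>"
    using dec by (simp only: Linf_decomposition_def)
  then obtain g where g: "g \<in> borel_measurable R" "AE s in R. ennreal (?h s) \<le> g s"
    "(\<integral>\<^sup>+s. g s \<partial>R) < \<infinity>"
    unfolding upper_integral_def Inf_less_iff by blast
  have fin: "AE s in R. g s \<noteq> \<infinity>"
    using g(1,3) by (intro nn_integral_PInf_AE) auto
  have "integrable R (\<lambda>s. enn2real (g s))"
  proof (rule integrableI_nonneg)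
    show "(\<lambda>s. enn2real (g s)) \<in> borel_measurable R" using g(1) by measurable
    have "(\<integral>\<^sup>+s. ennreal (enn2real (g s)) \<partial>R) = (\<integral>\<^sup>+s. g s \<partial>R)"
      using fin by (intro nn_integral_cong_AE) (auto simp: less_top)
    then show "(\<integral>\<^sup>+s. ennreal (enn2real (g s)) \<partial>R) < \<infinity>" using g(3) by simp
  qed auto
  moreover have "AE s in R. ?h s \<le> enn2real (g s)"
    using g(2) fin
  proof eventually_elim
    fix s assume "ennreal (?h s) \<le> g s" "g s \<noteq> \<infinity>"
    then have "ennreal (?h s) \<le> ennreal (enn2real (g s))" by (simp add: less_top)
    then show "?h s \<le> enn2real (g s)" by (simp only: ennreal_le_iff enn2real_nonneg)
  qed
  ultimately show thesis by (rule that)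
qed

locale pvm_family =
  fixes k :: nat and X :: "nat \<Rightarrow> ('w, 'h) pvm_data" and Y :: "(nat \<Rightarrow> 'w, 't) pvm_data"
    and \<tau> :: "(nat \<Rightarrow> 'h) \<Rightarrow> 't"
  assumes factors: "j \<in> {1..k+1} \<Longrightarrow> pvm_space (X j)"
    and product: "product_pvm Y {1..k+1} X \<tau>"
begin

text \<open>
  Outside the index set some \<open>\<sigma>\<close>-finite measure is needed, because the locale of \<open>\<sigma>\<close>-finite products
  speaks about all indices.
\<close>

definition factor_measure :: "(nat \<Rightarrow> 'h) \<Rightarrow> nat \<Rightarrow> 'w measure" where
  "factor_measure x j = (if j \<in> {1..k+1} then pvm_measure (X j) (x j) else count_space {})"

lemma product_sigma_finite_factor:
  assumes x: "x \<in> (\<Pi>\<^sub>E j\<in>{1..k+1}. vecs (hsp (X j)))"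
  shows "product_sigma_finite (factor_measure x)"
proof (rule product_sigma_finite.intro)
  fix j
  show "sigma_finite_measure (factor_measure x j)"
  proof (cases "j \<in> {1..k+1}")
    case True
    then have "finite_measure (pvm_measure (X j) (x j))"
      using x by (intro pvm_space.finite_pvm_measure factors) auto
    then show ?thesis using True by (simp add: factor_measure_def finite_measure_def)
  next
    case False
    have "finite_measure (count_space ({} :: 'w set))" by (rule finite_measure_count_space) simp
    then show ?thesis
      by (simp only: factor_measure_def if_not_P[OF False] finite_measure.axioms(1))
  qed
qed

text \<open>
  The link between \<open>P\<close> and the factors: the positive measure of an elementary tensor is the product
  measure. Both agree on rectangles, by the formula for inner products of elementary tensors.
\<close>

lemma pvm_measure_product:
  assumes x: "x \<in> (\<Pi>\<^sub>E j\<in>{1..k+1}. vecs (hsp (X j)))"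
  shows "pvm_measure Y (\<tau> x) = PiM {1..k+1} (factor_measure x)"
proof -
  interpret Y: product_pvm Y "{1..k+1}" X \<tau> by (rule product)
  interpret F: product_sigma_finite "factor_measure x" by (rule product_sigma_finite_factor[OF x])
  have sets_F: "sets (PiM {1..k+1} (factor_measure x)) = sets (PiM {1..k+1} (\<lambda>j. base (X j)))"
    by (rule sets_PiM_cong) (simp_all add: factor_measure_def)
  have x_j: "x j \<in> vecs (hsp (X j))" if "j \<in> {1..k+1}" for j using x that by auto
  show ?thesis
  proof (rule F.PiM_eqI)
    show "sets (pvm_measure Y (\<tau> x)) = sets (PiM {1..k+1} (factor_measure x))"
      using sets_F Y.sets_product by simp
    fix G assume "\<And>j. j \<in> {1..k+1} \<Longrightarrow> G j \<in> sets (factor_measure x j)"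
    then have G: "\<And>j. j \<in> {1..k+1} \<Longrightarrow> G j \<in> sets (base (X j))" by (simp add: factor_measure_def)
    then have PG: "Pi\<^sub>E {1..k+1} G \<in> sets (base Y)"
      unfolding Y.sets_product by (intro sets_PiM_I_finite) auto
    have px: "(\<lambda>j\<in>{1..k+1}. prj (X j) (G j) (x j)) \<in> (\<Pi>\<^sub>E j\<in>{1..k+1}. vecs (hsp (X j)))"
      using pvm_space.prj_closed[OF factors G x_j] by auto
    have "vinner (hsp Y) (prj Y (Pi\<^sub>E {1..k+1} G) (\<tau> x)) (\<tau> x)
        = (\<Prod>j\<in>{1..k+1}. vinner (hsp (X j)) (prj (X j) (G j) (x j)) (x j))"
      using Y.prj_product[OF G x] Y.tensor_inner[OF px x] by simp
    also have "\<dots> = (\<Prod>j\<in>{1..k+1}. of_real (measure (factor_measure x j) (G j)))"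
      by (rule prod.cong[OF refl])
        (simp add: factor_measure_def pvm_space.measure_pvm_measure[OF factors x_j G])
    finally have "complex_of_real (measure (pvm_measure Y (\<tau> x)) (Pi\<^sub>E {1..k+1} G))
        = of_real (\<Prod>j\<in>{1..k+1}. measure (factor_measure x j) (G j))"
      using Y.measure_pvm_measure[OF Y.tensor_closed[OF x] PG] by simp
    then have "measure (pvm_measure Y (\<tau> x)) (Pi\<^sub>E {1..k+1} G)
        = (\<Prod>j\<in>{1..k+1}. measure (factor_measure x j) (G j))"
      by (simp only: of_real_eq_iff)
    moreover have "emeasure (factor_measure x j) (G j) = ennreal (measure (factor_measure x j) (G j))"
      if "j \<in> {1..k+1}" for j
      using finite_measure.emeasure_eq_measure[OF pvm_space.finite_pvm_measure[OF factors x_j]] that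
      by (simp add: factor_measure_def)
    ultimately show "emeasure (pvm_measure Y (\<tau> x)) (Pi\<^sub>E {1..k+1} G)
        = (\<Prod>j\<in>{1..k+1}. emeasure (factor_measure x j) (G j))"
      unfolding finite_measure.emeasure_eq_measure[OF Y.finite_pvm_measure[OF Y.tensor_closed[OF x]]]
      by (simp only: prod_ennreal[symmetric] measure_nonneg cong: prod.cong)
  qed simp
qed

lemma decomposition_measurable:
  assumes dec: "Linf_decomposition k X Y \<phi> R f" and j: "j \<in> {1..k+1}"
    and M: "sets M = sets (base (X j))"
  shows "(\<lambda>(s, w). f j w s) \<in> borel_measurable (R \<Otimes>\<^sub>M M)"
proof -
  have "(\<lambda>(w, s). f j w s) \<in> borel_measurable (base (X j) \<Otimes>\<^sub>M R)"
    using dec j by (simp only: Linf_decomposition_def)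
  also have "borel_measurable (base (X j) \<Otimes>\<^sub>M R) = borel_measurable (M \<Otimes>\<^sub>M R)"
    by (intro measurable_cong_sets sets_pair_measure_cong M[symmetric] refl)
  finally have "(\<lambda>(s, w). (\<lambda>(w, s). f j w s) (w, s)) \<in> borel_measurable (R \<Otimes>\<^sub>M M)"
    by (rule measurable_pair_swap)
  then show ?thesis by simp
qed

text \<open>
  Fubini's theorem: the function \<open>(s, \<omega>) \<mapsto> \<Prod>\<^sub>j f j (\<omega> j) s\<close> is integrable because its integral over
  \<open>\<omega>\<close> is at most a multiple of the product of the norms. The right-hand side of the second claim
  involves the decomposition only through the function that it represents.
\<close>

lemma integral_product_diagonal:
  assumes dec: "Linf_decomposition k X Y \<phi> R f"
    and x: "x \<in> (\<Pi>\<^sub>E j\<in>{1..k+1}. vecs (hsp (X j)))"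
  shows "integrable R (\<lambda>s. \<Prod>j\<in>{1..k+1}. \<integral>w. f j w s \<partial>pvm_measure (X j) (x j))"
    and "(\<integral>s. (\<Prod>j\<in>{1..k+1}. \<integral>w. f j w s \<partial>pvm_measure (X j) (x j)) \<partial>R)
      = (\<integral>\<omega>. (\<integral>s. (\<Prod>j\<in>{1..k+1}. f j (\<omega> j) s) \<partial>R) \<partial>pvm_measure Y (\<tau> x))"
    and "(\<lambda>\<omega>. \<integral>s. (\<Prod>j\<in>{1..k+1}. f j (\<omega> j) s) \<partial>R) \<in> borel_measurable (pvm_measure Y (\<tau> x))"
proof -
  interpret R: sigma_finite_measure R using dec by (simp only: Linf_decomposition_def)
  interpret Y: product_pvm Y "{1..k+1}" X \<tau> by (rule product)
  interpret F: product_sigma_finite "factor_measure x" by (rule product_sigma_finite_factor[OF x])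
  let ?I = "{1..k+1}"
  define P where "P = PiM ?I (factor_measure x)"
  have P: "pvm_measure Y (\<tau> x) = P" unfolding P_def by (rule pvm_measure_product[OF x])
  interpret P: finite_measure P
    unfolding P[symmetric] by (rule Y.finite_pvm_measure[OF Y.tensor_closed[OF x]])
  interpret RP: pair_sigma_finite R P ..
  have x_j: "x j \<in> vecs (hsp (X j))" if "j \<in> ?I" for j using x that by auto
  have Linf: "(\<lambda>w. f j w s) \<in> Linf (X j)" if "j \<in> ?I" "s \<in> space R" for j s
    using dec that by (simp only: Linf_decomposition_def)
  have int_j: "integrable (factor_measure x j) (\<lambda>w. f j w s)" if "j \<in> ?I" "s \<in> space R" for j s
    using pvm_space.Linf_integrable[OF factors Linf x_j] that by (simp add: factor_measure_def)
  define F where "F s \<omega> = (\<Prod>j\<in>?I. f j (\<omega> j) s)" for s \<omega>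
  have F_meas: "(\<lambda>(s, \<omega>). F s \<omega>) \<in> borel_measurable (R \<Otimes>\<^sub>M P)"
  proof -
    have "(\<lambda>p. f j (snd p j) (fst p)) \<in> borel_measurable (R \<Otimes>\<^sub>M P)" if j: "j \<in> ?I" for j
    proof -
      have "(\<lambda>(s, w). f j w s) \<in> borel_measurable (R \<Otimes>\<^sub>M factor_measure x j)"
        by (rule decomposition_measurable[OF dec j]) (use j in \<open>simp add: factor_measure_def\<close>)
      moreover have "(\<lambda>p. (fst p, snd p j)) \<in> (R \<Otimes>\<^sub>M P) \<rightarrow>\<^sub>M (R \<Otimes>\<^sub>M factor_measure x j)"
        unfolding P_def using j by measurable
      ultimately have "(\<lambda>p. (\<lambda>(s, w). f j w s) (fst p, snd p j)) \<in> borel_measurable (R \<Otimes>\<^sub>M P)"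
        by (rule measurable_compose_rev)
      then show ?thesis by simp
    qed
    then show ?thesis unfolding F_def by (simp add: split_beta' borel_measurable_prod)
  qed
  have F_int: "(\<integral>\<omega>. F s \<omega> \<partial>P) = (\<Prod>j\<in>?I. \<integral>w. f j w s \<partial>pvm_measure (X j) (x j))"
    and F_norm_int: "(\<integral>\<omega>. norm (F s \<omega>) \<partial>P) = (\<Prod>j\<in>?I. \<integral>w. norm (f j w s) \<partial>pvm_measure (X j) (x j))"
    and F_integrable: "integrable P (F s)" if s: "s \<in> space R" for s
  proof -
    have "(\<integral>\<omega>. F s \<omega> \<partial>P) = (\<Prod>j\<in>?I. \<integral>w. f j w s \<partial>factor_measure x j)"
      unfolding F_def P_def by (rule F.product_integral_prod) (use int_j s in auto)
    then show "(\<integral>\<omega>. F s \<omega> \<partial>P) = (\<Prod>j\<in>?I. \<integral>w. f j w s \<partial>pvm_measure (X j) (x j))"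
      by (simp add: factor_measure_def)
    have "(\<integral>\<omega>. norm (F s \<omega>) \<partial>P) = (\<Prod>j\<in>?I. \<integral>w. norm (f j w s) \<partial>factor_measure x j)"
      unfolding F_def P_def prod_norm[symmetric]
      by (rule F.product_integral_prod) (use int_j s in auto)
    then show "(\<integral>\<omega>. norm (F s \<omega>) \<partial>P) = (\<Prod>j\<in>?I. \<integral>w. norm (f j w s) \<partial>pvm_measure (X j) (x j))"
      by (simp add: factor_measure_def)
    show "integrable P (F s)"
      unfolding F_def P_def by (rule F.product_integrable_prod) (use int_j s in auto)
  qed
  obtain g where g: "integrable R g"
    "AE s in R. (\<Prod>j\<in>?I. Linf_norm (X j) (\<lambda>w. f j w s)) \<le> g s"
    by (rule Linf_decomposition_dominated[OF dec])
  define D where "D = (\<Prod>j\<in>?I. (vnorm (hsp (X j)) (x j))\<^sup>2)"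
  have D: "0 \<le> D" unfolding D_def by (intro prod_nonneg) simp
  have bound: "(\<integral>\<omega>. norm (F s \<omega>) \<partial>P) \<le> D * (\<Prod>j\<in>?I. Linf_norm (X j) (\<lambda>w. f j w s))"
    if s: "s \<in> space R" for s
  proof -
    have "(\<Prod>j\<in>?I. \<integral>w. norm (f j w s) \<partial>pvm_measure (X j) (x j))
        \<le> (\<Prod>j\<in>?I. Linf_norm (X j) (\<lambda>w. f j w s) * (vnorm (hsp (X j)) (x j))\<^sup>2)"
      using pvm_space.integral_norm_pvm_measure_le[OF factors Linf x_j] s
      by (intro prod_mono conjI Bochner_Integration.integral_nonneg) auto
    then show ?thesis by (simp add: F_norm_int[OF s] D_def prod.distrib mult.commute)
  qed
  have int: "integrable (R \<Otimes>\<^sub>M P) (case_prod F)"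
  proof (rule RP.Fubini_integrable[OF F_meas])
    show "integrable R (\<lambda>s. \<integral>\<omega>. norm (case_prod F (s, \<omega>)) \<partial>P)"
    proof (rule Bochner_Integration.integrable_bound[OF integrable_mult_right[OF g(1), of D]])
      show "(\<lambda>s. \<integral>\<omega>. norm (case_prod F (s, \<omega>)) \<partial>P) \<in> borel_measurable R"
        using F_meas by (intro P.borel_measurable_lebesgue_integral) (simp add: split_beta')
      show "AE s in R. norm (\<integral>\<omega>. norm (case_prod F (s, \<omega>)) \<partial>P) \<le> norm (D * g s)"
        using g(2) AE_space
      proof eventually_elim
        fix s assume s: "(\<Prod>j\<in>?I. Linf_norm (X j) (\<lambda>w. f j w s)) \<le> g s" "s \<in> space R"
        have "(\<integral>\<omega>. norm (F s \<omega>) \<partial>P) \<le> D * g s"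
          using bound[OF s(2)] mult_left_mono[OF s(1) D] by (rule order_trans)
        moreover have "0 \<le> (\<integral>\<omega>. norm (F s \<omega>) \<partial>P)" by (rule Bochner_Integration.integral_nonneg) simp
        ultimately show "norm (\<integral>\<omega>. norm (case_prod F (s, \<omega>)) \<partial>P) \<le> norm (D * g s)" by simp
      qed
    qed
    show "AE s in R. integrable P (\<lambda>\<omega>. case_prod F (s, \<omega>))"
      using F_integrable by (intro AE_I2) simp
  qed
  have outer: "integrable R (\<lambda>s. \<integral>\<omega>. F s \<omega> \<partial>P)"
    using RP.integrable_fst'[OF int] by simp
  have "integrable R (\<lambda>s. \<integral>\<omega>. F s \<omega> \<partial>P) \<longleftrightarrow>
      integrable R (\<lambda>s. \<Prod>j\<in>?I. \<integral>w. f j w s \<partial>pvm_measure (X j) (x j))"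
    by (rule Bochner_Integration.integrable_cong[OF refl]) (rule F_int)
  with outer show "integrable R (\<lambda>s. \<Prod>j\<in>?I. \<integral>w. f j w s \<partial>pvm_measure (X j) (x j))"
    by simp
  have "(\<integral>s. (\<Prod>j\<in>?I. \<integral>w. f j w s \<partial>pvm_measure (X j) (x j)) \<partial>R) = (\<integral>s. (\<integral>\<omega>. F s \<omega> \<partial>P) \<partial>R)"
    by (rule Bochner_Integration.integral_cong[OF refl F_int[symmetric]])
  also have "\<dots> = (\<integral>\<omega>. (\<integral>s. F s \<omega> \<partial>R) \<partial>P)"
    by (rule RP.Fubini_integral[OF int, symmetric])
  finally show "(\<integral>s. (\<Prod>j\<in>?I. \<integral>w. f j w s \<partial>pvm_measure (X j) (x j)) \<partial>R)
      = (\<integral>\<omega>. (\<integral>s. (\<Prod>j\<in>?I. f j (\<omega> j) s) \<partial>R) \<partial>pvm_measure Y (\<tau> x))"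
    unfolding P F_def .
  have "(\<lambda>(\<omega>, s). F s \<omega>) \<in> borel_measurable (P \<Otimes>\<^sub>M R)"
    using measurable_pair_swap[OF F_meas] by (simp add: split_beta')
  then show "(\<lambda>\<omega>. \<integral>s. (\<Prod>j\<in>?I. f j (\<omega> j) s) \<partial>R) \<in> borel_measurable (pvm_measure Y (\<tau> x))"
    unfolding P F_def[symmetric] by (rule R.borel_measurable_lebesgue_integral)
qed

text \<open>
  A \<open>P\<close>-null set is null for every positive measure of \<open>P\<close>.
\<close>

lemma decomposition_AE:
  assumes dec: "Linf_decomposition k X Y \<phi> R f"
    and x: "x \<in> (\<Pi>\<^sub>E j\<in>{1..k+1}. vecs (hsp (X j)))"
  shows "AE \<omega> in pvm_measure Y (\<tau> x). \<phi> \<omega> = (\<integral>s. (\<Prod>j\<in>{1..k+1}. f j (\<omega> j) s) \<partial>R)"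
proof -
  interpret Y: product_pvm Y "{1..k+1}" X \<tau> by (rule product)
  have "pvm_ae Y (\<lambda>\<omega>. integrable R (\<lambda>s. \<Prod>j\<in>{1..k+1}. f j (\<omega> j) s) \<and>
      \<phi> \<omega> = (\<integral>s. (\<Prod>j\<in>{1..k+1}. f j (\<omega> j) s) \<partial>R))"
    using dec by (simp only: Linf_decomposition_def)
  from Y.AE_pvm_measure[OF this Y.tensor_closed[OF x]] show ?thesis by eventually_elim blast
qed

lemma integral_product_diagonal_eq:
  assumes dec: "Linf_decomposition k X Y \<phi> R f" and dec': "Linf_decomposition k X Y \<phi> R' f'"
    and x: "x \<in> (\<Pi>\<^sub>E j\<in>{1..k+1}. vecs (hsp (X j)))"
  shows "(\<integral>s. (\<Prod>j\<in>{1..k+1}. \<integral>w. f j w s \<partial>pvm_measure (X j) (x j)) \<partial>R) =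
    (\<integral>s. (\<Prod>j\<in>{1..k+1}. \<integral>w. f' j w s \<partial>pvm_measure (X j) (x j)) \<partial>R')"
  unfolding integral_product_diagonal(2)[OF dec x] integral_product_diagonal(2)[OF dec' x]
proof (rule integral_cong_AE)
  show "AE \<omega> in pvm_measure Y (\<tau> x). (\<integral>s. (\<Prod>j\<in>{1..k+1}. f j (\<omega> j) s) \<partial>R) =
      (\<integral>s. (\<Prod>j\<in>{1..k+1}. f' j (\<omega> j) s) \<partial>R')"
    using decomposition_AE[OF dec x] decomposition_AE[OF dec' x] by eventually_elim simp
qed (rule integral_product_diagonal(3)[OF dec x] integral_product_diagonal(3)[OF dec' x])+

definition polar_family :: "(nat \<Rightarrow> 'h) \<Rightarrow> (nat \<Rightarrow> 'h) \<Rightarrow> (nat \<Rightarrow> nat) \<Rightarrow> nat \<Rightarrow> 'h" where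
  "polar_family v u p = (\<lambda>j\<in>{1..k+1}. polar_vec (hsp (X j)) (v j) (u j) (p j))"

lemma polar_family_closed:
  assumes "\<And>j. j \<in> {1..k+1} \<Longrightarrow> v j \<in> vecs (hsp (X j))" "\<And>j. j \<in> {1..k+1} \<Longrightarrow> u j \<in> vecs (hsp (X j))"
  shows "polar_family v u p \<in> (\<Pi>\<^sub>E j\<in>{1..k+1}. vecs (hsp (X j)))"
  unfolding polar_family_def
proof (rule restrict_PiE_iff[THEN iffD2], rule ballI)
  fix j assume j: "j \<in> {1..k+1}"
  show "polar_vec (hsp (X j)) (v j) (u j) (p j) \<in> vecs (hsp (X j))"
    by (rule pvm_space.polar_closed[OF factors[OF j] assms(1)[OF j] assms(2)[OF j]])
qed

text \<open>
  Polarizing each of the \<open>k + 1\<close> factors and multiplying out reduces arbitrary pairs of vectors to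
  the diagonal case, in which the product measure is positive.
\<close>

lemma rank_one_polarization:
  assumes dec: "Linf_decomposition k X Y \<phi> R f" and s: "s \<in> space R"
    and v: "\<And>j. j \<in> {1..k+1} \<Longrightarrow> v j \<in> vecs (hsp (X j))"
    and u: "\<And>j. j \<in> {1..k+1} \<Longrightarrow> u j \<in> vecs (hsp (X j))"
  shows "(\<Prod>j\<in>{1..k+1}. vinner (hsp (X j)) (pvm_integral (X j) (\<lambda>w. f j w s) (v j)) (u j)) =
    (\<Sum>p\<in>(\<Pi>\<^sub>E j\<in>{1..k+1}. {..<4}). (\<Prod>j\<in>{1..k+1}. \<i> ^ p j) *
      (\<Prod>j\<in>{1..k+1}. \<integral>w. f j w s \<partial>pvm_measure (X j) (polar_family v u p j)))"
proof -
  have "(\<Prod>j\<in>{1..k+1}. vinner (hsp (X j)) (pvm_integral (X j) (\<lambda>w. f j w s) (v j)) (u j)) =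
      (\<Prod>j\<in>{1..k+1}. \<Sum>n<4. \<i> ^ n * (\<integral>w. f j w s \<partial>pvm_measure (X j) (polar_vec (hsp (X j)) (v j) (u j) n)))"
  proof (rule prod.cong[OF refl])
    fix j assume j: "j \<in> {1..k+1}"
    have "(\<lambda>w. f j w s) \<in> Linf (X j)" using dec j s by (simp only: Linf_decomposition_def)
    then show "vinner (hsp (X j)) (pvm_integral (X j) (\<lambda>w. f j w s) (v j)) (u j) =
        (\<Sum>n<4. \<i> ^ n * (\<integral>w. f j w s \<partial>pvm_measure (X j) (polar_vec (hsp (X j)) (v j) (u j) n)))"
      using pvm_space.pvm_integral(2)[OF factors[OF j] _ v[OF j] u[OF j]]
      by (simp only: pvm_space.pvm_form_def[OF factors[OF j]])
  qed
  also have "\<dots> = (\<Sum>p\<in>(\<Pi>\<^sub>E j\<in>{1..k+1}. {..<4}). \<Prod>j\<in>{1..k+1}.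
      \<i> ^ p j * (\<integral>w. f j w s \<partial>pvm_measure (X j) (polar_vec (hsp (X j)) (v j) (u j) (p j))))"
    by (rule prod_sum_PiE) simp_all
  also have "\<dots> = (\<Sum>p\<in>(\<Pi>\<^sub>E j\<in>{1..k+1}. {..<4}). (\<Prod>j\<in>{1..k+1}. \<i> ^ p j) *
      (\<Prod>j\<in>{1..k+1}. \<integral>w. f j w s \<partial>pvm_measure (X j) (polar_family v u p j)))"
    unfolding prod.distrib polar_family_def by (intro sum.cong prod.cong arg_cong2[of _ _ _ _ "(*)"] refl) simp
  finally show ?thesis .
qed

lemma rank_one_integral:
  assumes dec: "Linf_decomposition k X Y \<phi> R f"
    and v: "\<And>j. j \<in> {1..k+1} \<Longrightarrow> v j \<in> vecs (hsp (X j))"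
    and u: "\<And>j. j \<in> {1..k+1} \<Longrightarrow> u j \<in> vecs (hsp (X j))"
  shows "integrable R (\<lambda>s. \<Prod>j\<in>{1..k+1}. vinner (hsp (X j)) (pvm_integral (X j) (\<lambda>w. f j w s) (v j)) (u j))"
    and "(\<integral>s. (\<Prod>j\<in>{1..k+1}. vinner (hsp (X j)) (pvm_integral (X j) (\<lambda>w. f j w s) (v j)) (u j)) \<partial>R) =
      (\<Sum>p\<in>(\<Pi>\<^sub>E j\<in>{1..k+1}. {..<4}). (\<Prod>j\<in>{1..k+1}. \<i> ^ p j) *
        (\<integral>s. (\<Prod>j\<in>{1..k+1}. \<integral>w. f j w s \<partial>pvm_measure (X j) (polar_family v u p j)) \<partial>R))"
proof -
  note int = integral_product_diagonal(1)[OF dec polar_family_closed[OF v u]]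
  have sum_int: "integrable R (\<lambda>s. \<Sum>p\<in>(\<Pi>\<^sub>E j\<in>{1..k+1}. {..<4}). (\<Prod>j\<in>{1..k+1}. \<i> ^ p j) *
      (\<Prod>j\<in>{1..k+1}. \<integral>w. f j w s \<partial>pvm_measure (X j) (polar_family v u p j)))"
    by (intro Bochner_Integration.integrable_sum integrable_mult_right int)
  show "integrable R (\<lambda>s. \<Prod>j\<in>{1..k+1}. vinner (hsp (X j)) (pvm_integral (X j) (\<lambda>w. f j w s) (v j)) (u j))"
    by (rule iffD2[OF Bochner_Integration.integrable_cong[OF refl rank_one_polarization[OF dec _ v u]] sum_int])
  have "(\<integral>s. (\<Prod>j\<in>{1..k+1}. vinner (hsp (X j)) (pvm_integral (X j) (\<lambda>w. f j w s) (v j)) (u j)) \<partial>R) =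
      (\<integral>s. (\<Sum>p\<in>(\<Pi>\<^sub>E j\<in>{1..k+1}. {..<4}). (\<Prod>j\<in>{1..k+1}. \<i> ^ p j) *
      (\<Prod>j\<in>{1..k+1}. \<integral>w. f j w s \<partial>pvm_measure (X j) (polar_family v u p j))) \<partial>R)"
    by (rule Bochner_Integration.integral_cong[OF refl rank_one_polarization[OF dec _ v u]])
  also have "\<dots> = (\<Sum>p\<in>(\<Pi>\<^sub>E j\<in>{1..k+1}. {..<4}). \<integral>s. (\<Prod>j\<in>{1..k+1}. \<i> ^ p j) *
      (\<Prod>j\<in>{1..k+1}. \<integral>w. f j w s \<partial>pvm_measure (X j) (polar_family v u p j)) \<partial>R)"
    by (rule Bochner_Integration.integral_sum) (rule integrable_mult_right, rule int)
  finally show "(\<integral>s. (\<Prod>j\<in>{1..k+1}. vinner (hsp (X j)) (pvm_integral (X j) (\<lambda>w. f j w s) (v j)) (u j)) \<partial>R) =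
      (\<Sum>p\<in>(\<Pi>\<^sub>E j\<in>{1..k+1}. {..<4}). (\<Prod>j\<in>{1..k+1}. \<i> ^ p j) *
        (\<integral>s. (\<Prod>j\<in>{1..k+1}. \<integral>w. f j w s \<partial>pvm_measure (X j) (polar_family v u p j)) \<partial>R))"
    by (simp only: integral_mult_right_zero)
qed

section \<open>Independence of the decomposition\<close>

lemma operator_fields_decomposition:
  assumes dec: "Linf_decomposition k X Y \<phi> R f"
  shows "\<exists>g. operator_fields k (\<lambda>j. hsp (X j)) R (\<lambda>s j. pvm_integral (X j) (\<lambda>w. f j w s))
    (\<lambda>s j. 2 * Linf_norm (X j) (\<lambda>w. f j w s)) g"
proof -
  obtain g where g: "integrable R g"
    "AE s in R. (\<Prod>j\<in>{1..k+1}. Linf_norm (X j) (\<lambda>w. f j w s)) \<le> g s"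
    by (rule Linf_decomposition_dominated[OF dec])
  have Linf: "(\<lambda>w. f j w s) \<in> Linf (X j)" if "j \<in> {1..k+1}" "s \<in> space R" for j s
    using dec that by (simp only: Linf_decomposition_def)
  have "operator_fields k (\<lambda>j. hsp (X j)) R (\<lambda>s j. pvm_integral (X j) (\<lambda>w. f j w s))
    (\<lambda>s j. 2 * Linf_norm (X j) (\<lambda>w. f j w s)) (\<lambda>s. 2 ^ (k + 1) * g s)"
  proof (rule operator_fields.intro)
    show "integrable R (\<lambda>s. 2 ^ (k + 1) * g s)" using g(1) by (rule integrable_mult_right)
    show "AE s in R. (\<Prod>j\<in>{1..k+1}. 2 * Linf_norm (X j) (\<lambda>w. f j w s)) \<le> 2 ^ (k + 1) * g s"
      using g(2)
    proof eventually_elim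
      fix s assume s: "(\<Prod>j\<in>{1..k+1}. Linf_norm (X j) (\<lambda>w. f j w s)) \<le> g s"
      have "(\<Prod>j\<in>{1..k+1}. 2 * Linf_norm (X j) (\<lambda>w. f j w s)) =
          2 ^ (k + 1) * (\<Prod>j\<in>{1..k+1}. Linf_norm (X j) (\<lambda>w. f j w s))"
        unfolding prod.distrib by simp
      also have "\<dots> \<le> 2 ^ (k + 1) * g s" using s by (rule mult_left_mono) simp
      finally show "(\<Prod>j\<in>{1..k+1}. 2 * Linf_norm (X j) (\<lambda>w. f j w s)) \<le> 2 ^ (k + 1) * g s" .
    qed
  next
    fix j assume j: "j \<in> {1..k+1}"
    interpret pvm_space "X j" by (rule factors[OF j])
    show "complex_hilbert (hsp (X j))" by (rule hilbert)
    fix s assume s: "s \<in> space R"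
    show "0 \<le> 2 * Linf_norm (X j) (\<lambda>w. f j w s)" using Linf_norm_nonneg[OF Linf[OF j s]] by simp
    show "bounded_linear_on (hsp (X j)) (hsp (X j)) (pvm_integral (X j) (\<lambda>w. f j w s))
        (2 * Linf_norm (X j) (\<lambda>w. f j w s))"
      using pvm_integral(1)[OF Linf[OF j s]] norm_pvm_integral_le[OF Linf[OF j s]]
      by (auto simp: bounded_linear_on_def bounded_ops_def)
  qed
  then show ?thesis by blast
qed

lemma sections_measurable_mono:
  assumes f: "f \<in> borel_measurable (sigma \<Omega> C)" and C: "C \<subseteq> C'" "C' \<subseteq> Pow \<Omega>"
  shows "f \<in> borel_measurable (sigma \<Omega> C')"
proof -
  have "sets (sigma \<Omega> C) \<subseteq> sets (sigma \<Omega> C')"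
    using C sigma_sets_mono'[OF C(1), of \<Omega>] by (simp add: sets_measure_of_conv)
  then show ?thesis using f by (auto simp: measurable_def space_measure_of_conv)
qed

text \<open>
  The countably many generators for the two decompositions are combined, so that one sequence expands
  the vectors of both.
\<close>

lemma common_expansion:
  assumes dec: "Linf_decomposition k X Y \<phi> R f" and dec': "Linf_decomposition k X Y \<phi> R' f'"
    and j: "j \<in> {1..k+1}" and h: "h \<in> vecs (hsp (X j))"
  shows "\<exists>e. (\<forall>i. e i \<in> vecs (hsp (X j))) \<and> (\<forall>n. orthonormal_upto (hsp (X j)) e n) \<and>
    (\<forall>s\<in>space R. (\<lambda>n. vnorm (hsp (X j)) (vdiff (hsp (X j))
      (fourier (hsp (X j)) e n (pvm_integral (X j) (\<lambda>w. f j w s) h)) (pvm_integral (X j) (\<lambda>w. f j w s) h)))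
      \<longlonglongrightarrow> 0) \<and>
    (\<forall>s\<in>space R'. (\<lambda>n. vnorm (hsp (X j)) (vdiff (hsp (X j))
      (fourier (hsp (X j)) e n (pvm_integral (X j) (\<lambda>w. f' j w s) h)) (pvm_integral (X j) (\<lambda>w. f' j w s) h)))
      \<longlonglongrightarrow> 0)"
proof -
  interpret pvm_space "X j" by (rule factors[OF j])
  have f: "(\<lambda>(w, s). f j w s) \<in> borel_measurable (base (X j) \<Otimes>\<^sub>M R)"
    using dec j by (simp only: Linf_decomposition_def)
  have f': "(\<lambda>(w, s). f' j w s) \<in> borel_measurable (base (X j) \<Otimes>\<^sub>M R')"
    using dec' j by (simp only: Linf_decomposition_def)
  obtain C where C: "countable C" "C \<subseteq> sets (base (X j))"
    "\<And>s. s \<in> space R \<Longrightarrow> (\<lambda>w. f j w s) \<in> borel_measurable (sigma (space (base (X j))) C)"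
    by (rule measurable_sections_countably_generated[OF f]) (rule that)
  obtain C' where C': "countable C'" "C' \<subseteq> sets (base (X j))"
    "\<And>s. s \<in> space R' \<Longrightarrow> (\<lambda>w. f' j w s) \<in> borel_measurable (sigma (space (base (X j))) C')"
    by (rule measurable_sections_countably_generated[OF f']) (rule that)
  have CC: "countable (C \<union> C')" "C \<union> C' \<subseteq> sets (base (X j))" using C C' by auto
  have sub: "C \<union> C' \<subseteq> Pow (space (base (X j)))" using CC(2) sets.space_closed by (rule order_trans)
  obtain e where e: "\<And>n. e n \<in> vecs (hsp (X j))" "\<And>n. orthonormal_upto (hsp (X j)) e n"
    "\<And>f. \<lbrakk>f \<in> Linf (X j); f \<in> borel_measurable (sigma (space (base (X j))) (C \<union> C'))\<rbrakk>
      \<Longrightarrow> (\<lambda>n. vnorm (hsp (X j)) (vdiff (hsp (X j)) (fourier (hsp (X j)) e n (pvm_integral (X j) f h))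
            (pvm_integral (X j) f h))) \<longlonglongrightarrow> 0"
    by (rule countable_expansion[OF CC h]) (rule that)
  show ?thesis
  proof (intro exI[of _ e] conjI allI ballI e(1,2))
    fix s assume s: "s \<in> space R"
    have "(\<lambda>w. f j w s) \<in> Linf (X j)" using dec j s by (simp only: Linf_decomposition_def)
    then show "(\<lambda>n. vnorm (hsp (X j)) (vdiff (hsp (X j))
      (fourier (hsp (X j)) e n (pvm_integral (X j) (\<lambda>w. f j w s) h)) (pvm_integral (X j) (\<lambda>w. f j w s) h)))
      \<longlonglongrightarrow> 0"
      by (rule e(3)) (rule sections_measurable_mono[OF C(3)[OF s] Un_upper1 sub])
  next
    fix s assume s: "s \<in> space R'"
    have "(\<lambda>w. f' j w s) \<in> Linf (X j)" using dec' j s by (simp only: Linf_decomposition_def)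
    then show "(\<lambda>n. vnorm (hsp (X j)) (vdiff (hsp (X j))
      (fourier (hsp (X j)) e n (pvm_integral (X j) (\<lambda>w. f' j w s) h)) (pvm_integral (X j) (\<lambda>w. f' j w s) h)))
      \<longlonglongrightarrow> 0"
      by (rule e(3)) (rule sections_measurable_mono[OF C'(3)[OF s] Un_upper2 sub])
  qed
qed

text \<open>
  All matrix coefficients of the two integrands are integrable and have equal integrals. This
  determines the weak equations that single out the Pettis integral.
\<close>

lemma matrix_coefficients_eq:
  assumes dec: "Linf_decomposition k X Y \<phi> R f" and dec': "Linf_decomposition k X Y \<phi> R' f'"
    and b: "\<And>j. j \<in> {1..k} \<Longrightarrow> b j \<in> bounded_ops (hsp (X (j + 1))) (hsp (X j))"
    and h: "h \<in> vecs (hsp (X (k + 1)))" and h': "h' \<in> vecs (hsp (X 1))"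
  shows "integrable R (\<lambda>s. vinner (hsp (X 1))
      (alternating_product (\<lambda>j. pvm_integral (X j) (\<lambda>w. f j w s)) b k h) h') \<and>
    integrable R' (\<lambda>s. vinner (hsp (X 1))
      (alternating_product (\<lambda>j. pvm_integral (X j) (\<lambda>w. f' j w s)) b k h) h') \<and>
    (\<integral>s. vinner (hsp (X 1)) (alternating_product (\<lambda>j. pvm_integral (X j) (\<lambda>w. f j w s)) b k h) h' \<partial>R) =
    (\<integral>s. vinner (hsp (X 1)) (alternating_product (\<lambda>j. pvm_integral (X j) (\<lambda>w. f' j w s)) b k h) h' \<partial>R')"
proof -
  obtain g where g: "operator_fields k (\<lambda>j. hsp (X j)) R (\<lambda>s j. pvm_integral (X j) (\<lambda>w. f j w s))
    (\<lambda>s j. 2 * Linf_norm (X j) (\<lambda>w. f j w s)) g"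
    using operator_fields_decomposition[OF dec] ..
  obtain g' where g': "operator_fields k (\<lambda>j. hsp (X j)) R' (\<lambda>s j. pvm_integral (X j) (\<lambda>w. f' j w s))
    (\<lambda>s j. 2 * Linf_norm (X j) (\<lambda>w. f' j w s)) g'"
    using operator_fields_decomposition[OF dec'] ..
  show ?thesis
  proof (rule integral_alternating_product_eq[OF g g' b _ _ h h'])
    fix j h assume "j \<in> {1..k+1}" "h \<in> vecs (hsp (X j))"
    then show "\<exists>e. (\<forall>i. e i \<in> vecs (hsp (X j))) \<and> (\<forall>n. orthonormal_upto (hsp (X j)) e n) \<and>
      (\<forall>s\<in>space R. (\<lambda>n. vnorm (hsp (X j)) (vdiff (hsp (X j))
        (fourier (hsp (X j)) e n (pvm_integral (X j) (\<lambda>w. f j w s) h)) (pvm_integral (X j) (\<lambda>w. f j w s) h)))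
        \<longlonglongrightarrow> 0) \<and>
      (\<forall>s\<in>space R'. (\<lambda>n. vnorm (hsp (X j)) (vdiff (hsp (X j))
        (fourier (hsp (X j)) e n (pvm_integral (X j) (\<lambda>w. f' j w s) h)) (pvm_integral (X j) (\<lambda>w. f' j w s) h)))
        \<longlonglongrightarrow> 0)"
      by (rule common_expansion[OF dec dec'])
  next
    fix v u assume v: "\<And>j. j \<in> {1..k+1} \<Longrightarrow> v j \<in> vecs (hsp (X j))"
      and u: "\<And>j. j \<in> {1..k+1} \<Longrightarrow> u j \<in> vecs (hsp (X j))"
    have "(\<integral>s. (\<Prod>j\<in>{1..k+1}. vinner (hsp (X j)) (pvm_integral (X j) (\<lambda>w. f j w s) (v j)) (u j)) \<partial>R) =
        (\<Sum>p\<in>(\<Pi>\<^sub>E j\<in>{1..k+1}. {..<4}). (\<Prod>j\<in>{1..k+1}. \<i> ^ p j) *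
        (\<integral>s. (\<Prod>j\<in>{1..k+1}. \<integral>w. f j w s \<partial>pvm_measure (X j) (polar_family v u p j)) \<partial>R))"
      by (rule rank_one_integral(2)[OF dec v u])
    also have "\<dots> = (\<Sum>p\<in>(\<Pi>\<^sub>E j\<in>{1..k+1}. {..<4}). (\<Prod>j\<in>{1..k+1}. \<i> ^ p j) *
        (\<integral>s. (\<Prod>j\<in>{1..k+1}. \<integral>w. f' j w s \<partial>pvm_measure (X j) (polar_family v u p j)) \<partial>R'))"
      by (intro sum.cong refl arg_cong2[where f = "(*)"]
          integral_product_diagonal_eq[OF dec dec' polar_family_closed[OF v u]])
    also have "\<dots> = (\<integral>s. (\<Prod>j\<in>{1..k+1}. vinner (hsp (X j)) (pvm_integral (X j) (\<lambda>w. f' j w s) (v j)) (u j)) \<partial>R')"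
      by (rule rank_one_integral(2)[OF dec' v u, symmetric])
    finally have "(\<integral>s. (\<Prod>j\<in>{1..k+1}. vinner (hsp (X j)) (pvm_integral (X j) (\<lambda>w. f j w s) (v j)) (u j)) \<partial>R) =
        (\<integral>s. (\<Prod>j\<in>{1..k+1}. vinner (hsp (X j)) (pvm_integral (X j) (\<lambda>w. f' j w s) (v j)) (u j)) \<partial>R')" .
    then show "integrable R (\<lambda>s. \<Prod>j\<in>{1..k+1}. vinner (hsp (X j)) (pvm_integral (X j) (\<lambda>w. f j w s) (v j)) (u j)) \<and>
        integrable R' (\<lambda>s. \<Prod>j\<in>{1..k+1}. vinner (hsp (X j)) (pvm_integral (X j) (\<lambda>w. f' j w s) (v j)) (u j)) \<and>
        (\<integral>s. (\<Prod>j\<in>{1..k+1}. vinner (hsp (X j)) (pvm_integral (X j) (\<lambda>w. f j w s) (v j)) (u j)) \<partial>R) =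
        (\<integral>s. (\<Prod>j\<in>{1..k+1}. vinner (hsp (X j)) (pvm_integral (X j) (\<lambda>w. f' j w s) (v j)) (u j)) \<partial>R')"
      using rank_one_integral(1)[OF dec v u] rank_one_integral(1)[OF dec' v u] by blast
  qed
qed

end

theorem theorem4p2p12:
  fixes k :: nat
    and X :: "nat \<Rightarrow> ('w, 'h) pvm_data"
    and Y :: "(nat \<Rightarrow> 'w, 't) pvm_data"
    and \<tau> :: "(nat \<Rightarrow> 'h) \<Rightarrow> 't"
    and \<phi> :: "(nat \<Rightarrow> 'w) \<Rightarrow> complex"
    and R :: "'s measure" and f :: "nat \<Rightarrow> 'w \<Rightarrow> 's \<Rightarrow> complex"
    and R' :: "'r measure" and f' :: "nat \<Rightarrow> 'w \<Rightarrow> 'r \<Rightarrow> complex"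
  assumes "k \<ge> 1"
    and "\<And>j. j \<in> {1..k+1} \<Longrightarrow> pvm_space (X j)"
    and "product_pvm Y {1..k+1} X \<tau>"
    and "\<phi> \<in> Linf_tensor TYPE('s) k X Y"
    and "Linf_decomposition k X Y \<phi> R f"
    and "Linf_decomposition k X Y \<phi> R' f'"
  shows "multiple_operator_integral k X R f = multiple_operator_integral k X R' f'"
  unfolding multiple_operator_integral_def
proof (rule restrict_ext)
  fix b assume "b \<in> (\<Pi>\<^sub>E j\<in>{1..k}. bounded_ops (hsp (X (j + 1))) (hsp (X j)))"
  then have b: "\<And>j. j \<in> {1..k} \<Longrightarrow> b j \<in> bounded_ops (hsp (X (j + 1))) (hsp (X j))" by auto
  interpret pvm_family k X Y \<tau> by (rule pvm_family.intro[OF assms(2,3)])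
  note eq = matrix_coefficients_eq[OF assms(5,6) b]
  \<comment> \<open>The conditions that define the two Pettis integrals are equivalent, so the descriptions agree
    whether or not an operator satisfies them.\<close>
  have "(\<forall>h\<in>vecs (hsp (X (k + 1))). \<forall>h'\<in>vecs (hsp (X 1)).
      integrable R (\<lambda>s. vinner (hsp (X 1)) (alternating_product (\<lambda>j. pvm_integral (X j) (\<lambda>w. f j w s)) b k h) h') \<and>
      vinner (hsp (X 1)) (T h) h' =
        (\<integral>s. vinner (hsp (X 1)) (alternating_product (\<lambda>j. pvm_integral (X j) (\<lambda>w. f j w s)) b k h) h' \<partial>R)) =
    (\<forall>h\<in>vecs (hsp (X (k + 1))). \<forall>h'\<in>vecs (hsp (X 1)).
      integrable R' (\<lambda>s. vinner (hsp (X 1)) (alternating_product (\<lambda>j. pvm_integral (X j) (\<lambda>w. f' j w s)) b k h) h') \<and>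
      vinner (hsp (X 1)) (T h) h' =
        (\<integral>s. vinner (hsp (X 1)) (alternating_product (\<lambda>j. pvm_integral (X j) (\<lambda>w. f' j w s)) b k h) h' \<partial>R'))" for T
    using eq by (intro ball_cong refl) simp
  then show "pettis_integral (hsp (X (k + 1))) (hsp (X 1)) R
        (\<lambda>s. alternating_product (\<lambda>j. pvm_integral (X j) (\<lambda>w. f j w s)) b k) =
      pettis_integral (hsp (X (k + 1))) (hsp (X 1)) R'
        (\<lambda>s. alternating_product (\<lambda>j. pvm_integral (X j) (\<lambda>w. f' j w s)) b k)"
    unfolding pettis_integral_def by presburger
qed

end
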